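(* Let $\mathcal{G}$ denote the family of toroidal graphs that contain no adjacent triangles, contain no $6$-cycles, and contain no $l$-cycles for some $l \in \{5,7\}$ (i.e. each graph in $\mathcal{G}$ has no adjacent triangles and either has neither $5$-cycles nor $6$-cycles, or has neither $6$-cycles nor $7$-cycles). Every graph in $\mathcal{G}$ is $(3,1)^*$-choosable.
   Context: All graphs are finite, simple and undirected. A toroidal graph $G=(V,E,F)$ is a graph embedded on the torus, where $V$, $E$, $F$ are its sets of vertices, edges and faces. A face of an embedded graph is incident with the edges and vertices on its boundary. The degree of a face is the number of edges incident with it, where each cut-edge is counted twice; a $3$-face is a face of degree $3$. Two faces are adjacent if they share a common edge; two adjacent $3$-faces are referred to as adjacent triangles. An $m$-cycle is a cycle of length $m$ in $G$. A list assignment $L$ of $G$ assigns to each vertex $v \in V(G)$ a set of colors $L(v)$. For a non-negative integer $d$, an $(L,d)^*$-coloring of $G$ is a mapping $\phi$ that assigns a color $\phi(v) \in L(v)$ to each vertex $v \in V(G)$ such that at most $d$ neighbors of $v$ receive the color $\phi(v)$. For integers $m \geq d \geq 0$, $G$ is $(m,d)^*$-choosable if $G$ admits an $(L,d)^*$-coloring for every list assignment $L$ with $|L(v)| \geq m$ for all $v \in V(G)$.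
   Formalization: "No adjacent triangles" is taken to mean that no two distinct 3-cycles share an edge, rather than no two adjacent 3-faces; with 3-faces the claim fails, since a pendant edge drawn inside each 3-face removes all 3-faces without creating cycles. *)

theory Defs
  imports "HOL-Analysis.Analysis"
begin

section \<open>Finite simple graphs and cycles\<close>

definition simple_graph :: "'a set \<Rightarrow> 'a set set \<Rightarrow> bool" where
  "simple_graph V E \<longleftrightarrow> finite V \<and> (\<forall>e\<in>E. e \<subseteq> V \<and> card e = 2)"

text \<open>A cycle is given by the list of its vertices in cyclic order, without repeating the first.\<close>

definition graph_cycle :: "'a set set \<Rightarrow> 'a list \<Rightarrow> bool" where
  "graph_cycle E xs \<longleftrightarrow> 3 \<le> length xs \<and> distinct xs \<and>
     (\<forall>i<length xs. {xs ! i, xs ! (Suc i mod length xs)} \<in> E)"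

definition contains_cycle :: "'a set set \<Rightarrow> nat \<Rightarrow> bool" where
  "contains_cycle E m \<longleftrightarrow> (\<exists>xs. graph_cycle E xs \<and> length xs = m)"

text \<open>
  Triangles are 3-cycles, identified with their vertex sets; they need not bound a face of an
  embedding. Demanding only that no two 3-faces share an edge would make the
  condition empty for the purpose of colouring: a pendant edge drawn inside a 3-face turns it into
  a 5-face and creates no cycle. The theorem would then be false for 6- and 7-cycles.
  Take the theta graph made of three paths of length 4 (11 vertices, 12 edges)
  and replace each edge \<open>xy\<close> by a copy of \<open>K\<^sub>5\<close> minus an edge \<open>pq\<close> on \<open>x, y, z, p, q\<close>. All cycles have
  length at most 5 or at least 8, and in a 3-colouring with defect 1 every copy
  contains a monochromatic edge at \<open>x\<close> or \<open>y\<close>, but there are 12 copies and only 11 such vertices.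
\<close>

definition triangle :: "'a set set \<Rightarrow> 'a set \<Rightarrow> bool" where
  "triangle E T \<longleftrightarrow> (\<exists>xs. graph_cycle E xs \<and> length xs = 3 \<and> set xs = T)"

definition adjacent_triangles :: "'a set set \<Rightarrow> 'a set \<Rightarrow> 'a set \<Rightarrow> bool" where
  "adjacent_triangles E S T \<longleftrightarrow>
     triangle E S \<and> triangle E T \<and> S \<noteq> T \<and> (\<exists>e\<in>E. e \<subseteq> S \<and> e \<subseteq> T)"


section \<open>Graphs embedded on the torus\<close>

definition torus :: "(complex \<times> complex) set" where
  "torus = sphere 0 1 \<times> sphere 0 1"

text \<open>
  Vertices are drawn as the points \<open>p v\<close> and edges as the simple arcs \<open>\<gamma> e\<close>, which meet each other
  and the vertex points only at common ends. The faces, that is the components of the complement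
  of the drawing in the torus, are not required to be discs.
\<close>

definition torus_embedding ::
  "'a set \<Rightarrow> 'a set set \<Rightarrow> ('a \<Rightarrow> complex \<times> complex) \<Rightarrow> ('a set \<Rightarrow> real \<Rightarrow> complex \<times> complex) \<Rightarrow> bool"
where
  "torus_embedding V E p \<gamma> \<longleftrightarrow>
     inj_on p V \<and> p ` V \<subseteq> torus \<and>
     (\<forall>e\<in>E. arc (\<gamma> e) \<and> path_image (\<gamma> e) \<subseteq> torus \<and>
            {pathstart (\<gamma> e), pathfinish (\<gamma> e)} = p ` e \<and>
            path_image (\<gamma> e) \<inter> p ` V = p ` e) \<and>
     (\<forall>e\<in>E. \<forall>f\<in>E. e \<noteq> f \<longrightarrow> path_image (\<gamma> e) \<inter> path_image (\<gamma> f) = p ` (e \<inter> f))"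

definition toroidal :: "'a set \<Rightarrow> 'a set set \<Rightarrow> bool" where
  "toroidal V E \<longleftrightarrow> simple_graph V E \<and> (\<exists>p \<gamma>. torus_embedding V E p \<gamma>)"


section \<open>Defective list colouring\<close>

definition defective_list_coloring ::
  "'a set \<Rightarrow> 'a set set \<Rightarrow> ('a \<Rightarrow> 'c set) \<Rightarrow> nat \<Rightarrow> ('a \<Rightarrow> 'c) \<Rightarrow> bool"
where
  "defective_list_coloring V E L d \<phi> \<longleftrightarrow>
     (\<forall>v\<in>V. \<phi> v \<in> L v \<and> card {u\<in>V. {u, v} \<in> E \<and> \<phi> u = \<phi> v} \<le> d)"

text \<open>
  The type argument is the type of colours. Infinite lists are allowed; since \<^const>\<open>card\<close> is 0 on
  infinite sets, the size bound is imposed on finite lists only.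
\<close>

definition defective_choosable ::
  "'c itself \<Rightarrow> nat \<Rightarrow> nat \<Rightarrow> 'a set \<Rightarrow> 'a set set \<Rightarrow> bool"
where
  "defective_choosable _ m d V E \<longleftrightarrow>
     (\<forall>L :: 'a \<Rightarrow> 'c set. (\<forall>v\<in>V. finite (L v) \<longrightarrow> m \<le> card (L v)) \<longrightarrow>
        (\<exists>\<phi>. defective_list_coloring V E L d \<phi>))"

end

theory Submission
  imports Defs "HOL-Combinatorics.Orbits"
begin

text \<open>
  A counterexample with fewest vertices, with lists of size 3, has minimum degree 3, at most \<open>2 d - 6\<close> neighbours
  of degree 3 around a vertex of degree \<open>d\<close>, and no triangle with degrees 3, 4, 4. Such a graph
  on the torus is excluded by discharging along faces, once it has a rotation system
  with at least \<open>|E| - |V|\<close> faces.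

  The rotation system is obtained without straightening the arcs of the embedding. The torus is tiled by small bricks
  whose adjacency graph is the triangular lattice. Bricks meeting a vertex and the first thirds of its
  edges, together with part of those meeting the middle thirds, form connected branch sets, so
  the graph is a minor of that lattice; the branch sets can be enlarged to cover all bricks.
  Switching on an edge composes the rotation of the lattice with a transposition and changes the number of
  orbits by at most one. Switching on edges inside the branch sets until the orbits are the branch sets, and comparing with
  all edges switched on, where the orbits are the triangular faces, bounds the number of faces.
\<close>

section \<open>Orbits of permutations and quotients of rotation systems\<close>

text \<open>Topology enters through connectedness and distances alone; discharging needs only enough
  boundary walks of some rotation system, not the faces of the drawing. Their number F comes from a
  cancellation. With N bricks the lattice has 6 N darts, at least N vertex orbits and at least 2 N
  face orbits, so twice these orbits balance the darts. Each edge spent inside a branch set or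
  discarded costs at most one orbit, and what remains is F \<ge> |E| - |V|. If each face hands at
  least one unit to its corners, the charges "1 minus half the degree plus corner shares" have a
  nonnegative sum over the vertices. Vertices of degree 3 may be positive, but the reducible
  configurations make all their neighbours larger and bound how many of them a larger vertex has,
  and the larger vertices absorb more than there is. The two cases exclude different corner
  sequences, hence two weightings.\<close>

lemma orbit_eq_permutes:
  assumes "f permutes D" "finite D" "y \<in> orbit f x"
  shows "orbit f y = orbit f x"
  using orbit_cyclic_eq3[OF cyclic_on_orbit[OF assms(1,2)] assms(3)] .

lemma self_in_orbit_permutes:
  assumes "f permutes D" "finite D"
  shows "x \<in> orbit f x"
  by (rule permutation_self_in_orbit) (use assms permutation_permutes in blast)

lemma orbit_swap_other:
  assumes f: "f permutes D" "finite D" and a: "a \<notin> orbit f x" and b: "b \<notin> orbit f x"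
  shows "orbit (f(a := f b, b := f a)) x = orbit f x"
  by (rule orbit_cong) (use assms self_in_orbit_permutes[OF f] in auto)

lemma swap_permutes:
  assumes "f permutes D" "a \<in> D" "b \<in> D"
  shows "f(a := f b, b := f a) permutes D"
proof -
  have "f \<circ> Transposition.transpose a b = f(a := f b, b := f a)"
    by (auto simp: fun_eq_iff Transposition.transpose_def)
  then show ?thesis
    using permutes_compose[OF permutes_swap_id[OF assms(2,3)] assms(1)] by simp
qed

text \<open>Orbits avoiding \<open>a\<close> and \<open>b\<close> survive unchanged; at most two are
  lost, and the new orbit of \<open>a\<close> is not among the survivors.\<close>

lemma card_orbits_swap_ge:
  assumes f: "f permutes D" "finite D" and ab: "a \<in> D" "b \<in> D"
  shows "card (orbit f ` D) \<le> card (orbit (f(a := f b, b := f a)) ` D) + 1"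
proof -
  let ?g = "f(a := f b, b := f a)"
  have g: "?g permutes D" by (rule swap_permutes[OF f(1) ab])
  let ?A = "orbit f ` D - {orbit f a, orbit f b}"
  have "?A \<subseteq> orbit ?g ` D"
  proof
    fix Q assume "Q \<in> ?A"
    then obtain x where x: "x \<in> D" "Q = orbit f x" "Q \<noteq> orbit f a" "Q \<noteq> orbit f b" by auto
    then have "a \<notin> orbit f x" "b \<notin> orbit f x" using orbit_eq_permutes[OF f] by auto
    then have "orbit ?g x = Q" using orbit_swap_other[OF f] x by simp
    then show "Q \<in> orbit ?g ` D" using x by auto
  qed
  moreover have "orbit ?g a \<notin> ?A"
  proof
    assume "orbit ?g a \<in> ?A"
    then obtain x where x: "orbit ?g a = orbit f x" "orbit f x \<noteq> orbit f a" by auto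
    have "a \<in> orbit f x" using self_in_orbit_permutes[OF g f(2), of a] x by simp
    then show False using orbit_eq_permutes[OF f] x(2) by auto
  qed
  ultimately have "insert (orbit ?g a) ?A \<subseteq> orbit ?g ` D" using ab by auto
  then have 1: "card (insert (orbit ?g a) ?A) \<le> card (orbit ?g ` D)"
    using f(2) by (intro card_mono) auto
  have "card (insert (orbit ?g a) ?A) = card ?A + 1" using \<open>orbit ?g a \<notin> ?A\<close> f(2) by simp
  moreover have "card (orbit f ` D) \<le> card ?A + 2"
    using diff_card_le_card_Diff[of "{orbit f a, orbit f b}" "orbit f ` D"]
      card_insert_le_m1[of 2 "{orbit f b}" "orbit f a"] by simp
  ultimately show ?thesis using 1 by simp
qed

text \<open>After the swap, \<open>a\<close> goes where \<open>b\<close> went and runs through the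
  old cycle of \<open>b\<close>, which avoids \<open>a\<close>; by symmetry \<open>b\<close> leads
  through that of \<open>a\<close>. Two cycles are spliced into one.\<close>

lemma orbit_swap_merge:
  assumes f: "f permutes D" "finite D" and ab: "a \<in> D" "b \<in> D" and neq: "b \<notin> orbit f a"
  shows "orbit (f(a := f b, b := f a)) a = orbit f a \<union> orbit f b"
    and "orbit (f(a := f b, b := f a)) b = orbit f a \<union> orbit f b"
proof -
  have sub: "orbit f b \<subseteq> orbit (f(a := f b, b := f a)) a"
    if ab: "a \<in> D" "b \<in> D" and neq: "b \<notin> orbit f a" for a b
  proof
    let ?g = "f(a := f b, b := f a)"
    have nab: "a \<notin> orbit f b"
      using neq orbit_eq_permutes[OF f] self_in_orbit_permutes[OF f] by blast
    fix x assume "x \<in> orbit f b"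
    then show "x \<in> orbit ?g a"
    proof induction
      case base
      have "?g a = f b" using neq self_in_orbit_permutes[OF f, of a] by auto
      then show ?case using orbit.base[of ?g a] by metis
    next
      case (step y)
      have "?g a = f b" using neq self_in_orbit_permutes[OF f, of a] by auto
      then have base: "f b \<in> orbit ?g a" using orbit.base[of ?g a] by metis
      show ?case
      proof (cases "y = b")
        case True then show ?thesis using base by (simp only:)
      next
        case False
        then have "?g y = f y" using step(1) nab by auto
        then show ?thesis using orbit.step[OF step(2)] by metis
      qed
    qed
  qed
  let ?g = "f(a := f b, b := f a)"
  have g: "?g permutes D" by (rule swap_permutes[OF f(1) ab])
  have nab: "a \<notin> orbit f b"
    using neq orbit_eq_permutes[OF f] self_in_orbit_permutes[OF f] by blast
  have s1: "orbit f b \<subseteq> orbit ?g a" using sub[OF ab neq] .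
  have "f(b := f a, a := f b) = ?g" using neq self_in_orbit_permutes[OF f, of a] by (auto simp: fun_eq_iff)
  then have s2: "orbit f a \<subseteq> orbit ?g b" using sub[OF ab(2,1) nab] by simp
  have eq: "orbit ?g b = orbit ?g a"
    using s1 self_in_orbit_permutes[OF f, of b] orbit_eq_permutes[OF g f(2)] by blast
  have step: "?g y \<in> orbit f a \<union> orbit f b" if "y \<in> orbit f a \<union> orbit f b" for y
    using that by (auto intro: orbit.intros)
  have "orbit ?g a \<subseteq> orbit f a \<union> orbit f b"
  proof
    fix x assume "x \<in> orbit ?g a"
    then show "x \<in> orbit f a \<union> orbit f b"
      by induction (use step self_in_orbit_permutes[OF f] in blast)+
  qed
  then show "orbit ?g a = orbit f a \<union> orbit f b" using s1 s2 eq by blast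
  then show "orbit ?g b = orbit f a \<union> orbit f b" using eq by simp
qed

text \<open>The strict decrease is what makes a choice with fewest orbits saturated in
  \<open>switched_spanning\<close>.\<close>

lemma card_orbits_swap_merge:
  assumes f: "f permutes D" "finite D" and ab: "a \<in> D" "b \<in> D" and neq: "b \<notin> orbit f a"
  shows "card (orbit (f(a := f b, b := f a)) ` D) < card (orbit f ` D)"
proof -
  let ?g = "f(a := f b, b := f a)"
  let ?O = "orbit f a \<union> orbit f b"
  have g: "?g permutes D" by (rule swap_permutes[OF f(1) ab])
  have "orbit ?g ` D \<subseteq> insert ?O (orbit f ` D - {orbit f a, orbit f b})"
  proof
    fix Q assume "Q \<in> orbit ?g ` D"
    then obtain x where x: "x \<in> D" "Q = orbit ?g x" by auto
    show "Q \<in> insert ?O (orbit f ` D - {orbit f a, orbit f b})"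
    proof (cases "x \<in> ?O")
      case True
      then have "x \<in> orbit ?g a" using orbit_swap_merge[OF f ab neq] by simp
      then have "Q = ?O" using orbit_eq_permutes[OF g f(2)] x orbit_swap_merge[OF f ab neq] by auto
      then show ?thesis by simp
    next
      case False
      then have "a \<notin> orbit f x" "b \<notin> orbit f x"
        using orbit_eq_permutes[OF f] self_in_orbit_permutes[OF f] by blast+
      then show ?thesis
        using orbit_swap_other[OF f] x self_in_orbit_permutes[OF f] by auto
    qed
  qed
  then have "card (orbit ?g ` D) \<le> card (insert ?O (orbit f ` D - {orbit f a, orbit f b}))"
    using f(2) by (intro card_mono) auto
  also have "\<dots> \<le> card (orbit f ` D - {orbit f a, orbit f b}) + 1"
    by (simp add: card_insert_if f(2))
  also have "card (orbit f ` D - {orbit f a, orbit f b}) = card (orbit f ` D) - 2"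
  proof -
    have "orbit f a \<noteq> orbit f b" using neq self_in_orbit_permutes[OF f, of b] by auto
    then show ?thesis using ab f(2) by (subst card_Diff_subset) auto
  qed
  also have "card (orbit f ` D) - 2 + 1 < card (orbit f ` D)"
  proof -
    have "orbit f a \<noteq> orbit f b" using neq self_in_orbit_permutes[OF f, of b] by auto
    then have "card {orbit f a, orbit f b} = 2" by simp
    moreover have "{orbit f a, orbit f b} \<subseteq> orbit f ` D" using ab by auto
    ultimately have "2 \<le> card (orbit f ` D)" using f(2) by (metis card_mono finite_imageI)
    then show ?thesis by simp
  qed
  finally show ?thesis .
qed

text \<open>For a set \<open>T\<close> of darts closed under the edge involution \<open>\<alpha>\<close>, the orbits of \<open>switched \<sigma> \<alpha> T\<close> are the
  boundary walks of the ribbon graph that has only the edges in \<open>T\<close>: they are the vertices for \<open>T = {}\<close> and the faces if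
  \<open>T\<close> contains all darts.\<close>

definition switched :: "('d \<Rightarrow> 'd) \<Rightarrow> ('d \<Rightarrow> 'd) \<Rightarrow> 'd set \<Rightarrow> 'd \<Rightarrow> 'd" where
  "switched \<sigma> \<alpha> T x = \<sigma> (if x \<in> T then \<alpha> x else x)"

text \<open>Deleting the elements outside \<open>K\<close> from each cycle of \<open>f\<close> keeps
  the cyclic order of the rest. This serves to forget the lattice darts that represent no edge of
  the graph.\<close>

lemma first_return:
  assumes f: "f permutes D" "finite D" and K: "K \<subseteq> D"
  obtains \<tau> where "\<tau> permutes K"
    "\<And>x. x \<in> K \<Longrightarrow> \<exists>n>0. \<tau> x = (f ^^ n) x \<and> (\<forall>m. 0 < m \<longrightarrow> m < n \<longrightarrow> (f ^^ m) x \<notin> K)"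
    "\<And>x y. x \<in> K \<Longrightarrow> y \<in> K \<Longrightarrow> y \<in> orbit f x \<Longrightarrow> y \<in> orbit \<tau> x"
proof -
  define N where "N x = (LEAST n. 0 < n \<and> (f ^^ n) x \<in> K)" for x
  have fin: "finite K" using K f(2) finite_subset by blast
  have ex: "\<exists>n. 0 < n \<and> (f ^^ n) x \<in> K" if "x \<in> K" for x
    using self_in_orbit_permutes[OF f, of x] that unfolding orbit_altdef by force
  have N: "0 < N x" "(f ^^ N x) x \<in> K" if "x \<in> K" for x
    using LeastI_ex[OF ex[OF that]] unfolding N_def by auto
  have Nmin: "(f ^^ m) x \<notin> K" if "0 < m" "m < N x" for m x
    using not_less_Least[of m "\<lambda>n. 0 < n \<and> (f ^^ n) x \<in> K"] that unfolding N_def by auto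
  define \<tau> where "\<tau> x = (if x \<in> K then (f ^^ N x) x else x)" for x
  have injf: "inj (f ^^ n)" for n using permutes_inj[OF f(1)] inj_fn by blast
  \<comment> \<open>Equal return points cancel to put \<open>x\<close> on the path of
    \<open>y\<close>, where it would be an earlier return unless the times agree.\<close>
  have aux: "x = y" if "x \<in> K" "y \<in> K" "(f ^^ N x) x = (f ^^ N y) y" "N x \<le> N y" for x y
  proof -
    have "(f ^^ N y) y = (f ^^ N x) ((f ^^ (N y - N x)) y)"
      using that(4) by (metis comp_apply funpow_add le_add_diff_inverse)
    then have e: "x = (f ^^ (N y - N x)) y" using that(3) injf by (metis injD)
    show ?thesis
    proof (cases "N y - N x = 0")
      case True then show ?thesis using e by simp
    next
      case False
      then have "(f ^^ (N y - N x)) y \<notin> K" using Nmin[of "N y - N x" y] N(1)[OF that(1)] by simp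
      then show ?thesis using e that by simp
    qed
  qed
  have "inj_on \<tau> K"
    unfolding inj_on_def \<tau>_def by (metis aux nle_le)
  moreover have "\<tau> ` K \<subseteq> K" using N by (auto simp: \<tau>_def)
  ultimately have "bij_betw \<tau> K K"
    using fin by (simp add: bij_betw_def endo_inj_surj)
  then have perm: "\<tau> permutes K" by (auto intro: bij_imp_permutes simp: \<tau>_def)
  \<comment> \<open>Strong induction on the travel time: split off the first return and continue
    from there.\<close>
  have orb: "(f ^^ n) x \<in> K \<Longrightarrow> x \<in> K \<Longrightarrow> 0 < n \<Longrightarrow> (f ^^ n) x \<in> orbit \<tau> x" for n x
  proof (induction n arbitrary: x rule: less_induct)
    case (less n)
    have le: "N x \<le> n" using Nmin[of n x] less.prems by (meson not_less)
    have t: "\<tau> x = (f ^^ N x) x" using less.prems by (simp add: \<tau>_def)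
    show ?case
    proof (cases "N x = n")
      case True then show ?thesis using t orbit.base[of \<tau> x] by simp
    next
      case False
      then have lt: "N x < n" using le by simp
      have e: "(f ^^ n) x = (f ^^ (n - N x)) (\<tau> x)"
        unfolding t using le by (metis add.commute comp_apply funpow_add le_add_diff_inverse)
      have "(f ^^ (n - N x)) (\<tau> x) \<in> orbit \<tau> (\<tau> x)"
        using less.IH[of "n - N x" "\<tau> x"] less.prems lt N[OF less.prems(2)] e t by simp
      then show ?thesis using e by (simp add: orbit_subset)
    qed
  qed
  show ?thesis
  proof (rule that[OF perm])
    fix x assume "x \<in> K"
    then show "\<exists>n>0. \<tau> x = (f ^^ n) x \<and> (\<forall>m. 0 < m \<longrightarrow> m < n \<longrightarrow> (f ^^ m) x \<notin> K)"
      using N(1) Nmin by (intro exI[of _ "N x"]) (auto simp: \<tau>_def)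
  next
    fix x y assume "x \<in> K" "y \<in> K" "y \<in> orbit f x"
    then show "y \<in> orbit \<tau> x" using orb unfolding orbit_altdef[of f] by auto
  qed
qed

lemma switched_permutes:
  assumes "\<sigma> permutes D" "\<alpha> permutes D" "\<And>x. \<alpha> (\<alpha> x) = x" "T \<subseteq> D" "\<alpha> ` T \<subseteq> T"
  shows "switched \<sigma> \<alpha> T permutes D"
proof -
  have "(\<lambda>x. if x \<in> T then \<alpha> x else x) permutes D"
  proof (rule bij_imp_permutes)
    show "bij_betw (\<lambda>x. if x \<in> T then \<alpha> x else x) D D"
      by (rule bij_betw_byWitness[where f' = "\<lambda>x. if x \<in> T then \<alpha> x else x"])
        (use assms permutes_in_image[OF assms(2)] in auto)
    show "(if x \<in> T then \<alpha> x else x) = x" if "x \<notin> D" for x using that assms by auto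
  qed
  from permutes_compose[OF this assms(1)] show ?thesis
    by (simp add: switched_def[abs_def] comp_def)
qed

text \<open>Links switching an edge with the swap lemmas: the images of its two darts are
  exchanged.\<close>

lemma switched_toggle:
  assumes "\<And>x. \<alpha> (\<alpha> x) = x" "d \<notin> T" "\<alpha> ` T \<subseteq> T"
  shows "switched \<sigma> \<alpha> (insert d (insert (\<alpha> d) T)) =
         (switched \<sigma> \<alpha> T)(d := switched \<sigma> \<alpha> T (\<alpha> d), \<alpha> d := switched \<sigma> \<alpha> T d)"
proof -
  have "\<alpha> d \<notin> T" using assms by (metis image_subset_iff)
  then show ?thesis using assms by (auto simp: switched_def fun_eq_iff)
qed

lemma switched_untoggle:
  assumes "\<And>x. \<alpha> (\<alpha> x) = x" "d \<in> T" "\<alpha> ` T \<subseteq> T"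
  shows "switched \<sigma> \<alpha> (T - {d, \<alpha> d}) =
         (switched \<sigma> \<alpha> T)(d := switched \<sigma> \<alpha> T (\<alpha> d), \<alpha> d := switched \<sigma> \<alpha> T d)"
proof -
  have "\<alpha> d \<in> T" using assms by (metis image_subset_iff)
  then show ?thesis using assms by (auto simp: switched_def fun_eq_iff)
qed

text \<open>\<open>R\<close> consists of \<open>card R / 2\<close> edges, each changing the number
  of orbits by at most one; the doubled form avoids the division. As a toggle is undone by a toggle,
  the single swap bound gives both directions.\<close>

lemma card_orbits_switched:
  assumes "finite D" "\<sigma> permutes D" "\<alpha> permutes D" "\<And>x. \<alpha> (\<alpha> x) = x" "\<And>x. x \<in> D \<Longrightarrow> \<alpha> x \<noteq> x"
    and T: "T \<subseteq> D" "\<alpha> ` T \<subseteq> T" and R: "R \<subseteq> D" "\<alpha> ` R \<subseteq> R" "T \<inter> R = {}"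
  shows "2 * card (orbit (switched \<sigma> \<alpha> T) ` D) \<le> 2 * card (orbit (switched \<sigma> \<alpha> (T \<union> R)) ` D) + card R
       \<and> 2 * card (orbit (switched \<sigma> \<alpha> (T \<union> R)) ` D) \<le> 2 * card (orbit (switched \<sigma> \<alpha> T) ` D) + card R"
  using R
proof (induction "card R" arbitrary: R rule: less_induct)
  case less
  have finR: "finite R" using less.prems assms(1) finite_subset by blast
  show ?case
  proof (cases "R = {}")
    case True then show ?thesis by simp
  next
    case False
    then obtain d where d: "d \<in> R" by auto
    then have ad: "\<alpha> d \<in> R" using less.prems by auto
    have dne: "\<alpha> d \<noteq> d" using d less.prems assms(5) by auto
    let ?R = "R - {d, \<alpha> d}"
    have c: "card R = card ?R + 2"
    proof -
      have "card {d, \<alpha> d} \<le> card R" by (rule card_mono) (use finR d ad in auto)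
      then show ?thesis using card_Diff_subset[of "{d, \<alpha> d}" R] d ad dne finR by auto
    qed
    have inj: "\<alpha> x = \<alpha> y \<longleftrightarrow> x = y" for x y by (metis assms(4))
    have cl: "\<alpha> ` ?R \<subseteq> ?R" using less.prems(2) assms(4) inj by auto
    have IH: "2 * card (orbit (switched \<sigma> \<alpha> T) ` D) \<le> 2 * card (orbit (switched \<sigma> \<alpha> (T \<union> ?R)) ` D) + card ?R
       \<and> 2 * card (orbit (switched \<sigma> \<alpha> (T \<union> ?R)) ` D) \<le> 2 * card (orbit (switched \<sigma> \<alpha> T) ` D) + card ?R"
      by (rule less.hyps) (use c cl less.prems in auto)
    let ?f = "switched \<sigma> \<alpha> (T \<union> ?R)" and ?g = "switched \<sigma> \<alpha> (T \<union> R)"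
    have cl': "\<alpha> ` (T \<union> ?R) \<subseteq> T \<union> ?R" using cl T by auto
    have cl2: "\<alpha> ` (T \<union> R) \<subseteq> T \<union> R" using less.prems T by auto
    have f: "?f permutes D" by (rule switched_permutes[OF assms(2,3,4)]) (use T cl' less.prems in auto)
    have g: "?g permutes D" by (rule switched_permutes[OF assms(2,3,4)]) (use T cl2 less.prems in auto)
    have dT: "d \<notin> T \<union> ?R" using d less.prems by auto
    have eq1: "T \<union> R = insert d (insert (\<alpha> d) (T \<union> ?R))" using d ad by auto
    have fg: "?g = ?f(d := ?f (\<alpha> d), \<alpha> d := ?f d)"
      by (subst eq1) (rule switched_toggle[OF assms(4) dT cl'])
    have eq2: "T \<union> ?R = (T \<union> R) - {d, \<alpha> d}" using d ad less.prems by auto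
    have gf: "?f = ?g(d := ?g (\<alpha> d), \<alpha> d := ?g d)"
      by (subst eq2) (rule switched_untoggle[OF assms(4) _ cl2], use d in auto)
    have dD: "d \<in> D" "\<alpha> d \<in> D" using d ad less.prems by auto
    have "card (orbit ?f ` D) \<le> card (orbit ?g ` D) + 1"
      using card_orbits_swap_ge[OF f assms(1) dD] fg by simp
    moreover have "card (orbit ?g ` D) \<le> card (orbit ?f ` D) + 1"
      using card_orbits_swap_ge[OF g assms(1) dD] gf by simp
    ultimately show ?thesis using IH c by simp
  qed
qed

text \<open>A replacement for spanning trees of the fibres of \<open>\<beta>\<close>: among the edge
  sets inside fibres, \<open>T\<close> has fewest orbits, so no toggle can merge two of them.
  \<open>conn\<close> says that a fibre is not split by any set closed under \<open>\<sigma>\<close>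
  and the inner edges.\<close>

lemma switched_spanning:
  assumes "finite D" "\<sigma> permutes D" "\<alpha> permutes D" "\<And>x. \<alpha> (\<alpha> x) = x"
    and \<sigma>\<beta>: "\<And>x. x \<in> D \<Longrightarrow> \<beta> (\<sigma> x) = \<beta> x"
    and conn: "\<And>S x y. x \<in> D \<Longrightarrow> y \<in> D \<Longrightarrow> \<beta> x = \<beta> y \<Longrightarrow> x \<in> S \<Longrightarrow>
      (\<And>z. z \<in> D \<Longrightarrow> z \<in> S \<longleftrightarrow> \<sigma> z \<in> S) \<Longrightarrow>
      (\<And>z. z \<in> D \<Longrightarrow> z \<in> S \<Longrightarrow> \<beta> (\<alpha> z) = \<beta> z \<Longrightarrow> \<alpha> z \<in> S) \<Longrightarrow> y \<in> S"
  obtains T where "T \<subseteq> {x \<in> D. \<beta> (\<alpha> x) = \<beta> x}" "\<alpha> ` T \<subseteq> T"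
    "\<And>x. x \<in> D \<Longrightarrow> orbit (switched \<sigma> \<alpha> T) x = {y \<in> D. \<beta> y = \<beta> x}"
proof -
  let ?I = "{x \<in> D. \<beta> (\<alpha> x) = \<beta> x}"
  let ?P = "\<lambda>T. T \<subseteq> ?I \<and> \<alpha> ` T \<subseteq> T"
  let ?c = "\<lambda>T. card (orbit (switched \<sigma> \<alpha> T) ` D)"
  obtain T where T: "?P T" and min: "\<And>T'. ?P T' \<Longrightarrow> ?c T \<le> ?c T'"
    using ex_has_least_nat[of ?P "{}" ?c] by auto
  have \<alpha>D: "\<alpha> x \<in> D \<longleftrightarrow> x \<in> D" for x using permutes_in_image[OF assms(3)] .
  have \<sigma>D: "\<sigma> x \<in> D \<longleftrightarrow> x \<in> D" for x using permutes_in_image[OF assms(2)] .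
  let ?f = "switched \<sigma> \<alpha> T"
  have f: "?f permutes D" by (rule switched_permutes[OF assms(2,3,4)]) (use T in auto)
  have f\<beta>: "\<beta> (?f x) = \<beta> x \<and> ?f x \<in> D" if "x \<in> D" for x
    using that T \<sigma>\<beta> \<alpha>D \<sigma>D by (auto simp: switched_def)
  have sub: "y \<in> D \<and> \<beta> y = \<beta> x" if "y \<in> orbit ?f x" "x \<in> D" for x y
    using that by induction (use f\<beta> in auto)
  \<comment> \<open>Otherwise toggling the edge of \<open>d\<close>, whether in \<open>T\<close> or
    not, would merge two orbits against minimality.\<close>
  have link: "\<alpha> d \<in> orbit ?f d" if d: "d \<in> ?I" for d
  proof (rule ccontr)
    assume n: "\<alpha> d \<notin> orbit ?f d"
    have dD: "d \<in> D" "\<alpha> d \<in> D" using d \<alpha>D by auto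
    have lt: "card (orbit (?f(d := ?f (\<alpha> d), \<alpha> d := ?f d)) ` D) < ?c T"
      by (rule card_orbits_swap_merge[OF f assms(1) dD n])
    show False
    proof (cases "d \<in> T")
      case True
      have "\<alpha> x = \<alpha> y \<longleftrightarrow> x = y" for x y by (metis assms(4))
      then have "?P (T - {d, \<alpha> d})" using T assms(4) by auto
      from min[OF this] lt show False using switched_untoggle[OF assms(4) True] T by simp
    next
      case False
      have "?P (insert d (insert (\<alpha> d) T))" using T assms(4) d \<alpha>D by auto
      from min[OF this] lt show False using switched_toggle[OF assms(4) False] T by simp
    qed
  qed
  show ?thesis
  proof (rule that)
    show "T \<subseteq> ?I" "\<alpha> ` T \<subseteq> T" using T by auto
    fix x assume x: "x \<in> D"
    show "orbit ?f x = {y \<in> D. \<beta> y = \<beta> x}"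
    proof (intro equalityI subsetI)
      fix y assume "y \<in> orbit ?f x" then show "y \<in> {y \<in> D. \<beta> y = \<beta> x}" using sub x by auto
    next
      fix y assume y: "y \<in> {y \<in> D. \<beta> y = \<beta> x}"
      have eqf: "y \<in> orbit ?f x \<longleftrightarrow> orbit ?f y = orbit ?f x" for x y
        using orbit_eq_permutes[OF f assms(1)] self_in_orbit_permutes[OF f assms(1)] by blast
      have st: "orbit ?f (?f z) = orbit ?f z" for z
        using eqf orbit.base[of ?f z] by blast
      have la: "orbit ?f (\<alpha> z) = orbit ?f z" if "z \<in> ?I" for z
        using link[OF that] eqf by blast
      \<comment> \<open>For \<open>z\<close> in \<open>T\<close> the value \<open>\<sigma> z\<close>
        is taken at the other end \<open>\<alpha> z\<close>, which lies in the same orbit by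
        \<open>link\<close>.\<close>
      have ss: "orbit ?f (\<sigma> z) = orbit ?f z" if "z \<in> D" for z
      proof (cases "z \<in> T")
        case True
        then have "\<alpha> z \<in> T" "z \<in> ?I" using T by auto
        then have "?f (\<alpha> z) = \<sigma> z" using assms(4) by (simp add: switched_def)
        then show ?thesis using st[of "\<alpha> z"] la \<open>z \<in> ?I\<close> by simp
      next
        case False
        then show ?thesis using st[of z] by (simp add: switched_def)
      qed
      show "y \<in> orbit ?f x"
      proof (rule conn[of x y])
        show "x \<in> D" "y \<in> D" "\<beta> x = \<beta> y" using x y by auto
        show "x \<in> orbit ?f x" by (rule self_in_orbit_permutes[OF f assms(1)])
        show "z \<in> orbit ?f x \<longleftrightarrow> \<sigma> z \<in> orbit ?f x" if "z \<in> D" for z using ss[OF that] eqf by simp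
        show "\<alpha> z \<in> orbit ?f x" if "z \<in> D" "z \<in> orbit ?f x" "\<beta> (\<alpha> z) = \<beta> z" for z
          using la[of z] that eqf by simp
      qed
    qed
  qed
qed

text \<open>Each fibre is contracted to a vertex: the walk around its inner edges \<open>T\<close>
  meets the darts of \<open>K\<close> in a cyclic order, which is the rotation
  \<open>\<tau>\<close>. For the count, switching on \<open>T\<close> costs at most
  \<open>card T / 2\<close> vertex orbits, discarding the remaining edges costs at most half their
  darts in face orbits, and \<open>K\<close> is what is left of \<open>D\<close>.\<close>

theorem rotation_of_quotient:
  assumes "finite D" "\<sigma> permutes D" "\<alpha> permutes D" "\<And>x. \<alpha> (\<alpha> x) = x" "\<And>x. x \<in> D \<Longrightarrow> \<alpha> x \<noteq> x"
    and \<sigma>\<beta>: "\<And>x. x \<in> D \<Longrightarrow> \<beta> (\<sigma> x) = \<beta> x"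
    and conn: "\<And>S x y. x \<in> D \<Longrightarrow> y \<in> D \<Longrightarrow> \<beta> x = \<beta> y \<Longrightarrow> x \<in> S \<Longrightarrow>
      (\<And>z. z \<in> D \<Longrightarrow> z \<in> S \<longleftrightarrow> \<sigma> z \<in> S) \<Longrightarrow>
      (\<And>z. z \<in> D \<Longrightarrow> z \<in> S \<Longrightarrow> \<beta> (\<alpha> z) = \<beta> z \<Longrightarrow> \<alpha> z \<in> S) \<Longrightarrow> y \<in> S"
    and K: "K \<subseteq> D" "\<alpha> ` K \<subseteq> K" "\<And>x. x \<in> K \<Longrightarrow> \<beta> (\<alpha> x) \<noteq> \<beta> x" "\<beta> ` D \<subseteq> \<beta> ` K"
  obtains \<tau> where "\<tau> permutes K" "\<And>x. x \<in> K \<Longrightarrow> \<beta> (\<tau> x) = \<beta> x"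
    "\<And>x y. x \<in> K \<Longrightarrow> y \<in> K \<Longrightarrow> \<beta> x = \<beta> y \<Longrightarrow> y \<in> orbit \<tau> x"
    "2 * card (orbit (\<sigma> \<circ> \<alpha>) ` D) + 2 * card (orbit \<sigma> ` D) + card K
       \<le> 2 * card (orbit (\<tau> \<circ> \<alpha>) ` K) + 2 * card (\<beta> ` D) + card D"
proof -
  obtain T where T: "T \<subseteq> {x \<in> D. \<beta> (\<alpha> x) = \<beta> x}" "\<alpha> ` T \<subseteq> T"
    and Torb: "\<And>x. x \<in> D \<Longrightarrow> orbit (switched \<sigma> \<alpha> T) x = {y \<in> D. \<beta> y = \<beta> x}"
  proof (rule switched_spanning[where D = D and \<sigma> = \<sigma> and \<alpha> = \<alpha> and \<beta> = \<beta>, OF assms(1-4) \<sigma>\<beta> conn])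
    fix T assume "T \<subseteq> {x \<in> D. \<beta> (\<alpha> x) = \<beta> x}" "\<alpha> ` T \<subseteq> T"
      "\<And>x. x \<in> D \<Longrightarrow> orbit (switched \<sigma> \<alpha> T) x = {y \<in> D. \<beta> y = \<beta> x}"
    then show thesis by (rule that)
  qed
  let ?f = "switched \<sigma> \<alpha> T" and ?g = "switched \<sigma> \<alpha> (T \<union> K)"
  have TD: "T \<subseteq> D" using T by auto
  have TK: "T \<inter> K = {}" using T K by auto
  have f: "?f permutes D" by (rule switched_permutes[OF assms(2,3,4) TD T(2)])
  have g: "?g permutes D" by (rule switched_permutes[OF assms(2,3,4)]) (use TD T K in auto)
  have \<alpha>D: "\<alpha> x \<in> D \<longleftrightarrow> x \<in> D" for x using permutes_in_image[OF assms(3)] .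
  obtain \<tau> where \<tau>: "\<tau> permutes K"
    "\<And>x. x \<in> K \<Longrightarrow> \<exists>n>0. \<tau> x = (?f ^^ n) x \<and> (\<forall>m. 0 < m \<longrightarrow> m < n \<longrightarrow> (?f ^^ m) x \<notin> K)"
    "\<And>x y. x \<in> K \<Longrightarrow> y \<in> K \<Longrightarrow> y \<in> orbit ?f x \<Longrightarrow> y \<in> orbit \<tau> x"
    using first_return[OF f assms(1) K(1)] by metis
  have gf: "?g x = ?f (if x \<in> K then \<alpha> x else x)" for x
  proof -
    have "\<alpha> x \<notin> T" if "x \<in> K" using that K TK by auto
    then show ?thesis using TK by (auto simp: switched_def)
  qed
  \<comment> \<open>After the first step \<open>?g\<close> and \<open>?f\<close> agree until the
    next dart of \<open>K\<close>, so a step of \<open>\<tau> \<circ> \<alpha>\<close> stays within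
    an orbit of \<open>?g\<close>.\<close>
  have \<tau>g: "\<tau> (\<alpha> x) \<in> orbit ?g x" if x: "x \<in> K" for x
  proof -
    obtain n where n: "n > 0" "\<tau> (\<alpha> x) = (?f ^^ n) (\<alpha> x)" "\<forall>m. 0 < m \<longrightarrow> m < n \<longrightarrow> (?f ^^ m) (\<alpha> x) \<notin> K"
      using \<tau>(2)[of "\<alpha> x"] K x by auto
    have "0 < m \<Longrightarrow> m \<le> n \<Longrightarrow> (?f ^^ m) (\<alpha> x) = (?g ^^ m) x" for m
    proof (induction m)
      case 0 then show ?case by simp
    next
      case (Suc m)
      show ?case
      proof (cases "m = 0")
        case True then show ?thesis using gf x by simp
      next
        case False
        then have e: "(?f ^^ m) (\<alpha> x) = (?g ^^ m) x" using Suc by simp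
        have "(?f ^^ m) (\<alpha> x) \<notin> K" using n(3) False Suc.prems by simp
        then show ?thesis using e gf[of "(?g ^^ m) x"] by simp
      qed
    qed
    from this[of n] n(1,2) show ?thesis by (auto simp: orbit_altdef)
  qed
  have orb_sub: "orbit (\<tau> \<circ> \<alpha>) x \<subseteq> orbit ?g x" if x: "x \<in> K" for x
  proof
    fix y assume "y \<in> orbit (\<tau> \<circ> \<alpha>) x"
    then have "y \<in> orbit ?g x \<and> y \<in> K"
    proof induction
      case base then show ?case using \<tau>g[OF x] K x permutes_in_image[OF \<tau>(1)] by auto
    next
      case (step y)
      then have "\<tau> (\<alpha> y) \<in> orbit ?g y" using \<tau>g by auto
      then have "\<tau> (\<alpha> y) \<in> orbit ?g x" using step by (auto intro: orbit_trans)
      then show ?case using K step permutes_in_image[OF \<tau>(1)] by auto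
    qed
    then show "y \<in> orbit ?g x" by simp
  qed
  \<comment> \<open>An orbit of \<open>?g\<close> avoiding \<open>K\<close> would be an orbit of
    \<open>?f\<close>, hence a whole fibre, and every fibre contains a dart of \<open>K\<close>. So
    no face is lost when passing to \<open>K\<close>.\<close>
  have meet: "\<exists>y\<in>K. orbit ?g x = orbit ?g y" if x: "x \<in> D" for x
  proof (cases "orbit ?g x \<inter> K = {}")
    case False then show ?thesis using orbit_eq_permutes[OF g assms(1)] by blast
  next
    case True
    have "orbit ?f x = orbit ?g x"
      by (rule orbit_cong[OF self_in_orbit_permutes[OF g assms(1)]]) (use True gf in auto)
    then have "{y \<in> D. \<beta> y = \<beta> x} \<inter> K = {}" using Torb[OF x] True by simp
    moreover obtain k where "k \<in> K" "\<beta> k = \<beta> x" using K(4) x by force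
    ultimately show ?thesis using K(1) by blast
  qed
  have c1: "card (orbit ?g ` D) \<le> card (orbit (\<tau> \<circ> \<alpha>) ` K)"
  proof -
    \<comment> \<open>An orbit of \<open>\<tau> \<circ> \<alpha>\<close> determines the orbit of
      \<open>?g\<close> around it, whichever representative is chosen.\<close>
    let ?h = "\<lambda>Q. orbit ?g (SOME x. x \<in> K \<and> orbit (\<tau> \<circ> \<alpha>) x = Q)"
    have "orbit ?g ` D \<subseteq> ?h ` (orbit (\<tau> \<circ> \<alpha>) ` K)"
    proof
      fix Q assume "Q \<in> orbit ?g ` D"
      then obtain y where y: "y \<in> K" "Q = orbit ?g y" using meet by auto
      let ?y = "SOME x. x \<in> K \<and> orbit (\<tau> \<circ> \<alpha>) x = orbit (\<tau> \<circ> \<alpha>) y"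
      have s: "?y \<in> K \<and> orbit (\<tau> \<circ> \<alpha>) ?y = orbit (\<tau> \<circ> \<alpha>) y"
        by (rule someI[of _ y]) (use y in auto)
      have "orbit ?g ?y = orbit ?g y"
      proof -
        have "(\<tau> \<circ> \<alpha>) y \<in> orbit ?g y" "(\<tau> \<circ> \<alpha>) y \<in> orbit ?g ?y"
          using orb_sub s y orbit.base[of "\<tau> \<circ> \<alpha>" y] by blast+
        then show ?thesis using orbit_eq_permutes[OF g assms(1)] by metis
      qed
      then show "Q \<in> ?h ` (orbit (\<tau> \<circ> \<alpha>) ` K)" using y by auto
    qed
    then show ?thesis using K(1) assms(1) finite_subset[OF K(1) assms(1)]
      by (meson card_image_le card_mono finite_imageI le_trans)
  qed
  let ?R = "D - (T \<union> K)"
  have cR: "card ?R + card T + card K = card D"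
  proof -
    have "card (T \<union> K) = card T + card K"
      using TK TD K(1) assms(1) by (intro card_Un_disjoint) (auto intro: finite_subset)
    moreover have "card ?R = card D - card (T \<union> K)"
      using TD K(1) assms(1) by (intro card_Diff_subset) (auto intro: finite_subset)
    moreover have "card (T \<union> K) \<le> card D" using TD K(1) assms(1) by (intro card_mono) auto
    ultimately show ?thesis by simp
  qed
  have clR: "\<alpha> ` ?R \<subseteq> ?R"
  proof -
    have "\<alpha> x \<in> T \<longleftrightarrow> x \<in> T" "\<alpha> x \<in> K \<longleftrightarrow> x \<in> K" for x
      using T(2) K(2) assms(4) by (metis image_subset_iff)+
    then show ?thesis using \<alpha>D by auto
  qed
  have full: "switched \<sigma> \<alpha> (T \<union> K \<union> ?R) x = (\<sigma> \<circ> \<alpha>) x" for x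
    using TD K(1) permutes_not_in[OF assms(3), of x] by (auto simp: switched_def)
  have "2 * card (orbit (switched \<sigma> \<alpha> (T \<union> K \<union> ?R)) ` D) \<le> 2 * card (orbit ?g ` D) + card ?R"
    by (rule card_orbits_switched[OF assms(1-5), THEN conjunct2]) (use TD T K clR in auto)
  moreover have "switched \<sigma> \<alpha> (T \<union> K \<union> ?R) = \<sigma> \<circ> \<alpha>" using full by (simp add: fun_eq_iff)
  ultimately have c2: "2 * card (orbit (\<sigma> \<circ> \<alpha>) ` D) \<le> 2 * card (orbit ?g ` D) + card ?R" by simp
  have "2 * card (orbit (switched \<sigma> \<alpha> {}) ` D) \<le> 2 * card (orbit (switched \<sigma> \<alpha> ({} \<union> T)) ` D) + card T"
    by (rule card_orbits_switched[OF assms(1-5), THEN conjunct1]) (use TD T in auto)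
  moreover have "switched \<sigma> \<alpha> {} = \<sigma>" by (simp add: switched_def fun_eq_iff)
  moreover have "card (orbit ?f ` D) \<le> card (\<beta> ` D)"
  proof -
    have "orbit ?f ` D = (\<lambda>v. {y \<in> D. \<beta> y = v}) ` (\<beta> ` D)" using Torb by (auto simp: image_image)
    then show ?thesis using assms(1) card_image_le[of "\<beta> ` D" "\<lambda>v. {y \<in> D. \<beta> y = v}"] by simp
  qed
  ultimately have c3: "2 * card (orbit \<sigma> ` D) \<le> 2 * card (\<beta> ` D) + card T" by simp
  show ?thesis
  proof (rule that[OF \<tau>(1)])
    fix x assume x: "x \<in> K"
    obtain n where "n > 0" "\<tau> x = (?f ^^ n) x" using \<tau>(2)[OF x] by auto
    then have "\<tau> x \<in> orbit ?f x" by (auto simp: orbit_altdef)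
    then show "\<beta> (\<tau> x) = \<beta> x" using Torb[of x] K x by auto
  next
    fix x y assume "x \<in> K" "y \<in> K" "\<beta> x = \<beta> y"
    then show "y \<in> orbit \<tau> x" using \<tau>(3) Torb[of x] K(1) by auto
  next
    show "2 * card (orbit (\<sigma> \<circ> \<alpha>) ` D) + 2 * card (orbit \<sigma> ` D) + card K
       \<le> 2 * card (orbit (\<tau> \<circ> \<alpha>) ` K) + 2 * card (\<beta> ` D) + card D"
      using c1 c2 c3 cR by simp
  qed
qed

section \<open>Minors of finite graphs\<close>

text \<open>Connectedness as the impossibility of a proper nonempty part closed under adjacency; the
  empty set qualifies. This form fits both the closed sets of points in the brick argument and the
  closed sets of darts in \<open>switched_spanning\<close>.\<close>

definition cut_connected :: "('b \<Rightarrow> 'b \<Rightarrow> bool) \<Rightarrow> 'b set \<Rightarrow> bool" where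
  "cut_connected adj S \<longleftrightarrow>
     (\<forall>A. A \<subseteq> S \<longrightarrow> A \<noteq> {} \<longrightarrow> (\<forall>x\<in>A. \<forall>y\<in>S. adj x y \<longrightarrow> y \<in> A) \<longrightarrow> A = S)"

lemma cut_connectedD:
  assumes "cut_connected adj S" "x \<in> A" "x \<in> S" "\<And>x y. x \<in> A \<Longrightarrow> x \<in> S \<Longrightarrow> y \<in> S \<Longrightarrow> adj x y \<Longrightarrow> y \<in> A"
  shows "S \<subseteq> A"
proof -
  have "A \<inter> S = S"
    using assms(1)[unfolded cut_connected_def, rule_format, of "A \<inter> S"] assms(2-4) by blast
  then show ?thesis by blast
qed

lemma cut_connectedI:
  assumes "\<And>A x. A \<subseteq> S \<Longrightarrow> x \<in> A \<Longrightarrow> (\<And>x y. x \<in> A \<Longrightarrow> y \<in> S \<Longrightarrow> adj x y \<Longrightarrow> y \<in> A) \<Longrightarrow> S \<subseteq> A"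
  shows "cut_connected adj S"
  unfolding cut_connected_def using assms by blast

lemma cut_connected_insert:
  assumes "cut_connected adj S" "symp adj" "x \<in> S" "adj x y"
  shows "cut_connected adj (insert y S)"
proof (rule cut_connectedI)
  fix A z assume A: "A \<subseteq> insert y S" "z \<in> A"
    and cl: "\<And>x' y'. x' \<in> A \<Longrightarrow> y' \<in> insert y S \<Longrightarrow> adj x' y' \<Longrightarrow> y' \<in> A"
  have xA: "\<exists>w. w \<in> A \<and> w \<in> S"
  proof (cases "z = y")
    case True
    then have "x \<in> A" using cl[of y x] A assms by (auto dest: sympD)
    then show ?thesis using assms by auto
  next
    case False then show ?thesis using A by auto
  qed
  then obtain w where "w \<in> A" "w \<in> S" by auto
  then have "S \<subseteq> A" using cut_connectedD[OF assms(1), of w A] cl by auto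
  moreover have "y \<in> A" using cl[of x y] calculation assms by auto
  ultimately show "insert y S \<subseteq> A" by auto
qed

lemma cut_connected_Union:
  assumes B: "cut_connected adj B" "b \<in> B" and P: "\<And>i. i \<in> I \<Longrightarrow> cut_connected adj (P i)" "\<And>i. i \<in> I \<Longrightarrow> B \<subseteq> P i"
  shows "cut_connected adj (B \<union> (\<Union>i\<in>I. P i))"
proof (rule cut_connectedI)
  let ?U = "B \<union> (\<Union>i\<in>I. P i)"
  fix A x assume A: "A \<subseteq> ?U" "x \<in> A"
    and cl: "\<And>x y. x \<in> A \<Longrightarrow> y \<in> ?U \<Longrightarrow> adj x y \<Longrightarrow> y \<in> A"
  have B': "B \<subseteq> A" if "w \<in> A" "w \<in> B" for w
    by (rule cut_connectedD[OF B(1)]) (use that cl in auto)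
  have P': "P i \<subseteq> A" if "w \<in> A" "w \<in> P i" "i \<in> I" for w i
    by (rule cut_connectedD[OF P(1)]) (use that cl in auto)
  have "B \<subseteq> A" using A B' P' P(2) by blast
  then show "?U \<subseteq> A" using P' P(2) B(2) by blast
qed

text \<open>Let \<open>P\<close> be a largest part of \<open>Q\<close> outside \<open>Bv\<close>
  that keeps \<open>Bu \<union> P\<close> connected. Since \<open>Q\<close> is connected and reaches
  \<open>Bv\<close>, some adjacency inside \<open>Q\<close> leaves \<open>P\<close> together with
  \<open>Q \<inter> Bu\<close>; by maximality it ends in \<open>Bv\<close>.\<close>

lemma branch_sets_adjacent:
  assumes "finite C" and sym: "symp adj"
    and B: "Bu \<subseteq> C" "cut_connected adj Bu" "Q \<subseteq> C" "cut_connected adj Q"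
    "Q \<inter> Bu \<noteq> {}" "Q \<inter> Bv \<noteq> {}" "Bu \<inter> Bv = {}"
  obtains P where "P \<subseteq> Q" "P \<inter> Bv = {}" "cut_connected adj (Bu \<union> P)"
    "\<exists>x\<in>Bu \<union> P. \<exists>y\<in>Bv. adj x y"
proof -
  let ?OK = "\<lambda>P. P \<subseteq> Q - Bv \<and> cut_connected adj (Bu \<union> P)"
  have ok: "?OK {}" using B by auto
  have bnd: "\<forall>y. ?OK y \<longrightarrow> card y < Suc (card C)"
  proof (intro allI impI)
    fix y assume "?OK y"
    then have "y \<subseteq> C" using B by auto
    then show "card y < Suc (card C)" by (intro le_imp_less_Suc card_mono[OF assms(1)])
  qed
  obtain P where P: "?OK P" "\<And>P'. ?OK P' \<Longrightarrow> card P' \<le> card P"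
    using ex_has_greatest_nat[of ?OK "{}" card "Suc (card C)", OF ok bnd] by auto
  have "P \<subseteq> C" using P B by blast
  then have finP: "finite P" using assms(1) finite_subset by blast
  let ?A = "P \<union> (Q \<inter> Bu)"
  have "\<not> Q \<subseteq> ?A" using B P by blast
  obtain x0 where "x0 \<in> Q \<inter> Bu" using B by auto
  then obtain x y where xy: "x \<in> ?A" "x \<in> Q" "y \<in> Q" "adj x y" "y \<notin> ?A"
    using cut_connectedD[OF B(4), of x0 ?A] \<open>\<not> Q \<subseteq> ?A\<close> by auto
  have "y \<in> Bv"
  proof (rule ccontr)
    assume n: "y \<notin> Bv"
    have "cut_connected adj (insert y (Bu \<union> P))"
      by (rule cut_connected_insert[of _ _ x]) (use P xy sym in auto)
    then have "?OK (insert y P)" using P n xy by auto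
    from P(2)[OF this] show False using xy finP by simp
  qed
  then show ?thesis using that[of P] P xy by blast
qed

text \<open>One end of every edge absorbs part of \<open>Q e\<close> so as to touch the other end.
  Disjointness is kept because \<open>Q e\<close> meets no foreign branch set and different
  \<open>Q e\<close> are disjoint. Among families of disjoint connected supersets, one with largest
  union covers \<open>C\<close>: an uncovered neighbour could be added.\<close>

theorem minor_partition:
  fixes V :: "'a set" and C :: "'b set"
  assumes "finite C" and sym: "symp adj" and C: "cut_connected adj C" and V: "finite V" "V \<noteq> {}"
    and E: "\<And>e. e \<in> E \<Longrightarrow> e \<subseteq> V \<and> card e = 2"
    and B: "\<And>v. v \<in> V \<Longrightarrow> B v \<subseteq> C \<and> B v \<noteq> {} \<and> cut_connected adj (B v)"
    and disjB: "\<And>u v. u \<in> V \<Longrightarrow> v \<in> V \<Longrightarrow> u \<noteq> v \<Longrightarrow> B u \<inter> B v = {}"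
    and Q: "\<And>e. e \<in> E \<Longrightarrow> Q e \<subseteq> C \<and> cut_connected adj (Q e)"
    and disjQ: "\<And>e f. e \<in> E \<Longrightarrow> f \<in> E \<Longrightarrow> e \<noteq> f \<Longrightarrow> Q e \<inter> Q f = {}"
    and QB: "\<And>e v. e \<in> E \<Longrightarrow> v \<in> V \<Longrightarrow> Q e \<inter> B v = {} \<longleftrightarrow> v \<notin> e"
  obtains \<beta> where "\<beta> ` C = V" "\<And>v. v \<in> V \<Longrightarrow> cut_connected adj {c \<in> C. \<beta> c = v}"
    "\<And>e. e \<in> E \<Longrightarrow> \<exists>x\<in>C. \<exists>y\<in>C. adj x y \<and> e = {\<beta> x, \<beta> y}"
proof -
  have exP: "\<exists>u v P. e = {u, v} \<and> u \<noteq> v \<and> P \<subseteq> Q e \<and> P \<inter> B v = {} \<and> cut_connected adj (B u \<union> P) \<and>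
    (\<exists>x\<in>B u \<union> P. \<exists>y\<in>B v. adj x y)" if e: "e \<in> E" for e
  proof -
    obtain u v where uv: "e = {u, v}" "u \<noteq> v" using E[OF e] by (auto simp: card_2_iff)
    have V': "u \<in> V" "v \<in> V" using E[OF e] uv by auto
    have ne: "Q e \<inter> B u \<noteq> {}" "Q e \<inter> B v \<noteq> {}" using QB[OF e] V' uv by blast+
    obtain P where "P \<subseteq> Q e" "P \<inter> B v = {}" "cut_connected adj (B u \<union> P)"
      "\<exists>x\<in>B u \<union> P. \<exists>y\<in>B v. adj x y"
    proof (rule branch_sets_adjacent[OF assms(1) sym, of "B u" "Q e" "B v"])
      show "B u \<subseteq> C" "cut_connected adj (B u)" "Q e \<subseteq> C" "cut_connected adj (Q e)" "B u \<inter> B v = {}"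
        using B[OF V'(1)] Q[OF e] disjB[OF V' uv(2)] by auto
    qed (use ne in auto)
    then show ?thesis using uv by blast
  qed
  then have "\<forall>e\<in>E. \<exists>u v P. e = {u, v} \<and> u \<noteq> v \<and> P \<subseteq> Q e \<and> P \<inter> B v = {} \<and> cut_connected adj (B u \<union> P) \<and>
    (\<exists>x\<in>B u \<union> P. \<exists>y\<in>B v. adj x y)" by (intro ballI)
  then obtain a b P where abP: "\<And>e. e \<in> E \<Longrightarrow> e = {a e, b e} \<and> a e \<noteq> b e \<and> P e \<subseteq> Q e \<and> P e \<inter> B (b e) = {} \<and>
    cut_connected adj (B (a e) \<union> P e) \<and> (\<exists>x\<in>B (a e) \<union> P e. \<exists>y\<in>B (b e). adj x y)"
    unfolding bchoice_iff by blast
  define B' where "B' v = B v \<union> (\<Union>e\<in>{e \<in> E. a e = v}. B v \<union> P e)" for v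
  have inB': "x \<in> B' v \<longleftrightarrow> x \<in> B v \<or> (\<exists>e\<in>E. a e = v \<and> x \<in> P e)" for x v
    by (auto simp: B'_def)
  have PB: "P e \<inter> B v = {}" if "e \<in> E" "v \<in> V" "v \<noteq> a e" for e v
  proof (cases "v = b e")
    case True then show ?thesis using abP[OF that(1)] by auto
  next
    case False
    have "e = {a e, b e}" using abP[OF that(1)] by blast
    then have "v \<notin> e" using False that by blast
    then show ?thesis using QB[OF that(1,2)] abP[OF that(1)] by auto
  qed
  have aV: "a e \<in> V" if "e \<in> E" for e using abP[OF that] E[OF that] by (metis insertI1 subsetD)
  have bV: "b e \<in> V" if "e \<in> E" for e using abP[OF that] E[OF that] by (metis insertI1 insertI2 subsetD)
  have PC: "P e \<subseteq> C" if "e \<in> E" for e using abP[OF that] Q[OF that] by auto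
  define OK where "OK f \<longleftrightarrow> (\<forall>v\<in>V. B' v \<subseteq> f v \<and> f v \<subseteq> C \<and> cut_connected adj (f v)) \<and>
     (\<forall>u\<in>V. \<forall>v\<in>V. u \<noteq> v \<longrightarrow> f u \<inter> f v = {})" for f
  have OK': "OK B'"
    unfolding OK_def
  proof (intro conjI ballI impI)
    fix v assume v: "v \<in> V"
    show "B' v \<subseteq> B' v" by simp
    show "B' v \<subseteq> C" using inB' B[OF v] PC by blast
    obtain x where "x \<in> B v" using B[OF v] by auto
    then show "cut_connected adj (B' v)" unfolding B'_def
      by (rule cut_connected_Union[rotated]) (use B[OF v] abP in auto)
  next
    fix u v assume uv: "u \<in> V" "v \<in> V" "u \<noteq> v"
    have "False" if x: "x \<in> B' u" "x \<in> B' v" for x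
    proof -
      consider "x \<in> B u" "x \<in> B v" | e where "x \<in> B u" "e \<in> E" "a e = v" "x \<in> P e"
        | e where "x \<in> B v" "e \<in> E" "a e = u" "x \<in> P e"
        | e f where "e \<in> E" "a e = u" "x \<in> P e" "f \<in> E" "a f = v" "x \<in> P f"
        using x inB' by blast
      then show False
      proof cases
        case 1 then show ?thesis using disjB uv by blast
      next
        case 2 then show ?thesis using PB[OF 2(2) uv(1)] uv by blast
      next
        case 3 then show ?thesis using PB[OF 3(2) uv(2)] uv by blast
      next
        case 4
        then have "e \<noteq> f" using uv by auto
        then show ?thesis using disjQ[OF 4(1,4)] abP[OF 4(1)] abP[OF 4(4)] 4 by blast
      qed
    qed
    then show "B' u \<inter> B' v = {}" by blast
  qed
  have bnd: "\<forall>f. OK f \<longrightarrow> card (\<Union>v\<in>V. f v) < Suc (card C)"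
  proof (intro allI impI)
    fix f assume "OK f"
    then have "(\<Union>v\<in>V. f v) \<subseteq> C" unfolding OK_def by blast
    then show "card (\<Union>v\<in>V. f v) < Suc (card C)" by (intro le_imp_less_Suc card_mono[OF assms(1)])
  qed
  from ex_has_greatest_nat[of OK B' "\<lambda>f. card (\<Union>v\<in>V. f v)" "Suc (card C)", OF OK' bnd]
  obtain f where fOK: "OK f" and max: "\<And>f'. OK f' \<Longrightarrow> card (\<Union>v\<in>V. f' v) \<le> card (\<Union>v\<in>V. f v)"
    by auto
  note f = fOK[unfolded OK_def]
  have fne: "f v \<noteq> {}" if v: "v \<in> V" for v
  proof -
    obtain x where "x \<in> B v" using B[OF v] by blast
    then have "x \<in> B' v" using inB' by blast
    moreover have "B' v \<subseteq> f v" using f v by simp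
    ultimately show ?thesis by blast
  qed
  have cover: "(\<Union>v\<in>V. f v) = C"
  proof (rule ccontr)
    assume n: "(\<Union>v\<in>V. f v) \<noteq> C"
    let ?U = "\<Union>v\<in>V. f v"
    have UC: "?U \<subseteq> C" using f by blast
    obtain w where "w \<in> V" using V by auto
    then obtain x0 where x0: "x0 \<in> ?U" using fne by blast
    then obtain x y where xy: "x \<in> ?U" "y \<in> C" "adj x y" "y \<notin> ?U"
      using cut_connectedD[OF C, of x0 ?U] n UC by blast
    then obtain v where v: "v \<in> V" "x \<in> f v" by auto
    let ?f = "f(v := insert y (f v))"
    have "cut_connected adj (insert y (f v))"
      by (rule cut_connected_insert[of _ _ x]) (use f v xy sym in auto)
    then have "OK ?f" unfolding OK_def using f xy v by auto
    then have "card (\<Union>v\<in>V. ?f v) \<le> card ?U" by (rule max)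
    moreover have "(\<Union>v\<in>V. ?f v) = insert y ?U" using v by auto
    moreover have "finite ?U" using UC assms(1) finite_subset by blast
    ultimately show False using xy by simp
  qed
  define \<beta> where "\<beta> c = (THE v. v \<in> V \<and> c \<in> f v)" for c
  have \<beta>: "\<beta> c = v" if "v \<in> V" "c \<in> f v" for c v
    unfolding \<beta>_def by (rule the_equality) (use f that in blast)+
  have fib: "{c \<in> C. \<beta> c = v} = f v" if "v \<in> V" for v
    using \<beta> cover that f by blast
  show ?thesis
  proof (rule that)
    show "\<beta> ` C = V"
    proof (intro equalityI subsetI)
      fix v assume "v \<in> \<beta> ` C"
      then obtain c w where "c \<in> f w" "w \<in> V" "v = \<beta> c" using cover by blast
      then show "v \<in> V" using \<beta> by simp
    next
      fix v assume v: "v \<in> V"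
      then obtain c where c: "c \<in> f v" using fne by blast
      then have "c \<in> C" using cover v by blast
      then show "v \<in> \<beta> ` C" using \<beta>[OF v c] by blast
    qed
    show "cut_connected adj {c \<in> C. \<beta> c = v}" if "v \<in> V" for v using fib f that by simp
    show "\<exists>x\<in>C. \<exists>y\<in>C. adj x y \<and> e = {\<beta> x, \<beta> y}" if e: "e \<in> E" for e
    proof -
      obtain x y where xy: "x \<in> B (a e) \<union> P e" "y \<in> B (b e)" "adj x y" using abP[OF e] by blast
      have "x \<in> B' (a e)" "y \<in> B' (b e)" using xy e inB' by auto
      then have x: "x \<in> f (a e)" "y \<in> f (b e)" using f aV[OF e] bV[OF e] by auto
      then have "\<beta> x = a e" "\<beta> y = b e" using \<beta> aV[OF e] bV[OF e] by auto
      moreover have "x \<in> C" "y \<in> C" using x f aV[OF e] bV[OF e] by blast+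
      ultimately show ?thesis using xy abP[OF e] by metis
    qed
  qed
qed

section \<open>The hexagonal map on the torus\<close>

text \<open>The six directions of the triangular lattice, counterclockwise in skew coordinates, so
  that adding 3 to the index reverses a direction.\<close>

definition hex_dx :: "nat \<Rightarrow> int" where "hex_dx k = [1, 0, -1, -1, 0, 1] ! (k mod 6)"
definition hex_dy :: "nat \<Rightarrow> int" where "hex_dy k = [0, 1, 1, 0, -1, -1] ! (k mod 6)"

definition hex_shift :: "nat \<Rightarrow> int \<times> int \<Rightarrow> nat \<Rightarrow> int \<times> int" where
  "hex_shift M c k = ((fst c + hex_dx k) mod int M, (snd c + hex_dy k) mod (2 * int M))"

definition hex_cells :: "nat \<Rightarrow> (int \<times> int) set" where
  "hex_cells M = {0..<int M} \<times> {0..<2 * int M}"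

definition hex_adj :: "nat \<Rightarrow> int \<times> int \<Rightarrow> int \<times> int \<Rightarrow> bool" where
  "hex_adj M c c' \<longleftrightarrow> c \<in> hex_cells M \<and> (\<exists>k<6. c' = hex_shift M c k)"

text \<open>A dart carries a direction instead of a target: for small \<open>M\<close> several
  directions may lead to the same cell, or back to the cell itself, and the counts remain
  valid.\<close>

definition hex_darts :: "nat \<Rightarrow> ((int \<times> int) \<times> nat) set" where
  "hex_darts M = hex_cells M \<times> {..<6}"

definition hex_rot :: "nat \<Rightarrow> (int \<times> int) \<times> nat \<Rightarrow> (int \<times> int) \<times> nat" where
  "hex_rot M d = (if d \<in> hex_darts M then (fst d, (snd d + 1) mod 6) else d)"

definition hex_rev :: "nat \<Rightarrow> (int \<times> int) \<times> nat \<Rightarrow> (int \<times> int) \<times> nat" where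
  "hex_rev M d = (if d \<in> hex_darts M then (hex_shift M (fst d) (snd d), (snd d + 3) mod 6) else d)"

lemma less_6_cases: "k < 6 \<Longrightarrow> (k::nat) = 0 \<or> k = 1 \<or> k = 2 \<or> k = 3 \<or> k = 4 \<or> k = 5"
  by auto

lemma hex_dir_opp: "k < 6 \<Longrightarrow> hex_dx (k + 3) = - hex_dx k \<and> hex_dy (k + 3) = - hex_dy k"
  by (drule less_6_cases) (auto simp: hex_dx_def hex_dy_def)

lemma hex_dir_mod: "hex_dx (k mod 6) = hex_dx k" "hex_dy (k mod 6) = hex_dy k"
  by (auto simp: hex_dx_def hex_dy_def)

text \<open>A face walk reverses a dart and rotates once, which adds 3 + 1 to the direction; three
  such directions run around a triangle.\<close>

lemma hex_dir_triangle:
  "k < 6 \<Longrightarrow> hex_dx k + hex_dx (k + 4) + hex_dx (k + 8) = 0 \<and> hex_dy k + hex_dy (k + 4) + hex_dy (k + 8) = 0"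
  by (drule less_6_cases) (auto simp: hex_dx_def hex_dy_def)

lemma hex_shift_in:
  assumes "c \<in> hex_cells M" shows "hex_shift M c k \<in> hex_cells M"
  using assms by (auto simp: hex_cells_def hex_shift_def intro!: pos_mod_bound)

lemma hex_shift_mod [simp]: "hex_shift M c (k mod 6) = hex_shift M c k"
  by (simp add: hex_shift_def hex_dir_mod)

lemma hex_shift_shift:
  "hex_shift M (hex_shift M c k) l =
    ((fst c + hex_dx k + hex_dx l) mod int M, (snd c + hex_dy k + hex_dy l) mod (2 * int M))"
  by (simp add: hex_shift_def mod_simps)

lemma hex_shift_back:
  assumes "c \<in> hex_cells M" "k < 6"
  shows "hex_shift M (hex_shift M c k) (k + 3) = c"
  using assms hex_dir_opp[OF assms(2)] by (auto simp: hex_shift_shift hex_cells_def)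

lemma hex_adj_sym: "symp (hex_adj M)"
proof (rule sympI)
  fix c c' assume "hex_adj M c c'"
  then obtain k where k: "c \<in> hex_cells M" "k < 6" "c' = hex_shift M c k" by (auto simp: hex_adj_def)
  then have "c = hex_shift M c' ((k + 3) mod 6)" using hex_shift_back by simp
  moreover have "c' \<in> hex_cells M" using k hex_shift_in by simp
  ultimately show "hex_adj M c' c" unfolding hex_adj_def by (metis mod_less_divisor zero_less_numeral)
qed

lemma finite_hex_cells: "finite (hex_cells M)" by (simp add: hex_cells_def)

lemma finite_hex_darts: "finite (hex_darts M)" by (simp add: hex_darts_def finite_hex_cells)

lemma hex_rot_in: "hex_rot M d \<in> hex_darts M \<longleftrightarrow> d \<in> hex_darts M"
  by (auto simp: hex_rot_def hex_darts_def)

lemma hex_rev_in: "hex_rev M d \<in> hex_darts M \<longleftrightarrow> d \<in> hex_darts M"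
  by (auto simp: hex_rev_def hex_darts_def hex_shift_in)

lemma hex_rev_rev: "hex_rev M (hex_rev M d) = d"
proof (cases "d \<in> hex_darts M")
  case True
  then have "hex_rev M d \<in> hex_darts M" by (simp add: hex_rev_in)
  moreover obtain c k where d: "d = (c, k)" "c \<in> hex_cells M" "k < 6" using True by (auto simp: hex_darts_def)
  have "((k + 3) mod 6 + 3) mod 6 = k" using less_6_cases[OF d(3)] by auto
  ultimately show ?thesis using True hex_shift_back[OF d(2,3)] d(1)
    by (simp add: hex_rev_def)
next
  case False then show ?thesis by (simp add: hex_rev_def)
qed

lemma hex_rev_permutes: "hex_rev M permutes hex_darts M"
  by (rule bij_imp_permutes, rule bij_betw_byWitness[where f' = "hex_rev M"])
    (auto simp: hex_rev_rev hex_rev_in, simp add: hex_rev_def)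

lemma hex_rev_neq: "d \<in> hex_darts M \<Longrightarrow> hex_rev M d \<noteq> d"
proof -
  assume "d \<in> hex_darts M"
  then obtain c k where d: "d = (c, k)" "c \<in> hex_cells M" "k < 6" by (auto simp: hex_darts_def)
  have "(k + 3) mod 6 \<noteq> k" using less_6_cases[OF d(3)] by auto
  then show ?thesis using d by (auto simp: hex_rev_def hex_darts_def)
qed

lemma hex_rot_funpow:
  "d \<in> hex_darts M \<Longrightarrow> (hex_rot M ^^ n) d = (fst d, (snd d + n) mod 6)"
proof (induction n)
  case 0 then show ?case by (auto simp: hex_darts_def)
next
  case (Suc n)
  then have "(hex_rot M ^^ n) d \<in> hex_darts M" by (auto simp: hex_darts_def)
  then show ?case using Suc by (simp add: hex_rot_def mod_simps)
qed

lemma hex_rot_permutes: "hex_rot M permutes hex_darts M"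
proof (rule bij_imp_permutes)
  show "bij_betw (hex_rot M) (hex_darts M) (hex_darts M)"
  proof (rule bij_betw_byWitness[where f' = "hex_rot M ^^ 5"])
    have 6: "(hex_rot M ^^ 6) d = d" if "d \<in> hex_darts M" for d
      using hex_rot_funpow[OF that, of 6] that by (auto simp: hex_darts_def)
    show "\<forall>a\<in>hex_darts M. (hex_rot M ^^ 5) (hex_rot M a) = a"
      using 6 by (simp add: eval_nat_numeral funpow_swap1)
    show "\<forall>a\<in>hex_darts M. hex_rot M ((hex_rot M ^^ 5) a) = a"
      using 6 by (simp add: eval_nat_numeral)
    show "hex_rot M ` hex_darts M \<subseteq> hex_darts M" by (auto simp: hex_rot_in)
    show "(hex_rot M ^^ 5) ` hex_darts M \<subseteq> hex_darts M" by (auto simp: eval_nat_numeral hex_rot_in)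
  qed
qed (simp add: hex_rot_def)

text \<open>Every orbit has at most \<open>n\<close> elements. A bound on the orbit sizes is all
  that the Euler count takes from the lattice.\<close>

lemma card_orbits_ge:
  assumes f: "f permutes D" "finite D" and n: "0 < n" "\<And>x. x \<in> D \<Longrightarrow> (f ^^ n) x = x"
  shows "card D \<le> n * card (orbit f ` D)"
proof -
  have "D \<subseteq> (\<Union>Q\<in>orbit f ` D. Q)" using self_in_orbit_permutes[OF f] by auto
  moreover have "orbit f x \<subseteq> D" if "x \<in> D" for x using permutes_orbit_subset[OF f(1) that] .
  ultimately have "card D \<le> card (\<Union>Q\<in>orbit f ` D. Q)" using f(2) by (intro card_mono) (auto intro: finite_subset)
  also have "\<dots> \<le> (\<Sum>Q\<in>orbit f ` D. card Q)" using f(2) by (intro card_UN_le) auto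
  also have "\<dots> \<le> (\<Sum>Q\<in>orbit f ` D. n)"
  proof (rule sum_mono)
    fix Q assume "Q \<in> orbit f ` D"
    then obtain x where x: "x \<in> D" "Q = orbit f x" by auto
    have "Q = (\<lambda>m. (f ^^ m) x) ` {..<n}" using orbit_altdef_bounded[OF n(2)[OF x(1)] n(1)] x(2) by auto
    then show "card Q \<le> n" using card_image_le[of "{..<n}" "\<lambda>m. (f ^^ m) x"] by simp
  qed
  finally show ?thesis by (simp add: mult.commute)
qed

lemma hex_face_cube:
  assumes "d \<in> hex_darts M"
  shows "((hex_rot M \<circ> hex_rev M) ^^ 3) d = d"
proof -
  obtain c k where d: "d = (c, k)" "c \<in> hex_cells M" "k < 6" using assms by (auto simp: hex_darts_def)
  have step: "(hex_rot M \<circ> hex_rev M) (c, k) = (hex_shift M c k, (k + 4) mod 6)"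
    if "c \<in> hex_cells M" "k < 6" for c k
  proof -
    have "(c, k) \<in> hex_darts M" using that by (simp add: hex_darts_def)
    moreover have "(hex_shift M c k, (k + 3) mod 6) \<in> hex_darts M"
      using that by (simp add: hex_darts_def hex_shift_in)
    ultimately show ?thesis by (simp add: hex_rot_def hex_rev_def mod_simps add.commute)
  qed
  have "((k + 4) mod 6 + 4) mod 6 = (k + 8) mod 6" "((k + 8) mod 6 + 4) mod 6 = k"
    using less_6_cases[OF d(3)] by auto
  moreover have "((hex_rot M \<circ> hex_rev M) ^^ 3) d =
    (hex_rot M \<circ> hex_rev M) ((hex_rot M \<circ> hex_rev M) ((hex_rot M \<circ> hex_rev M) d))"
    by (simp add: eval_nat_numeral)
  ultimately have "((hex_rot M \<circ> hex_rev M) ^^ 3) d =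
    (hex_shift M (hex_shift M (hex_shift M c k) (k + 4)) (k + 8), k)"
    using d by (simp add: step hex_shift_in del: comp_apply)
  also have "hex_shift M (hex_shift M (hex_shift M c k) (k + 4)) (k + 8) = c"
    using hex_dir_triangle[OF d(3)] d(2)
    by (auto simp: hex_shift_def mod_simps hex_cells_def prod_eq_iff add.assoc)
  finally show ?thesis unfolding d(1) .
qed

section \<open>Rotation systems of simple graphs, obtained from partitions of the cells\<close>

definition arcs :: "'a set set \<Rightarrow> ('a \<times> 'a) set" where
  "arcs E = {(u, v). {u, v} \<in> E}"

definition arc_rev :: "'a set set \<Rightarrow> 'a \<times> 'a \<Rightarrow> 'a \<times> 'a" where
  "arc_rev E d = (if d \<in> arcs E then (snd d, fst d) else d)"

definition rotation_system :: "'a set set \<Rightarrow> ('a \<times> 'a \<Rightarrow> 'a \<times> 'a) \<Rightarrow> bool" where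
  "rotation_system E \<tau> \<longleftrightarrow> \<tau> permutes arcs E \<and> (\<forall>d\<in>arcs E. fst (\<tau> d) = fst d) \<and>
     (\<forall>d\<in>arcs E. \<forall>d'\<in>arcs E. fst d = fst d' \<longrightarrow> d' \<in> orbit \<tau> d)"

text \<open>Every edge picks one lattice dart between the branch sets of its ends, and
  \<open>rotation_of_quotient\<close> is applied to these darts and their reverses; the result is
  then renamed to ordered pairs of vertices.\<close>

theorem rotation_of_hex_partition:
  fixes V :: "'a set"
  assumes E: "\<And>e. e \<in> E \<Longrightarrow> e \<subseteq> V \<and> card e = 2" and iso: "\<And>v. v \<in> V \<Longrightarrow> \<exists>e\<in>E. v \<in> e"
    and \<beta>V: "\<beta> ` hex_cells M = V"
    and conn: "\<And>v. v \<in> V \<Longrightarrow> cut_connected (hex_adj M) {c \<in> hex_cells M. \<beta> c = v}"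
    and edge: "\<And>e. e \<in> E \<Longrightarrow> \<exists>x\<in>hex_cells M. \<exists>y\<in>hex_cells M. hex_adj M x y \<and> e = {\<beta> x, \<beta> y}"
  obtains \<tau> where "rotation_system E \<tau>"
    "card (arcs E) \<le> 2 * card (orbit (\<tau> \<circ> arc_rev E) ` arcs E) + 2 * card V"
proof -
  let ?D = "hex_darts M" and ?r = "hex_rev M" and ?b = "\<lambda>d. \<beta> (fst d)"
  have "\<forall>e\<in>E. \<exists>d. d \<in> ?D \<and> e = {?b d, ?b (?r d)}"
  proof
    fix e assume "e \<in> E"
    then obtain x y where xy: "x \<in> hex_cells M" "y \<in> hex_cells M" "hex_adj M x y" "e = {\<beta> x, \<beta> y}"
      using edge by blast
    then obtain k where "k < 6" "y = hex_shift M x k" by (auto simp: hex_adj_def)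
    then have "(x, k) \<in> ?D \<and> e = {?b (x, k), ?b (?r (x, k))}"
      using xy by (auto simp: hex_darts_def hex_rev_def)
    then show "\<exists>d. d \<in> ?D \<and> e = {?b d, ?b (?r d)}" by (rule exI)
  qed
  from bchoice[OF this] obtain g where "\<forall>e\<in>E. g e \<in> ?D \<and> e = {?b (g e), ?b (?r (g e))}"
    by (elim exE)
  note g = this[rule_format]
  define K where "K = (\<Union>e\<in>E. {g e, ?r (g e)})"
  have Ke: "\<exists>e\<in>E. d \<in> {g e, ?r (g e)} \<and> e = {?b d, ?b (?r d)}" if "d \<in> K" for d
  proof -
    obtain e where e: "e \<in> E" "d \<in> {g e, ?r (g e)}" using \<open>d \<in> K\<close> by (auto simp: K_def)
    have "e = {?b d, ?b (?r d)}"
    proof (cases "d = g e")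
      case True then show ?thesis using g[OF e(1)] by blast
    next
      case False
      then have "d = ?r (g e)" using e by simp
      then have "?r d = g e" by (simp add: hex_rev_rev)
      with \<open>d = ?r (g e)\<close> show ?thesis using g[OF e(1)] by (metis insert_commute)
    qed
    then show ?thesis using e by blast
  qed
  have KD: "K \<subseteq> ?D" using g by (auto simp: K_def hex_rev_in)
  have Kr: "?r ` K \<subseteq> K" by (auto simp: K_def hex_rev_rev)
  have Kb: "?b (?r d) \<noteq> ?b d" if "d \<in> K" for d
  proof -
    obtain e where "e \<in> E" "e = {?b d, ?b (?r d)}" using Ke \<open>d \<in> K\<close> by blast
    then show ?thesis using E[of e] by auto
  qed
  have bK: "?b ` ?D \<subseteq> ?b ` K"
  proof
    fix v assume "v \<in> ?b ` ?D"
    then have "v \<in> V" using \<beta>V by (auto simp: hex_darts_def)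
    then obtain e where e: "e \<in> E" "v \<in> e" using iso by blast
    then have "v = ?b (g e) \<or> v = ?b (?r (g e))" using g by blast
    moreover have "g e \<in> K" "?r (g e) \<in> K" using e by (auto simp: K_def)
    ultimately show "v \<in> ?b ` K" by blast
  qed
  have "fst ` ?D = hex_cells M" by (simp add: hex_darts_def fst_image_times lessThan_empty_iff)
  then have bD: "?b ` ?D = V" using \<beta>V by (metis image_image)
  have sb: "?b (hex_rot M x) = ?b x" for x by (simp add: hex_rot_def)
  \<comment> \<open>A set closed under the rotation contains all six darts of a cell or none, so it
    is governed by the cells \<open>c\<close> with \<open>(c, 0)\<close> in it, and connectedness of
    the branch set applies to those.\<close>
  have cn: "y \<in> S" if xy: "x \<in> ?D" "y \<in> ?D" "?b x = ?b y" "x \<in> S"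
     and rot: "\<And>z. z \<in> ?D \<Longrightarrow> z \<in> S \<longleftrightarrow> hex_rot M z \<in> S"
     and rev: "\<And>z. z \<in> ?D \<Longrightarrow> z \<in> S \<Longrightarrow> ?b (?r z) = ?b z \<Longrightarrow> ?r z \<in> S" for S x y
  proof -
    have rotn: "(hex_rot M ^^ n) z \<in> S \<longleftrightarrow> z \<in> S" if z: "z \<in> ?D" for z n
    proof (induction n)
      case (Suc n)
      have "(hex_rot M ^^ n) z \<in> ?D" using z by (induction n) (simp_all add: hex_rot_in)
      then show ?case using Suc rot by simp
    qed simp
    have all: "(c, k) \<in> S" if "(c, l) \<in> S" "c \<in> hex_cells M" "k < 6" "l < 6" for c k l
    proof -
      have "(c, l) \<in> ?D" using that by (simp add: hex_darts_def)
      \<comment> \<open>Adding 6 keeps the difference of natural numbers exact; six rotations are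
        the identity.\<close>
      moreover have "(hex_rot M ^^ (6 + k - l)) (c, l) = (c, k)"
        using hex_rot_funpow[OF calculation, of "6 + k - l"] that by auto
      ultimately show ?thesis using rotn[of "(c, l)" "6 + k - l"] that by simp
    qed
    let ?A = "{c. (c, 0) \<in> S}"
    have cx: "fst x \<in> hex_cells M" "snd x < 6" and cy: "fst y \<in> hex_cells M" "snd y < 6"
      using xy by (auto simp: hex_darts_def)
    have "{c \<in> hex_cells M. \<beta> c = ?b x} \<subseteq> ?A"
    proof (rule cut_connectedD[OF conn])
      show "?b x \<in> V" using cx \<beta>V by auto
      show "fst x \<in> ?A" using all[of "fst x" "snd x" 0] cx xy by simp
      show "fst x \<in> {c \<in> hex_cells M. \<beta> c = ?b x}" using cx by simp
      fix c c' assume c: "c \<in> ?A" "c \<in> {c \<in> hex_cells M. \<beta> c = ?b x}" "c' \<in> {c \<in> hex_cells M. \<beta> c = ?b x}"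
        "hex_adj M c c'"
      then obtain k where k: "k < 6" "c' = hex_shift M c k" by (auto simp: hex_adj_def)
      have cS: "(c, k) \<in> S" using all[of c 0 k] c k by simp
      have "(c, k) \<in> ?D" using c k by (simp add: hex_darts_def)
      then have "?r (c, k) = (c', (k + 3) mod 6)" using k by (simp add: hex_rev_def)
      moreover have "?r (c, k) \<in> S" using rev[OF \<open>(c, k) \<in> ?D\<close> cS] calculation c by simp
      ultimately show "c' \<in> ?A" using all[of c' "(k + 3) mod 6" 0] c by simp
    qed
    then have "(fst y, 0) \<in> S" using cy xy by auto
    then show "y \<in> S" using all[of "fst y" 0 "snd y"] cy by simp
  qed
  show ?thesis
  proof (rule rotation_of_quotient[where D = ?D and \<sigma> = "hex_rot M" and \<alpha> = ?r and \<beta> = ?b and K = K,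
        OF finite_hex_darts hex_rot_permutes hex_rev_permutes hex_rev_rev hex_rev_neq sb cn KD Kr Kb bK])
    fix \<tau> assume \<tau>: "\<tau> permutes K" "\<And>x. x \<in> K \<Longrightarrow> ?b (\<tau> x) = ?b x"
      "\<And>x y. x \<in> K \<Longrightarrow> y \<in> K \<Longrightarrow> ?b x = ?b y \<Longrightarrow> y \<in> orbit \<tau> x"
      and cnt: "2 * card (orbit (hex_rot M \<circ> ?r) ` ?D) + 2 * card (orbit (hex_rot M) ` ?D) + card K
       \<le> 2 * card (orbit (\<tau> \<circ> ?r) ` K) + 2 * card (?b ` ?D) + card ?D"
    \<comment> \<open>The ordered pair of vertices whose branch sets the dart joins; one chosen dart
      per edge makes this renaming injective on \<open>K\<close>.\<close>
    define lab where "lab d = (?b d, ?b (?r d))" for d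
    have inj: "inj_on lab K"
    proof (rule inj_onI)
      fix d d' assume d: "d \<in> K" "d' \<in> K" and l: "lab d = lab d'"
      obtain e where e: "e \<in> E" "d \<in> {g e, ?r (g e)}" "e = {?b d, ?b (?r d)}" using Ke d by blast
      obtain e' where e': "e' \<in> E" "d' \<in> {g e', ?r (g e')}" "e' = {?b d', ?b (?r d')}" using Ke d by blast
      have "e = e'" using e e' l by (simp add: lab_def)
      then have "d' = d \<or> d' = ?r d" using e(2) e'(2) by (auto simp: hex_rev_rev)
      then show "d = d'" using l Kb[OF d(1)] by (auto simp: lab_def)
    qed
    have im: "lab ` K = arcs E"
    proof (intro equalityI subsetI)
      fix a assume "a \<in> lab ` K"
      then show "a \<in> arcs E" using Ke by (fastforce simp: lab_def arcs_def)
    next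
      fix a assume "a \<in> arcs E"
      then obtain u v where uv: "a = (u, v)" "{u, v} \<in> E" by (auto simp: arcs_def)
      have "{u, v} = {?b (g {u, v}), ?b (?r (g {u, v}))}" using g[OF uv(2)] by blast
      then have "a = lab (g {u, v}) \<or> a = lab (?r (g {u, v}))"
        using uv by (auto simp: lab_def hex_rev_rev doubleton_eq_iff)
      moreover have "g {u, v} \<in> K" "?r (g {u, v}) \<in> K" using uv by (auto simp: K_def)
      ultimately show "a \<in> lab ` K" by blast
    qed
    have finK: "finite K" using KD finite_hex_darts finite_subset by blast
    have \<tau>K: "\<tau> d \<in> K \<longleftrightarrow> d \<in> K" for d using permutes_in_image[OF \<tau>(1)] .
    define \<tau>' where "\<tau>' a = (if a \<in> arcs E then lab (\<tau> (inv_into K lab a)) else a)" for a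
    have \<tau>': "\<tau>' (lab d) = lab (\<tau> d)" if "d \<in> K" for d
      by (simp add: \<tau>'_def inv_into_f_f[OF inj that] im[symmetric] that)
    have bl: "bij_betw lab K (arcs E)" using inj im by (simp add: bij_betw_def)
    have "bij_betw \<tau>' (arcs E) (arcs E)"
    proof -
      have "bij_betw (lab \<circ> \<tau> \<circ> inv_into K lab) (arcs E) (arcs E)"
        by (intro bij_betw_trans[OF bij_betw_inv_into[OF bl]] bij_betw_trans[OF permutes_imp_bij[OF \<tau>(1)] bl])
      then show ?thesis by (rule bij_betw_cong[THEN iffD1, rotated]) (simp add: \<tau>'_def)
    qed
    then have perm: "\<tau>' permutes arcs E" by (rule bij_imp_permutes) (simp add: \<tau>'_def)
    have lr: "arc_rev E (lab d) = lab (?r d)" if "d \<in> K" for d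
      using that im by (auto simp: arc_rev_def lab_def hex_rev_rev)
    have rot: "rotation_system E \<tau>'"
      unfolding rotation_system_def
    proof (intro conjI perm ballI impI)
      fix a assume "a \<in> arcs E"
      then obtain d where d: "d \<in> K" "a = lab d" using im by blast
      then show "fst (\<tau>' a) = fst a" using \<tau>' \<tau>(2) by (simp add: lab_def)
    next
      fix a a' assume "a \<in> arcs E" "a' \<in> arcs E" "fst a = fst a'"
      then obtain d d' where d: "d \<in> K" "a = lab d" "d' \<in> K" "a' = lab d'" using im by blast
      then have "d' \<in> orbit \<tau> d" using \<tau>(3) \<open>fst a = fst a'\<close> by (simp add: lab_def)
      moreover have "lab ` orbit \<tau> d = orbit \<tau>' (lab d)"
      proof (rule orbit_inverse)
        show "d \<in> orbit \<tau> d" by (rule self_in_orbit_permutes[OF \<tau>(1) finK])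
        show "\<tau>' (lab x) = lab (\<tau> x)" if "x \<in> orbit \<tau> d" for x
          using \<tau>' permutes_orbit_subset[OF \<tau>(1) d(1)] that by blast
      qed
      ultimately show "a' \<in> orbit \<tau>' a" using d by blast
    qed
    have Kr': "?r d \<in> K" if "d \<in> K" for d using Kr that by blast
    \<comment> \<open>\<open>?r\<close> permutes all of \<open>?D\<close>. Cut down to
      \<open>K\<close>, it composes with \<open>\<tau>\<close> to a permutation of \<open>K\<close>
      with the same orbits there.\<close>
    define r' where "r' d = (if d \<in> K then ?r d else d)" for d
    have "r' permutes K"
      by (rule bij_imp_permutes, rule bij_betw_byWitness[where f' = r'])
        (use Kr in \<open>auto simp: r'_def hex_rev_rev\<close>)
    then have pr: "\<tau> \<circ> r' permutes K" using \<tau>(1) by (rule permutes_compose)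
    have orb: "lab ` orbit (\<tau> \<circ> ?r) d = orbit (\<tau>' \<circ> arc_rev E) (lab d) \<and> orbit (\<tau> \<circ> ?r) d \<subseteq> K" if d: "d \<in> K" for d
    proof -
      have eq: "orbit (\<tau> \<circ> r') d = orbit (\<tau> \<circ> ?r) d"
        by (rule orbit_cong0[OF d]) (simp_all add: r'_def Pi_iff \<tau>K Kr')
      have sub: "orbit (\<tau> \<circ> ?r) d \<subseteq> K" using permutes_orbit_subset[OF pr d] eq by simp
      have "lab ` orbit (\<tau> \<circ> ?r) d = orbit (\<tau>' \<circ> arc_rev E) (lab d)"
      proof (rule orbit_inverse)
        show "d \<in> orbit (\<tau> \<circ> ?r) d" using self_in_orbit_permutes[OF pr finK, of d] eq by simp
        show "(\<tau>' \<circ> arc_rev E) (lab x) = lab ((\<tau> \<circ> ?r) x)" if "x \<in> orbit (\<tau> \<circ> ?r) d" for x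
        proof -
          have "x \<in> K" "?r x \<in> K" using that sub Kr by auto
          then show ?thesis using lr \<tau>' by simp
        qed
      qed
      then show ?thesis using sub by simp
    qed
    have "orbit (\<tau>' \<circ> arc_rev E) ` arcs E = (`) lab ` (orbit (\<tau> \<circ> ?r) ` K)"
      unfolding im[symmetric] image_image by (intro image_cong refl) (simp add: orb)
    moreover have "inj_on ((`) lab) (orbit (\<tau> \<circ> ?r) ` K)"
      by (rule inj_on_subset[OF inj_on_image_Pow[OF inj]]) (use orb in blast)
    ultimately have "card (orbit (\<tau>' \<circ> arc_rev E) ` arcs E) = card (orbit (\<tau> \<circ> ?r) ` K)"
      by (simp add: card_image)
    moreover have "card K = card (arcs E)" using bij_betw_same_card[OF bl] .
    \<comment> \<open>At least \<open>card ?D / 6\<close> vertex orbits and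
      \<open>card ?D / 3\<close> face orbits, doubled, add up to at least \<open>card ?D\<close>, so
      the lattice drops out of \<open>cnt\<close>.\<close>
    moreover have "card ?D \<le> 6 * card (orbit (hex_rot M) ` ?D)"
      by (rule card_orbits_ge[OF hex_rot_permutes finite_hex_darts]) (auto simp: hex_rot_funpow hex_darts_def)
    moreover have "card ?D \<le> 3 * card (orbit (hex_rot M \<circ> ?r) ` ?D)"
      by (rule card_orbits_ge[OF permutes_compose[OF hex_rev_permutes hex_rot_permutes] finite_hex_darts])
        (simp_all only: hex_face_cube zero_less_numeral)
    ultimately have "card (arcs E) \<le> 2 * card (orbit (\<tau>' \<circ> arc_rev E) ` arcs E) + 2 * card V"
      using cnt bD by simp
    then show thesis using that rot by blast
  qed
qed

section \<open>Tiling the torus by bricks\<close>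

text \<open>Each row of bricks is shifted by half a brick against the previous one. The shifts of all \<open>2 M\<close> rows add
  up to a full turn, so both coordinates of a cell are taken modulo their own period.\<close>

definition hex_point :: "nat \<Rightarrow> int \<times> int \<Rightarrow> real \<Rightarrow> real \<Rightarrow> complex \<times> complex" where
  "hex_point M c s t = (cis (2 * pi * ((of_int (fst c) + of_int (snd c) / 2 + s) / real M)),
                        cis (2 * pi * ((of_int (snd c) + t) / (2 * real M))))"

definition hex_brick :: "nat \<Rightarrow> int \<times> int \<Rightarrow> (complex \<times> complex) set" where
  "hex_brick M c = {hex_point M c s t | s t. s \<in> {0..1} \<and> t \<in> {0..1}}"

lemma compact_hex_brick: "compact (hex_brick M c)"
proof -
  have "hex_brick M c = (\<lambda>z. hex_point M c (fst z) (snd z)) ` ({0..1} \<times> {0..1})"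
    by (force simp: hex_brick_def)
  moreover have "compact \<dots>"
    unfolding hex_point_def divide_inverse
    by (intro compact_continuous_image compact_Times compact_Icc)
      (auto simp: cis_conv_exp intro!: continuous_intros)
  ultimately show ?thesis by simp
qed

lemma cis_2pi_eq: "cis (2 * pi * x) = cis (2 * pi * y) \<longleftrightarrow> (\<exists>n::int. x = y + of_int n)"
proof -
  have "cis (2 * pi * x) = cis (2 * pi * y) \<longleftrightarrow> sin (2 * pi * x) = sin (2 * pi * y) \<and> cos (2 * pi * x) = cos (2 * pi * y)"
    by (auto simp: complex_eq_iff)
  also have "\<dots> \<longleftrightarrow> (\<exists>n::int. 2 * pi * x = 2 * pi * y + 2 * pi * of_int n)"
    by (rule sin_cos_eq_iff)
  also have "\<dots> \<longleftrightarrow> (\<exists>n::int. x = y + of_int n)"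
    by (simp add: distrib_left[symmetric] flip: mult.assoc)
  finally show ?thesis .
qed

lemma torus_point:
  assumes "z \<in> torus" obtains x y where "z = (cis (2 * pi * x), cis (2 * pi * y))" "0 \<le> y" "y < 1"
proof -
  have ex: "\<exists>x. 0 \<le> x \<and> x < 1 \<and> w = cis (2 * pi * x)" if "norm w = 1" for w
  proof -
    have w: "w = cis (Arg w)" using that cis_Arg[of w] by (cases "w = 0") (auto simp: sgn_eq)
    let ?a = "Arg w / (2 * pi)"
    have "w = cis (2 * pi * ?a)" using w by simp
    also have "\<dots> = cis (2 * pi * frac ?a)"
      unfolding cis_2pi_eq by (rule exI[of _ "\<lfloor>?a\<rfloor>"]) (simp add: frac_def)
    finally show ?thesis using frac_ge_0[of ?a] frac_lt_1[of ?a] by blast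
  qed
  have "norm (fst z) = 1" "norm (snd z) = 1" using assms by (auto simp: torus_def)
  from ex[OF this(1)] ex[OF this(2)] show ?thesis using that by (metis prod.collapse)
qed

lemma hex_brick_cover:
  assumes M: "0 < M" and z: "z \<in> torus" obtains c where "c \<in> hex_cells M" "z \<in> hex_brick M c"
proof -
  obtain x y where xy: "z = (cis (2 * pi * x), cis (2 * pi * y))" "0 \<le> y" "y < 1" using torus_point[OF z] .
  \<comment> \<open>The row is read off first, since positions in it are shifted by half the row
    number. It is already in range because of \<open>0 \<le> y < 1\<close>, while the column is
    reduced modulo \<open>M\<close>.\<close>
  let ?j = "\<lfloor>2 * real M * y\<rfloor>" let ?i = "\<lfloor>real M * x - ?j / 2\<rfloor>"
  let ?t = "2 * real M * y - ?j" let ?s = "real M * x - ?j / 2 - ?i"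
  have st: "?s \<in> {0..1}" "?t \<in> {0..1}" by (auto; linarith)+
  have j0: "0 \<le> ?j" using xy M by simp
  have "2 * real M * y < 2 * real M" using xy M by simp
  then have j1: "?j < 2 * int M" by linarith
  let ?c = "(?i mod int M, ?j)"
  have c: "?c \<in> hex_cells M" using j0 j1 M by (auto simp: hex_cells_def)
  have "?i = int M * (?i div int M) + ?i mod int M" by simp
  then have ri: "real_of_int ?i = real M * of_int (?i div int M) + of_int (?i mod int M)"
    by (metis of_int_add of_int_mult of_int_of_nat_eq)
  have "real M * x = of_int (?i mod int M) + ?j / 2 + ?s + real M * of_int (?i div int M)"
    using ri by simp
  then have X: "x = (of_int (?i mod int M) + ?j / 2 + ?s) / real M + of_int (?i div int M)"
    using M by (simp add: field_simps)
  have Y: "y = (?j + ?t) / (2 * real M)" using M by simp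
  have "cis (2 * pi * x) = cis (2 * pi * ((of_int (?i mod int M) + ?j / 2 + ?s) / real M))"
    unfolding cis_2pi_eq using X by blast
  moreover have "cis (2 * pi * y) = cis (2 * pi * ((?j + ?t) / (2 * real M)))" by (simp only: Y[symmetric])
  ultimately have "z = hex_point M ?c ?s ?t"
    by (simp only: xy(1) hex_point_def fst_conv snd_conv)
  then have "z \<in> hex_brick M ?c" unfolding hex_brick_def using st by blast
  then show ?thesis using c that by blast
qed

text \<open>In unreduced coordinates touching bricks differ by \<open>(a, b)\<close> with both
  \<open>b\<close> and \<open>a + b / 2\<close> between -1 and 1. Owing to the half-brick shift this
  leaves only zero and the six directions; in a square grid the diagonal neighbours would touch as
  well.\<close>

lemma hex_brick_touch:
  assumes M: "0 < M" and c: "c \<in> hex_cells M" "c' \<in> hex_cells M" and ne: "hex_brick M c \<inter> hex_brick M c' \<noteq> {}"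
  shows "c = c' \<or> hex_adj M c c'"
proof -
  obtain i j i' j' where ij: "c = (i, j)" "c' = (i', j')" by (metis prod.collapse)
  obtain s t s' t' where st: "s \<in> {0..1}" "t \<in> {0..1}" "s' \<in> {0..1}" "t' \<in> {0..1}"
    and eq: "hex_point M c s t = hex_point M c' s' t'"
    using ne unfolding hex_brick_def by blast
  have e1: "cis (2 * pi * ((of_int i + of_int j / 2 + s) / real M)) = cis (2 * pi * ((of_int i' + of_int j' / 2 + s') / real M))"
    and e2: "cis (2 * pi * ((of_int j + t) / (2 * real M))) = cis (2 * pi * ((of_int j' + t') / (2 * real M)))"
    using eq by (simp_all only: hex_point_def ij fst_conv snd_conv prod.inject)
  from e1[unfolded cis_2pi_eq]
  obtain m where m: "(of_int i + of_int j / 2 + s) / real M = (of_int i' + of_int j' / 2 + s') / real M + of_int m" ..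
  from e2[unfolded cis_2pi_eq]
  obtain n where n: "(of_int j + t) / (2 * real M) = (of_int j' + t') / (2 * real M) + of_int n" ..
  have cancel: "x = y + w * d" if xw: "x / w = y / w + d" and w: "w \<noteq> 0" for x y w d :: real
  proof -
    have "x = (x / w) * w" using w by simp
    also have "(x / w) * w = (y / w + d) * w" by (simp only: xw)
    also have "(y / w + d) * w = y + w * d" using w by (simp add: field_simps)
    finally show ?thesis .
  qed
  have m': "of_int i + of_int j / 2 + s = of_int i' + of_int j' / 2 + s' + real M * of_int m"
    by (rule cancel[OF m]) (use M in simp)
  have n': "of_int j + t = of_int j' + t' + 2 * real M * of_int n"
    by (rule cancel[OF n]) (use M in simp)
  \<comment> \<open>\<open>m\<close> and \<open>n\<close> count full turns around the torus. The
    \<open>n\<close> vertical turns pass \<open>2 M n\<close> rows and thereby shift by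
    \<open>M n\<close> columns, which \<open>a\<close> takes back.\<close>
  define b where "b = j' + 2 * int M * n - j"
  define a where "a = i' + int M * m - int M * n - i"
  have rb: "real_of_int b = of_int j' + 2 * real M * of_int n - of_int j" by (simp add: b_def)
  have ra: "real_of_int a = of_int i' + real M * of_int m - real M * of_int n - of_int i" by (simp add: a_def)
  have "-1 \<le> real_of_int b" "real_of_int b \<le> 1" using rb n' st by auto
  then have b: "b = -1 \<or> b = 0 \<or> b = 1" by linarith
  have "real_of_int a + real_of_int b / 2 = s - s'"
    unfolding ra rb using m' by (simp add: diff_divide_distrib add_divide_distrib)
  then have ab: "-1 \<le> real_of_int a + real_of_int b / 2" "real_of_int a + real_of_int b / 2 \<le> 1"
    using st by auto
  have a: "(b = 0 \<and> (a = -1 \<or> a = 0 \<or> a = 1)) \<or> (b = 1 \<and> (a = -1 \<or> a = 0)) \<or> (b = -1 \<and> (a = 0 \<or> a = 1))"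
    using b
  proof (elim disjE)
    assume h: "b = -1"
    then have "real_of_int b = -1" by (simp only: of_int_minus of_int_1 of_int_0)
    with ab have "-1 < real_of_int a" "real_of_int a < 2" by linarith+
    then have "-1 < a" "a < 2" by linarith+
    then have "a = 0 \<or> a = 1" by presburger
    then show ?thesis using h by simp
  next
    assume h: "b = 0"
    then have "real_of_int b = 0" by (simp only: of_int_minus of_int_1 of_int_0)
    with ab have "-2 < real_of_int a" "real_of_int a < 2" by linarith+
    then have "-2 < a" "a < 2" by linarith+
    then have "a = -1 \<or> a = 0 \<or> a = 1" by presburger
    then show ?thesis using h by simp
  next
    assume h: "b = 1"
    then have "real_of_int b = 1" by (simp only: of_int_minus of_int_1 of_int_0)
    with ab have "-2 < real_of_int a" "real_of_int a < 1" by linarith+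
    then have "-2 < a" "a < 1" by linarith+
    then have "a = -1 \<or> a = 0" by presburger
    then show ?thesis using h by simp
  qed
  have i: "i' = (i + a) mod int M"
  proof -
    have "i + a = i' + int M * (m - n)" by (simp add: a_def algebra_simps)
    then show ?thesis using c ij by (simp add: hex_cells_def)
  qed
  have j: "j' = (j + b) mod (2 * int M)"
  proof -
    have "j + b = j' + 2 * int M * n" by (simp add: b_def)
    then show ?thesis using c ij by (simp add: hex_cells_def)
  qed
  have adj: "hex_adj M c c'" if "k < 6" "hex_dx k = a" "hex_dy k = b" for k
    unfolding hex_adj_def using c(1) that i j ij by (auto simp: hex_shift_def)
  show ?thesis
  proof (cases "a = 0 \<and> b = 0")
    case True then show ?thesis using i j ij c by (simp add: hex_cells_def)
  next
    case False
    then have "\<exists>k<6. hex_dx k = a \<and> hex_dy k = b"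
      using a
      by (elim disjE conjE; hypsubst?)
        ((rule exI[of _ 0], simp add: hex_dx_def hex_dy_def; fail) |
         (rule exI[of _ 1], simp add: hex_dx_def hex_dy_def; fail) |
         (rule exI[of _ 2], simp add: hex_dx_def hex_dy_def; fail) |
         (rule exI[of _ 3], simp add: hex_dx_def hex_dy_def; fail) |
         (rule exI[of _ 4], simp add: hex_dx_def hex_dy_def; fail) |
         (rule exI[of _ 5], simp add: hex_dx_def hex_dy_def; fail) | simp)+
    then show ?thesis using adj by blast
  qed
qed

text \<open>The bricks of an adjacency-closed part and the remaining ones cut \<open>X\<close> into
  two closed pieces, disjoint because touching bricks are adjacent. So connectedness passes to cells
  without any regularity of \<open>X\<close>.\<close>

lemma hex_cells_meeting_connected:
  assumes M: "0 < M" and X: "connected X" "X \<subseteq> torus"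
  shows "cut_connected (hex_adj M) {c \<in> hex_cells M. hex_brick M c \<inter> X \<noteq> {}}"
    (is "cut_connected _ ?S")
proof (rule cut_connectedI)
  fix A c assume A: "A \<subseteq> ?S" "c \<in> A"
    and cl: "\<And>x y. x \<in> A \<Longrightarrow> y \<in> ?S \<Longrightarrow> hex_adj M x y \<Longrightarrow> y \<in> A"
  let ?U = "\<Union>x\<in>A. hex_brick M x" and ?W = "\<Union>x\<in>?S - A. hex_brick M x"
  have fin: "finite A" "finite (?S - A)" using A finite_hex_cells[of M] by (auto intro: finite_subset)
  have cld: "closed ?U" "closed ?W"
    by (intro closed_UN fin ballI compact_imp_closed compact_hex_brick)+
  have cov: "X \<subseteq> ?U \<union> ?W"
  proof
    fix z assume z: "z \<in> X"
    then obtain d where "d \<in> hex_cells M" "z \<in> hex_brick M d" using hex_brick_cover[OF M] X by blast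
    then show "z \<in> ?U \<union> ?W" using z by blast
  qed
  have dis: "?U \<inter> ?W \<inter> X = {}"
  proof -
    have False if "x \<in> A" "y \<in> ?S - A" "z \<in> hex_brick M x" "z \<in> hex_brick M y" for x y z
    proof -
      have "x = y \<or> hex_adj M x y" using hex_brick_touch[OF M, of x y] that A by blast
      then show False using that cl[of x y] by auto
    qed
    then show ?thesis by blast
  qed
  have "?U \<inter> X \<noteq> {}" using A by blast
  then have "?W \<inter> X = {}" using connected_closedD[OF X(1) dis cov cld] by satx
  then show "?S \<subseteq> A" by blast
qed

lemma dist_cis_le: "dist (cis a) (cis b) \<le> \<bar>a - b\<bar>"
proof -
  have d: "(cis has_derivative (\<lambda>h. h *\<^sub>R (\<i> * cis x))) (at x within UNIV)" for x
    using has_derivative_cis[OF has_derivative_ident, of x UNIV] by simp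
  have "onorm (\<lambda>h. h *\<^sub>R (\<i> * cis x)) \<le> 1" for x
    by (rule onorm_bound) (simp_all add: norm_mult)
  then have "norm (cis a - cis b) \<le> 1 * norm (a - b)"
    by (intro differentiable_bound[OF convex_UNIV d]) auto
  then show ?thesis by (simp add: dist_norm)
qed

text \<open>The angles vary by at most \<open>2 * pi / M\<close> along a brick and
  \<open>pi / M\<close> across it, and a chord is no longer than its angle.\<close>

lemma dist_hex_brick:
  assumes M: "0 < M" and z: "z \<in> hex_brick M c" "w \<in> hex_brick M c"
  shows "dist z w \<le> 3 * pi / real M"
proof -
  obtain s t s' t' where st: "s \<in> {0..1}" "t \<in> {0..1}" "s' \<in> {0..1}" "t' \<in> {0..1}"
    and zw: "z = hex_point M c s t" "w = hex_point M c s' t'"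
    using z unfolding hex_brick_def by blast
  have "dist (fst z) (fst w) \<le> \<bar>2 * pi * ((of_int (fst c) + of_int (snd c) / 2 + s) / real M) - 2 * pi * ((of_int (fst c) + of_int (snd c) / 2 + s') / real M)\<bar>"
    unfolding zw hex_point_def fst_conv by (rule dist_cis_le)
  also have "\<dots> = \<bar>2 * pi / real M * (s - s')\<bar>" by (simp add: diff_divide_distrib algebra_simps add_divide_distrib)
  also have "\<dots> \<le> 2 * pi / real M * 1" unfolding abs_mult using st M by (intro mult_mono) auto
  finally have 1: "dist (fst z) (fst w) \<le> 2 * pi / real M" by simp
  have "dist (snd z) (snd w) \<le> \<bar>2 * pi * ((of_int (snd c) + t) / (2 * real M)) - 2 * pi * ((of_int (snd c) + t') / (2 * real M))\<bar>"
    unfolding zw hex_point_def snd_conv by (rule dist_cis_le)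
  also have "\<dots> = \<bar>pi / real M * (t - t')\<bar>"
    by (rule arg_cong[where f = abs]) (use M in \<open>simp add: field_simps\<close>)
  also have "\<dots> \<le> pi / real M * 1" unfolding abs_mult using st M by (intro mult_mono) auto
  finally have 2: "dist (snd z) (snd w) \<le> pi / real M" by simp
  have "dist z w \<le> dist (fst z) (fst w) + dist (snd z) (snd w)"
    unfolding dist_prod_def by (rule sqrt_sum_squares_le_sum) auto
  also have "\<dots> \<le> 3 * pi / real M" using 1 2 by (simp add: add_divide_distrib[symmetric])
  finally show ?thesis .
qed

text \<open>Disjoint compact sets have a positive distance, which small bricks cannot
  bridge.\<close>

lemma eventually_bricks_separate:
  assumes "compact X" "compact Y" "X \<inter> Y = {}"
  shows "eventually (\<lambda>M. \<forall>c. hex_brick M c \<inter> X = {} \<or> hex_brick M c \<inter> Y = {}) sequentially"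
proof -
  obtain \<delta> where \<delta>: "\<delta> > 0" "\<forall>x\<in>X. \<forall>y\<in>Y. \<delta> \<le> dist x y"
    using separate_compact_closed[OF assms(1) compact_imp_closed[OF assms(2)] assms(3)] by blast
  obtain N :: nat where N: "3 * pi / \<delta> < real N" using reals_Archimedean2 by blast
  show ?thesis
  proof (rule eventually_sequentiallyI[of "N + 1"])
    fix M assume "N + 1 \<le> M"
    then have M: "0 < M" "3 * pi / \<delta> < real M" using N by auto
    then have lt: "3 * pi / real M < \<delta>" using \<delta>(1) by (simp add: field_simps)
    have False if "z \<in> hex_brick M c" "z \<in> X" "w \<in> hex_brick M c" "w \<in> Y" for c z w
      using dist_hex_brick[OF M(1) that(1,3)] \<delta>(2) that lt by fastforce
    then show "\<forall>c. hex_brick M c \<inter> X = {} \<or> hex_brick M c \<inter> Y = {}" by blast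
  qed
qed

text \<open>The arcs may be irregular, so only compact connected pieces of them are used. The stars
  \<open>X v\<close> are pairwise disjoint, so are the middle thirds \<open>Me e\<close>, and
  \<open>Me e\<close> meets exactly the stars of its ends; a fine enough tiling keeps these
  incidences for the sets of cells.\<close>

theorem toroidal_rotation_system:
  fixes V :: "'a set" and E :: "'a set set"
  assumes "toroidal V E" "V \<noteq> {}" and iso: "\<And>v. v \<in> V \<Longrightarrow> \<exists>e\<in>E. v \<in> e"
  obtains \<tau> where "rotation_system E \<tau>"
    "card (arcs E) \<le> 2 * card (orbit (\<tau> \<circ> arc_rev E) ` arcs E) + 2 * card V"
proof -
  obtain p \<gamma> where "simple_graph V E" and emb: "torus_embedding V E p \<gamma>"
    using assms(1) unfolding toroidal_def by blast
  then have finV: "finite V" and E: "\<And>e. e \<in> E \<Longrightarrow> e \<subseteq> V \<and> card e = 2"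
    by (auto simp: simple_graph_def)
  have "E \<subseteq> Pow V" using E by auto
  then have finE: "finite E" using finV finite_subset by blast
  note emb = emb[unfolded torus_embedding_def]
  have inj: "p u = p v \<longleftrightarrow> u = v" if "u \<in> V" "v \<in> V" for u v
    using emb that by (auto simp: inj_on_def)
  have pV: "p v \<in> torus" if "v \<in> V" for v using emb that by auto
  have arc: "arc (\<gamma> e)" "path_image (\<gamma> e) \<subseteq> torus" "{\<gamma> e 0, \<gamma> e 1} = p ` e"
    "path_image (\<gamma> e) \<inter> p ` V = p ` e" if "e \<in> E" for e
    using emb that unfolding pathstart_def pathfinish_def by auto
  have cross: "path_image (\<gamma> e) \<inter> path_image (\<gamma> f) = p ` (e \<inter> f)" if "e \<in> E" "f \<in> E" "e \<noteq> f" for e f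
    using emb that by auto
  have ginj: "\<gamma> e s = \<gamma> e t \<longleftrightarrow> s = t" if "e \<in> E" "s \<in> {0..1}" "t \<in> {0..1}" for e s t
    using arc(1)[OF that(1)] that(2,3) by (auto simp: arc_def inj_on_def)
  have gcont: "continuous_on {0..1} (\<gamma> e)" if "e \<in> E" for e
    using arc(1)[OF that] by (simp add: arc_def path_def)
  have gin: "\<gamma> e t \<in> path_image (\<gamma> e)" if "t \<in> {0..1}" for e t using that by (auto simp: path_image_def)
  have gV: "t = 0 \<or> t = 1" if "e \<in> E" "t \<in> {0..1}" "\<gamma> e t \<in> p ` V" for e t
  proof -
    have "\<gamma> e t \<in> {\<gamma> e 0, \<gamma> e 1}"
      using gin[OF that(2), of e] that(3) arc(3,4)[OF that(1)]
      by blast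
    then show ?thesis using ginj[OF that(1,2), of 0] ginj[OF that(1,2), of 1] by auto
  qed
  have ends: "\<gamma> e 1 = p v" if e: "e \<in> E" "v \<in> e" "\<gamma> e 0 \<noteq> p v" for e v
  proof -
    have "p v \<in> {\<gamma> e 0, \<gamma> e 1}" unfolding arc(3)[OF e(1)] using e by blast
    then show ?thesis using e by auto
  qed
  \<comment> \<open>The arc has its own direction, so the third belonging to \<open>v\<close> is the
    one that starts or ends at \<open>p v\<close>.\<close>
  define A where "A e v = \<gamma> e ` (if \<gamma> e 0 = p v then {0..1/3} else {2/3..1})" for e v
  have AL: "A e v = \<gamma> e ` {0..1/3}" if "\<gamma> e 0 = p v" for e v using that by (simp add: A_def)
  have AR: "A e v = \<gamma> e ` {2/3..1}" if "\<gamma> e 0 \<noteq> p v" for e v using that by (simp add: A_def)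
  define Me where "Me e = \<gamma> e ` {1/3..2/3}" for e
  define X where "X v = \<Union> (insert {p v} ((\<lambda>e. A e v) ` {e \<in> E. v \<in> e}))" for v
  have Apath: "A e v \<subseteq> path_image (\<gamma> e)" for e v by (auto simp: A_def path_image_def split: if_splits)
  have Mpath: "Me e \<subseteq> path_image (\<gamma> e)" for e by (auto simp: Me_def path_image_def)
  have pA: "p v \<in> A e v" if e: "e \<in> E" "v \<in> e" for e v
  proof (cases "\<gamma> e 0 = p v")
    case True
    have "\<gamma> e 0 \<in> A e v" unfolding AL[OF True] by (intro imageI) simp
    moreover have "p v = \<gamma> e 0" using True by simp
    ultimately show ?thesis by simp
  next
    case False
    have "\<gamma> e 1 \<in> A e v" unfolding AR[OF False] by (intro imageI) simp
    moreover have "p v = \<gamma> e 1" using ends[OF e False] by simp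
    ultimately show ?thesis by simp
  qed
  have AV: "z = p v" if e: "e \<in> E" "v \<in> e" "z \<in> A e v" "z \<in> p ` V" for e v z
  proof (cases "\<gamma> e 0 = p v")
    case True
    then obtain t where t: "t \<in> {0..1/3}" "z = \<gamma> e t" using e(3) unfolding AL[OF True] by blast
    then have "t = 0 \<or> t = 1" using gV[of e t] e by auto
    then show ?thesis using t True by auto
  next
    case False
    then obtain t where t: "t \<in> {2/3..1}" "z = \<gamma> e t" using e(3) unfolding AR[OF False] by blast
    then have "t = 0 \<or> t = 1" using gV[of e t] e by auto
    then show ?thesis using t ends[OF e(1,2) False] by auto
  qed
  have MV: "Me e \<inter> p ` V = {}" if "e \<in> E" for e
  proof -
    have False if z: "z \<in> Me e" "z \<in> p ` V" for z
    proof -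
      obtain t where t: "t \<in> {1/3..2/3}" "z = \<gamma> e t" using z(1) unfolding Me_def by blast
      then have "t = 0 \<or> t = 1" using gV[OF \<open>e \<in> E\<close>, of t] z(2) by auto
      then show False using t(1) by auto
    qed
    then show ?thesis by blast
  qed
  have crossV: "z \<in> p ` V" if "e \<in> E" "f \<in> E" "e \<noteq> f" "z \<in> path_image (\<gamma> e)" "z \<in> path_image (\<gamma> f)" for e f z
    using cross[OF that(1-3)] that(4,5) E[OF that(1)] by blast
  have inX: "z \<in> X v \<longleftrightarrow> z = p v \<or> (\<exists>e\<in>E. v \<in> e \<and> z \<in> A e v)" for z v by (auto simp: X_def)
  \<comment> \<open>A common point is no vertex point, since \<open>X v\<close> contains only
    \<open>p v\<close> of these. So it lies on a single edge joining \<open>u\<close> and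
    \<open>v\<close>, with a parameter both at most 1/3 and at least 2/3.\<close>
  have XX: "X u \<inter> X v = {}" if uv: "u \<in> V" "v \<in> V" "u \<noteq> v" for u v
  proof -
    have ne: "p u \<noteq> p v" using inj uv by blast
    have False if z: "z \<in> X u" "z \<in> X v" for z
    proof -
      have "z \<notin> p ` V"
      proof
        assume zV: "z \<in> p ` V"
        then have "z = p u" using z(1) AV inX by blast
        moreover have "z = p v" using z(2) zV AV inX by blast
        ultimately show False using ne by simp
      qed
      then obtain e f where ef: "e \<in> E" "u \<in> e" "z \<in> A e u" "f \<in> E" "v \<in> f" "z \<in> A f v"
        using z inX uv by blast
      have "e = f" using crossV[OF ef(1,4)] Apath ef \<open>z \<notin> p ` V\<close> by blast
      obtain s t where st: "s \<in> {0..1}" "t \<in> {0..1}" "z = \<gamma> e s" "z = \<gamma> e t"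
        "if \<gamma> e 0 = p u then s \<le> 1/3 else s \<ge> 2/3" "if \<gamma> e 0 = p v then t \<le> 1/3 else t \<ge> 2/3"
        using ef(3,6) \<open>e = f\<close> by (auto simp: A_def split: if_splits)
      then have "s = t" using ginj[OF ef(1)] by blast
      moreover have "\<gamma> e 0 = p u \<or> \<gamma> e 0 = p v"
        using ends[OF ef(1,2)] ends[OF ef(1), of v] ef \<open>e = f\<close> ne by metis
      ultimately show False using st(5,6) ne by (auto split: if_splits)
    qed
    then show ?thesis by blast
  qed
  have MX: "Me e \<inter> X w = {}" if e: "e \<in> E" "w \<in> V" "w \<notin> e" for e w
  proof -
    have False if z: "z \<in> Me e" "z \<in> X w" for z
    proof -
      have "z \<noteq> p w" using MV[OF e(1)] z e by blast
      then obtain f where f: "f \<in> E" "w \<in> f" "z \<in> A f w" using z inX by blast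
      then have "z \<in> p ` V" using crossV[OF e(1) f(1)] Apath Mpath z e by blast
      then show False using MV[OF e(1)] z by blast
    qed
    then show ?thesis by blast
  qed
  have MM: "Me e \<inter> Me f = {}" if e: "e \<in> E" "f \<in> E" "e \<noteq> f" for e f
    using crossV[OF e] Mpath MV[OF e(1)] by blast
  have meet: "Me e \<inter> X v \<noteq> {}" if e: "e \<in> E" "v \<in> e" for e v
  proof (cases "\<gamma> e 0 = p v")
    case True
    have "\<gamma> e (1/3) \<in> A e v" unfolding AL[OF True] by (intro imageI) simp
    moreover have "\<gamma> e (1/3) \<in> Me e" unfolding Me_def by (intro imageI) simp
    ultimately show ?thesis using inX e by blast
  next
    case False
    have "\<gamma> e (2/3) \<in> A e v" unfolding AR[OF False] by (intro imageI) simp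
    moreover have "\<gamma> e (2/3) \<in> Me e" unfolding Me_def by (intro imageI) simp
    ultimately show ?thesis using inX e by blast
  qed
  have sub_top: "compact (\<gamma> e ` {a..b})" "connected (\<gamma> e ` {a..b})" if e: "e \<in> E" "0 \<le> a" "b \<le> 1" for e a b
  proof -
    have "continuous_on {a..b} (\<gamma> e)"
      by (rule continuous_on_subset[OF gcont[OF e(1)]]) (use e in auto)
    then show "compact (\<gamma> e ` {a..b})" "connected (\<gamma> e ` {a..b})"
      by (auto intro: compact_continuous_image connected_continuous_image)
  qed
  have A_top: "compact (A e v)" "connected (A e v)" if e: "e \<in> E" for e v
    unfolding A_def using sub_top[OF e] by auto
  have M_top: "compact (Me e)" "connected (Me e)" if e: "e \<in> E" for e
    unfolding Me_def using sub_top[OF e] by auto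
  have X_comp: "compact (X v)" for v
    unfolding X_def using finE A_top by (intro compact_Union) auto
  have X_conn: "connected (X v)" if "v \<in> V" for v
    unfolding X_def
  proof (rule connected_Union)
    show "connected s" if "s \<in> insert {p v} ((\<lambda>e. A e v) ` {e \<in> E. v \<in> e})" for s using that A_top by auto
    have "p v \<in> \<Inter> (insert {p v} ((\<lambda>e. A e v) ` {e \<in> E. v \<in> e}))" using pA by auto
    then show "\<Inter> (insert {p v} ((\<lambda>e. A e v) ` {e \<in> E. v \<in> e})) \<noteq> {}" by blast
  qed
  have X_torus: "X v \<subseteq> torus" if "v \<in> V" for v
  proof
    fix z assume "z \<in> X v"
    then consider "z = p v" | e where "e \<in> E" "z \<in> A e v" using inX by blast
    then show "z \<in> torus"
    proof cases
      case 1 then show ?thesis using pV[OF \<open>v \<in> V\<close>] by simp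
    next
      case 2 then show ?thesis using Apath[of e v] arc(2)[OF 2(1)] by blast
    qed
  qed
  have M_torus: "Me e \<subseteq> torus" if "e \<in> E" for e
    using Mpath[of e] arc(2)[OF that] by (rule subset_trans)
  let ?sep = "\<lambda>M Y Z. \<forall>c. hex_brick M c \<inter> Y = {} \<or> hex_brick M c \<inter> Z = {}"
  \<comment> \<open>Only finitely many disjoint pairs of compact sets occur, so one \<open>M\<close>
    separates them all.\<close>
  have ev: "eventually (\<lambda>M. 0 < M \<and> (\<forall>u\<in>V. \<forall>v\<in>V. u \<noteq> v \<longrightarrow> ?sep M (X u) (X v)) \<and>
     (\<forall>e\<in>E. \<forall>w\<in>V. w \<notin> e \<longrightarrow> ?sep M (Me e) (X w)) \<and>
     (\<forall>e\<in>E. \<forall>f\<in>E. e \<noteq> f \<longrightarrow> ?sep M (Me e) (Me f))) sequentially"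
  proof (intro eventually_conj eventually_ball_finite ballI finV finE)
    show "eventually (\<lambda>M. 0 < M) (sequentially)" by (rule eventually_gt_at_top)
    show "eventually (\<lambda>M. u \<noteq> v \<longrightarrow> ?sep M (X u) (X v)) sequentially" if "u \<in> V" "v \<in> V" for u v
      using eventually_bricks_separate[OF X_comp X_comp XX[OF that]] by (cases "u = v") auto
    show "eventually (\<lambda>M. w \<notin> e \<longrightarrow> ?sep M (Me e) (X w)) sequentially" if "e \<in> E" "w \<in> V" for e w
      using eventually_bricks_separate[OF M_top(1)[OF that(1)] X_comp MX[OF that]] by (cases "w \<in> e") auto
    show "eventually (\<lambda>M. e \<noteq> f \<longrightarrow> ?sep M (Me e) (Me f)) sequentially" if "e \<in> E" "f \<in> E" for e f
      using eventually_bricks_separate[OF M_top(1)[OF that(1)] M_top(1)[OF that(2)] MM[OF that]] by (cases "e = f") auto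
  qed
  from eventually_happens'[OF sequentially_bot ev] obtain M where H: "0 < M \<and> (\<forall>u\<in>V. \<forall>v\<in>V. u \<noteq> v \<longrightarrow> ?sep M (X u) (X v)) \<and>
     (\<forall>e\<in>E. \<forall>w\<in>V. w \<notin> e \<longrightarrow> ?sep M (Me e) (X w)) \<and>
     (\<forall>e\<in>E. \<forall>f\<in>E. e \<noteq> f \<longrightarrow> ?sep M (Me e) (Me f))"
    by (elim exE)
  have M: "0 < M" and sXX: "\<And>u v. u \<in> V \<Longrightarrow> v \<in> V \<Longrightarrow> u \<noteq> v \<Longrightarrow> ?sep M (X u) (X v)"
    and sMX: "\<And>e w. e \<in> E \<Longrightarrow> w \<in> V \<Longrightarrow> w \<notin> e \<Longrightarrow> ?sep M (Me e) (X w)"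
    and sMM: "\<And>e f. e \<in> E \<Longrightarrow> f \<in> E \<Longrightarrow> e \<noteq> f \<Longrightarrow> ?sep M (Me e) (Me f)"
    using H by simp_all
  let ?cells = "\<lambda>Y. {c \<in> hex_cells M. hex_brick M c \<inter> Y \<noteq> {}}"
  have cells_ne: "?cells Y \<noteq> {}" if "Y \<subseteq> torus" "Y \<noteq> {}" for Y
    using that hex_brick_cover[OF M] by blast
  have tor: "connected torus" unfolding torus_def
    by (intro connected_Times connected_sphere) simp_all
  have "?cells torus = hex_cells M"
  proof -
    have "hex_brick M c \<inter> torus \<noteq> {}" for c
    proof -
      have "hex_point M c 0 0 \<in> hex_brick M c" by (force simp: hex_brick_def)
      moreover have "hex_point M c 0 0 \<in> torus" by (simp add: hex_point_def torus_def)
      ultimately show ?thesis by blast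
    qed
    then show ?thesis by blast
  qed
  then have conn: "cut_connected (hex_adj M) (hex_cells M)"
    using hex_cells_meeting_connected[OF M tor] by simp
  show thesis
  proof (rule minor_partition[OF finite_hex_cells hex_adj_sym conn finV assms(2), of E "\<lambda>v. ?cells (X v)" "\<lambda>e. ?cells (Me e)"])
    show "e \<in> E \<Longrightarrow> e \<subseteq> V \<and> card e = 2" for e by (rule E)
    show "?cells (X v) \<subseteq> hex_cells M \<and> ?cells (X v) \<noteq> {} \<and> cut_connected (hex_adj M) (?cells (X v))"
      if "v \<in> V" for v
    proof (intro conjI)
      show "?cells (X v) \<noteq> {}" using cells_ne[OF X_torus[OF that]] inX by blast
      show "cut_connected (hex_adj M) (?cells (X v))"
        by (rule hex_cells_meeting_connected[OF M X_conn[OF that] X_torus[OF that]])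
    qed auto
    show "?cells (X u) \<inter> ?cells (X v) = {}" if "u \<in> V" "v \<in> V" "u \<noteq> v" for u v
      using sXX[OF that] by auto
    show "?cells (Me e) \<subseteq> hex_cells M \<and> cut_connected (hex_adj M) (?cells (Me e))" if "e \<in> E" for e
      using hex_cells_meeting_connected[OF M M_top(2)[OF that] M_torus[OF that]] by auto
    show "?cells (Me e) \<inter> ?cells (Me f) = {}" if "e \<in> E" "f \<in> E" "e \<noteq> f" for e f
      using sMM[OF that] by auto
    show "?cells (Me e) \<inter> ?cells (X v) = {} \<longleftrightarrow> v \<notin> e" if ev: "e \<in> E" "v \<in> V" for e v
    proof
      assume "v \<notin> e"
      then show "?cells (Me e) \<inter> ?cells (X v) = {}" using sMX[OF ev] by auto
    next
      assume em: "?cells (Me e) \<inter> ?cells (X v) = {}"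
      show "v \<notin> e"
      proof
        assume "v \<in> e"
        then obtain z where z: "z \<in> Me e" "z \<in> X v" using meet[OF ev(1)] by blast
        then obtain c where "c \<in> hex_cells M" "z \<in> hex_brick M c"
          using hex_brick_cover[OF M] M_torus[OF ev(1)] by blast
        then show False using em z by blast
      qed
    qed
  next
    fix \<beta> assume \<beta>: "\<beta> ` hex_cells M = V"
      "\<And>v. v \<in> V \<Longrightarrow> cut_connected (hex_adj M) {c \<in> hex_cells M. \<beta> c = v}"
      "\<And>e. e \<in> E \<Longrightarrow> \<exists>x\<in>hex_cells M. \<exists>y\<in>hex_cells M. hex_adj M x y \<and> e = {\<beta> x, \<beta> y}"
    show thesis
    proof (rule rotation_of_hex_partition[of E V \<beta> M, OF E iso \<beta>])
      fix \<tau> assume "rotation_system E \<tau>"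
        "card (arcs E) \<le> 2 * card (orbit (\<tau> \<circ> arc_rev E) ` arcs E) + 2 * card V"
      then show thesis by (rule that)
    qed
  qed
qed

section \<open>Reducible configurations\<close>

definition nbrs :: "'a set set \<Rightarrow> 'a \<Rightarrow> 'a set" where
  "nbrs E v = {u. {v, u} \<in> E}"

definition induced :: "'a set set \<Rightarrow> 'a set \<Rightarrow> 'a set set" where
  "induced E W = {e \<in> E. e \<subseteq> W}"

lemma nbrs_sym: "u \<in> nbrs E v \<longleftrightarrow> v \<in> nbrs E u"
  by (simp add: nbrs_def insert_commute)

lemma nbrs_induced: "v \<in> W \<Longrightarrow> nbrs (induced E W) v = {u \<in> W. {u, v} \<in> E}"
  by (auto simp: nbrs_def induced_def insert_commute)

text \<open>The new colours avoid those of coloured neighbours, so no monochromatic edge leaves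
  \<open>H\<close> and the defect needs checking inside \<open>H\<close> only.\<close>

lemma extend_defective_coloring:
  assumes "H \<subseteq> W" and \<phi>: "defective_list_coloring (W - H) E L d \<phi>"
    and \<psi>: "\<And>v. v \<in> H \<Longrightarrow> \<psi> v \<in> L v - \<phi> ` {u \<in> W - H. {u, v} \<in> E}"
      "\<And>v. v \<in> H \<Longrightarrow> card {u \<in> H. {u, v} \<in> E \<and> \<psi> u = \<psi> v} \<le> d"
  shows "\<exists>\<phi>. defective_list_coloring W E L d \<phi>"
proof
  let ?f = "\<lambda>v. if v \<in> H then \<psi> v else \<phi> v"
  have ne: "\<phi> u \<noteq> \<psi> v" if "v \<in> H" "u \<in> W - H" "{u, v} \<in> E" for u v
  proof -
    have "\<phi> u \<in> \<phi> ` {u \<in> W - H. {u, v} \<in> E}" by (rule imageI) (use that in simp)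
    then show ?thesis using \<psi>(1)[OF that(1)] by auto
  qed
  show "defective_list_coloring W E L d ?f"
    unfolding defective_list_coloring_def
  proof (intro ballI)
    fix v assume v: "v \<in> W"
    show "?f v \<in> L v \<and> card {u \<in> W. {u, v} \<in> E \<and> ?f u = ?f v} \<le> d"
    proof (cases "v \<in> H")
      case True
      then have "{u \<in> W. {u, v} \<in> E \<and> ?f u = ?f v} = {u \<in> H. {u, v} \<in> E \<and> \<psi> u = \<psi> v}"
        using assms(1) ne by auto
      then show ?thesis using \<psi>[OF True] True by simp
    next
      case False
      have "{u \<in> W. {u, v} \<in> E \<and> ?f u = ?f v} = {u \<in> W - H. {u, v} \<in> E \<and> \<phi> u = \<phi> v}"
        using False v ne by (force simp: insert_commute)
      then show ?thesis using \<phi> False v by (simp add: defective_list_coloring_def)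
    qed
  qed
qed

text \<open>Each coloured neighbour removes at most one of the three colours, and neighbours in
  \<open>H\<close> remove none. The additive form avoids subtraction of natural numbers.\<close>

lemma card_residual_list:
  assumes "finite (nbrs (induced E W) v)" "v \<in> W" "card (L v) = 3" "H \<subseteq> W"
  shows "3 + card (nbrs (induced E W) v \<inter> H) \<le>
    card (L v - \<phi> ` {u \<in> W - H. {u, v} \<in> E}) + card (nbrs (induced E W) v)"
proof -
  let ?O = "{u \<in> W - H. {u, v} \<in> E}" and ?N = "nbrs (induced E W) v"
  have N: "?N = {u \<in> W. {u, v} \<in> E}" by (rule nbrs_induced[OF assms(2)])
  have O: "?O = ?N - H" using N by auto
  have finO: "finite ?O" using O assms(1) by simp
  have "3 \<le> card (L v - \<phi> ` ?O) + card (\<phi> ` ?O)"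
    using diff_card_le_card_Diff[of "\<phi> ` ?O" "L v"] finO assms(3) by simp
  moreover have "card (\<phi> ` ?O) \<le> card ?O" using finO by (rule card_image_le)
  moreover have "card ?O + card (?N \<inter> H) = card ?N"
    unfolding O using card_Int_Diff[OF assms(1), of H] by simp
  ultimately show ?thesis by simp
qed

lemma ex_mem_of_card_pos: "0 < card A \<Longrightarrow> \<exists>x. x \<in> A"
  by (metis card_gt_0_iff ex_in_conv)

text \<open>Leaves are coloured first; a leaf of degree 3 keeps a colour because \<open>v\<close> is
  still uncoloured. With k leaves and degree d, at least 3 + k - d colours are left for
  \<open>v\<close>. If each occurred on two leaves, then 2 (3 + k - d) \<le> k, against
  \<open>big\<close>. So some colour occurs at most once, and independent leaves can clash with
  \<open>v\<close> only.\<close>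

lemma star_colorable:
  assumes W: "finite W" "v \<in> W" and E: "\<And>e. e \<in> E \<Longrightarrow> card e = 2"
    and L: "\<And>v. v \<in> W \<Longrightarrow> card (L v) = 3"
    and K: "K \<subseteq> nbrs (induced E W) v" "\<And>x. x \<in> K \<Longrightarrow> card (nbrs (induced E W) x) = 3"
      "\<And>x y. x \<in> K \<Longrightarrow> y \<in> K \<Longrightarrow> {x, y} \<notin> E"
    and big: "2 * card (nbrs (induced E W) v) < card K + 6"
    and \<phi>: "defective_list_coloring (W - insert v K) E L 1 \<phi>"
  shows "\<exists>\<phi>. defective_list_coloring W E L 1 \<phi>"
proof -
  let ?H = "insert v K" and ?N = "nbrs (induced E W)"
  let ?R = "\<lambda>x. L x - \<phi> ` {u \<in> W - ?H. {u, x} \<in> E}"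
  have NW: "?N x \<subseteq> W" if "x \<in> W" for x using nbrs_induced[OF that] by auto
  have finN: "finite (?N x)" if "x \<in> W" for x using NW[OF that] W(1) finite_subset by blast
  have HW: "?H \<subseteq> W" using K(1) NW[OF W(2)] W(2) by auto
  have finK: "finite K" using K(1) finN[OF W(2)] finite_subset by blast
  have loop: "{x} \<notin> E" for x using E[of "{x}"] by auto
  have vK: "v \<notin> K" using K(1) loop by (auto simp: nbrs_def induced_def)
  have res: "3 + card (?N x \<inter> ?H) \<le> card (?R x) + card (?N x)" if "x \<in> W" for x
    by (rule card_residual_list[where L = L, OF finN[OF that] that L[OF that] HW])
  have "\<forall>x\<in>K. \<exists>c. c \<in> ?R x"
  proof
    fix x assume x: "x \<in> K"
    have xW: "x \<in> W" using x HW by auto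
    have "v \<in> ?N x \<inter> ?H" using x K(1) nbrs_sym by fastforce
    then have "0 < card (?N x \<inter> ?H)" using finN[OF xW] by (auto simp: card_gt_0_iff)
    then have "0 < card (?R x)" using res[OF xW] K(2)[OF x] by simp
    then show "\<exists>c. c \<in> ?R x" by (rule ex_mem_of_card_pos)
  qed
  from bchoice[OF this] obtain g where "\<forall>x\<in>K. g x \<in> ?R x" by (elim exE)
  note g = this[rule_format]
  have "\<exists>c\<in>?R v. card {x \<in> K. g x = c} \<le> 1"
  proof (rule ccontr)
    assume "\<not> ?thesis"
    then have two: "2 \<le> card {x \<in> K. g x = c}" if "c \<in> ?R v" for c using that by force
    have "finite (L v)" by (rule card_ge_0_finite) (simp add: L[OF W(2)])
    then have finR: "finite (?R v)" by simp
    have "2 * card (?R v) = (\<Sum>c\<in>?R v. 2)" by simp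
    also have "\<dots> \<le> (\<Sum>c\<in>?R v. card {x \<in> K. g x = c})" by (rule sum_mono) (rule two)
    also have "\<dots> = card (\<Union>c\<in>?R v. {x \<in> K. g x = c})"
      using finR finK by (subst card_UN_disjoint) auto
    also have "\<dots> \<le> card K" using finK by (intro card_mono) auto
    finally have "2 * card (?R v) \<le> card K" .
    moreover have "?N v \<inter> ?H = K" using K(1) loop by (auto simp: nbrs_def induced_def)
    ultimately show False using res[OF W(2)] big by simp
  qed
  then obtain c where c: "c \<in> ?R v" "card {x \<in> K. g x = c} \<le> 1" by blast
  let ?g = "g(v := c)"
  show ?thesis
  proof (rule extend_defective_coloring[OF HW \<phi>])
    fix x assume x: "x \<in> ?H"
    show "?g x \<in> ?R x" using x c g vK by auto
    show "card {u \<in> ?H. {u, x} \<in> E \<and> ?g u = ?g x} \<le> 1"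
    proof (cases "x = v")
      case True
      have "{u \<in> ?H. {u, x} \<in> E \<and> ?g u = ?g x} \<subseteq> {x \<in> K. g x = c}"
        using True loop by auto
      then have "card {u \<in> ?H. {u, x} \<in> E \<and> ?g u = ?g x} \<le> card {x \<in> K. g x = c}"
        using finK by (intro card_mono) auto
      then show ?thesis using c(2) by simp
    next
      case False
      then have "{u \<in> ?H. {u, x} \<in> E \<and> ?g u = ?g x} \<subseteq> {v}" using x K(3) by auto
      then have "card {u \<in> ?H. {u, x} \<in> E \<and> ?g u = ?g x} \<le> card {v}" by (intro card_mono) auto
      then show ?thesis by simp
    qed
  qed
qed

text \<open>At least 2, 1, 1 colours remain for \<open>x\<close>, \<open>y\<close>,
  \<open>z\<close>. If \<open>x\<close> and \<open>y\<close> get different colours, only the two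
  edges at \<open>z\<close> can be monochromatic, and not both.\<close>

lemma triangle_colorable:
  assumes W: "finite W" "x \<in> W" "y \<in> W" "z \<in> W" and E: "\<And>e. e \<in> E \<Longrightarrow> card e = 2"
    and L: "\<And>v. v \<in> W \<Longrightarrow> card (L v) = 3"
    and T: "{x, y} \<in> E" "{y, z} \<in> E" "{x, z} \<in> E"
    and deg: "card (nbrs (induced E W) x) = 3" "card (nbrs (induced E W) y) = 4" "card (nbrs (induced E W) z) = 4"
    and \<phi>: "defective_list_coloring (W - {x, y, z}) E L 1 \<phi>"
  shows "\<exists>\<phi>. defective_list_coloring W E L 1 \<phi>"
proof -
  let ?H = "{x, y, z}" and ?N = "nbrs (induced E W)"
  let ?R = "\<lambda>x. L x - \<phi> ` {u \<in> W - ?H. {u, x} \<in> E}"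
  have loop: "{x} \<notin> E" for x using E[of "{x}"] by auto
  have ne: "x \<noteq> y" "y \<noteq> z" "x \<noteq> z" using T loop by auto
  have finN: "finite (?N v)" if "v \<in> W" for v using nbrs_induced[OF that] W(1) by auto
  have HW: "?H \<subseteq> W" using W by auto
  have res: "3 + card (?N v \<inter> ?H) \<le> card (?R v) + card (?N v)" if "v \<in> W" for v
    by (rule card_residual_list[where L = L, OF finN[OF that] that L[OF that] HW])
  have two: "card (?N v \<inter> ?H) \<ge> 2" if "v \<in> ?H" for v
  proof -
    have "?H - {v} \<subseteq> ?N v \<inter> ?H"
      using that T W by (auto simp: nbrs_def induced_def insert_commute)
    then have "card (?H - {v}) \<le> card (?N v \<inter> ?H)" by (intro card_mono) auto
    moreover have "card (?H - {v}) = 2" using that ne by auto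
    ultimately show ?thesis by simp
  qed
  have Rx: "2 \<le> card (?R x)" using res[OF W(2)] two[of x] deg by simp
  have Ry: "1 \<le> card (?R y)" using res[OF W(3)] two[of y] deg by simp
  have Rz: "1 \<le> card (?R z)" using res[OF W(4)] two[of z] deg by simp
  obtain b where b: "b \<in> ?R y" using ex_mem_of_card_pos[of "?R y"] Ry by auto
  obtain c where c: "c \<in> ?R z" using ex_mem_of_card_pos[of "?R z"] Rz by auto
  have "\<exists>a\<in>?R x. a \<noteq> b"
  proof (rule ccontr)
    assume "\<not> ?thesis"
    then have "?R x \<subseteq> {b}" by blast
    then have "card (?R x) \<le> card {b}" by (intro card_mono) auto
    then show False using Rx by simp
  qed
  then obtain a where a: "a \<in> ?R x" "a \<noteq> b" by blast
  define g where "g = (\<lambda>_. a)(y := b, z := c)"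
  have g: "g x = a" "g y = b" "g z = c" using ne by (simp_all add: g_def)
  show ?thesis
  proof (rule extend_defective_coloring[OF HW \<phi>])
    fix v assume v: "v \<in> ?H"
    then consider "v = x" | "v = y" | "v = z" by blast
    then show "g v \<in> ?R v" by cases (simp_all only: g a b c)
    \<comment> \<open>The only vertex of the triangle that can share the colour of
      \<open>v\<close>.\<close>
    define w where "w = (if v = x then z else if v = y then z else if b = c then y else x)"
    have "u = w" if u: "u \<in> ?H" "{u, v} \<in> E" "g u = g v" for u
    proof -
      have "u \<noteq> v" using u(2) loop by auto
      moreover have "{u, v} \<noteq> {x, y}" using u(3) g a(2) by (auto simp: doubleton_eq_iff)
      ultimately have "{u, v} = {x, z} \<or> {u, v} = {y, z}" using u(1) v by auto
      moreover have "a \<noteq> c" if "b = c" using that a(2) by simp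
      ultimately show ?thesis
        unfolding w_def using ne u(3) g by (auto simp: doubleton_eq_iff)
    qed
    then have "{u \<in> ?H. {u, v} \<in> E \<and> g u = g v} \<subseteq> {w}" by blast
    then have "card {u \<in> ?H. {u, v} \<in> E \<and> g u = g v} \<le> card {w}" by (intro card_mono) simp_all
    then show "card {u \<in> ?H. {u, v} \<in> E \<and> g u = g v} \<le> 1" by simp
  qed
qed

text \<open>\<open>W\<close> is a smallest uncolourable vertex set for lists cut down to three
  colours. The star bound contains more than it seems: \<open>K = {}\<close> gives minimum degree 3,
  and a single leaf shows that vertices of degree 3 are never adjacent.\<close>

theorem minimal_uncolorable:
  fixes V :: "'a set"
  assumes G: "simple_graph V E" and nc: "\<not> defective_choosable TYPE('c) 3 1 V E"
  obtains W where "W \<subseteq> V" "W \<noteq> {}"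
    "\<And>v K. v \<in> W \<Longrightarrow> K \<subseteq> nbrs (induced E W) v \<Longrightarrow> (\<And>x. x \<in> K \<Longrightarrow> card (nbrs (induced E W) x) = 3) \<Longrightarrow>
      (\<And>x y. x \<in> K \<Longrightarrow> y \<in> K \<Longrightarrow> {x, y} \<notin> E) \<Longrightarrow> card K + 6 \<le> 2 * card (nbrs (induced E W) v)"
    "\<And>x y z. {x, y} \<in> induced E W \<Longrightarrow> {y, z} \<in> induced E W \<Longrightarrow> {x, z} \<in> induced E W \<Longrightarrow>
      card (nbrs (induced E W) x) = 3 \<Longrightarrow> card (nbrs (induced E W) y) = 4 \<Longrightarrow> card (nbrs (induced E W) z) \<noteq> 4"
proof -
  have finV: "finite V" and E2: "\<And>e. e \<in> E \<Longrightarrow> card e = 2" using G by (auto simp: simple_graph_def)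
  obtain L :: "'a \<Rightarrow> 'c set" where L: "\<And>v. v \<in> V \<Longrightarrow> finite (L v) \<Longrightarrow> 3 \<le> card (L v)"
    and nL: "\<not> (\<exists>\<phi>. defective_list_coloring V E L 1 \<phi>)"
    using nc unfolding defective_choosable_def by blast
  have "\<exists>S. S \<subseteq> L v \<and> card S = 3" if "v \<in> V" for v
  proof (cases "finite (L v)")
    case True
    then show ?thesis using obtain_subset_with_card_n[OF L[OF that]] by metis
  next
    case False
    then show ?thesis using infinite_arbitrarily_large[of "L v" 3] by blast
  qed
  then have "\<forall>v\<in>V. \<exists>S. S \<subseteq> L v \<and> card S = 3" by blast
  from bchoice[OF this] obtain L' where "\<forall>v\<in>V. L' v \<subseteq> L v \<and> card (L' v) = 3" by (elim exE)
  note L' = this[rule_format]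
  \<comment> \<open>\<open>E\<close> can stay fixed here, because a colouring of \<open>W\<close>
    counts neighbours inside \<open>W\<close> only.\<close>
  define bad where "bad W \<longleftrightarrow> W \<subseteq> V \<and> \<not> (\<exists>\<phi>. defective_list_coloring W E L' 1 \<phi>)" for W
  have badV: "bad V"
    unfolding bad_def
  proof (intro conjI notI)
    assume "\<exists>\<phi>. defective_list_coloring V E L' 1 \<phi>"
    then obtain \<phi> where "defective_list_coloring V E L' 1 \<phi>" ..
    then have "defective_list_coloring V E L 1 \<phi>" using L' unfolding defective_list_coloring_def by blast
    then show False using nL by blast
  qed simp
  obtain W where bW: "bad W" and Wmin: "\<And>W'. bad W' \<Longrightarrow> card W \<le> card W'"
    using ex_has_least_nat[of bad V card, OF badV] by auto
  note W = bW[unfolded bad_def]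
  have finW: "finite W" using W finV finite_subset by blast
  have L3: "card (L' v) = 3" if "v \<in> W" for v using W L' that by blast
  have smaller: "\<exists>\<phi>. defective_list_coloring (W - H) E L' 1 \<phi>" if HW: "H \<subseteq> W" "H \<noteq> {}" for H
  proof (rule ccontr)
    assume "\<not> ?thesis"
    then have "bad (W - H)" unfolding bad_def using W by auto
    from Wmin[OF this] have "card W \<le> card (W - H)" .
    moreover have "W - H \<subset> W" using HW by blast
    then have "card (W - H) < card W" by (rule psubset_card_mono[OF finW])
    ultimately show False by simp
  qed
  show ?thesis
  proof (rule that)
    show "W \<subseteq> V" using W by blast
    show "W \<noteq> {}"
    proof
      assume "W = {}"
      then have "defective_list_coloring W E L' 1 \<phi>" for \<phi> by (simp add: defective_list_coloring_def)
      then show False using W by simp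
    qed
    show "card K + 6 \<le> 2 * card (nbrs (induced E W) v)"
      if vK: "v \<in> W" "K \<subseteq> nbrs (induced E W) v" "\<And>x. x \<in> K \<Longrightarrow> card (nbrs (induced E W) x) = 3"
        "\<And>x y. x \<in> K \<Longrightarrow> y \<in> K \<Longrightarrow> {x, y} \<notin> E" for v K
    proof (rule ccontr)
      assume "\<not> ?thesis"
      then have big: "2 * card (nbrs (induced E W) v) < card K + 6" by simp
      have "K \<subseteq> W" using vK(2) nbrs_induced[OF vK(1)] by auto
      then obtain \<phi> where col: "defective_list_coloring (W - insert v K) E L' 1 \<phi>"
        using smaller[of "insert v K"] vK(1) by auto
      have "\<exists>\<phi>. defective_list_coloring W E L' 1 \<phi>"
        by (rule star_colorable[where L = L', OF finW vK(1) E2 L3 vK(2-4) big col])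
      then show False using W by simp
    qed
    show "card (nbrs (induced E W) z) \<noteq> 4"
      if T: "{x, y} \<in> induced E W" "{y, z} \<in> induced E W" "{x, z} \<in> induced E W"
        and d: "card (nbrs (induced E W) x) = 3" "card (nbrs (induced E W) y) = 4" for x y z
    proof
      assume dz: "card (nbrs (induced E W) z) = 4"
      have xyz: "x \<in> W" "y \<in> W" "z \<in> W" "{x, y} \<in> E" "{y, z} \<in> E" "{x, z} \<in> E"
        using T by (auto simp: induced_def)
      obtain \<phi> where col: "defective_list_coloring (W - {x, y, z}) E L' 1 \<phi>"
        using smaller[of "{x, y, z}"] xyz(1-3) by auto
      have "\<exists>\<phi>. defective_list_coloring W E L' 1 \<phi>"
        by (rule triangle_colorable[where L = L', OF finW xyz(1-3) E2 L3 xyz(4-6) d dz col])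
      then show False using W by simp
    qed
  qed
qed

section \<open>Faces and corners\<close>

lemma orbit_enum:
  assumes f: "f permutes D" "finite D"
  shows "0 < card (orbit f x)" "(f ^^ card (orbit f x)) x = x"
    "inj_on (\<lambda>n. (f ^^ n) x) {..<card (orbit f x)}"
    "orbit f x = (\<lambda>n. (f ^^ n) x) ` {..<card (orbit f x)}"
proof -
  have x: "x \<in> orbit f x" by (rule self_in_orbit_permutes[OF f])
  let ?p = "funpow_dist1 f x x"
  have im: "orbit f x = (\<lambda>n. (f ^^ n) x) ` {..<?p}"
    using orbit_conv_funpow_dist1[OF x] by (simp add: atLeast0LessThan)
  have inj: "inj_on (\<lambda>n. (f ^^ n) x) {..<?p}"
    using inj_on_funpow_dist1[OF x] by (simp add: atLeast0LessThan)
  have c: "card (orbit f x) = ?p" unfolding im by (subst card_image[OF inj]) simp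
  show "0 < card (orbit f x)" unfolding c by simp
  show "(f ^^ card (orbit f x)) x = x" unfolding c by (rule funpow_dist1_prop[OF x])
  show "inj_on (\<lambda>n. (f ^^ n) x) {..<card (orbit f x)}" unfolding c by (rule inj)
  show "orbit f x = (\<lambda>n. (f ^^ n) x) ` {..<card (orbit f x)}" unfolding c by (rule im)
qed

text \<open>What both cases share; the absence of 5- or 7-cycles is a premise of single lemmas.
  Minimum degree 3 makes any three consecutive neighbours in the rotation distinct.\<close>

locale graph_map =
  fixes V :: "'a set" and E :: "'a set set" and \<tau> :: "'a \<times> 'a \<Rightarrow> 'a \<times> 'a"
  assumes finite_V: "finite V"
    and edges: "\<And>e. e \<in> E \<Longrightarrow> e \<subseteq> V \<and> card e = 2"
    and rotation: "rotation_system E \<tau>"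
    and min_deg: "\<And>v. v \<in> V \<Longrightarrow> 3 \<le> card (nbrs E v)"
    and diamond_free: "\<And>u v x y. {u, v} \<in> E \<Longrightarrow> {u, x} \<in> E \<Longrightarrow> {v, x} \<in> E \<Longrightarrow> {u, y} \<in> E \<Longrightarrow> {v, y} \<in> E \<Longrightarrow> x = y"
    and no_6_cycle: "\<not> contains_cycle E 6"
begin

definition adj :: "'a \<Rightarrow> 'a \<Rightarrow> bool" where "adj u v \<longleftrightarrow> {u, v} \<in> E"

definition nx :: "'a \<Rightarrow> 'a \<Rightarrow> 'a" where "nx v u = snd (\<tau> (v, u))"

definition face_perm :: "'a \<times> 'a \<Rightarrow> 'a \<times> 'a" where "face_perm = \<tau> \<circ> arc_rev E"

text \<open>The pair \<open>(v, u)\<close> names the corner at \<open>v\<close> from \<open>u\<close> to \<open>nx v u\<close>, which belongs to the face entering \<open>v\<close> by the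
  dart \<open>(u, v)\<close>.\<close>

definition flen :: "'a \<Rightarrow> 'a \<Rightarrow> nat" where "flen v u = card (orbit face_perm (u, v))"

abbreviation deg :: "'a \<Rightarrow> nat" where "deg v \<equiv> card (nbrs E v)"

lemma adj_sym: "adj u v \<Longrightarrow> adj v u" by (simp add: adj_def insert_commute)

lemma adj_neq: "adj u v \<Longrightarrow> u \<noteq> v" using edges[of "{u, v}"] by (auto simp: adj_def)

lemma adj_V: "adj u v \<Longrightarrow> u \<in> V" using edges[of "{u, v}"] by (auto simp: adj_def)

lemma adj_V2: "adj u v \<Longrightarrow> v \<in> V" using edges[of "{u, v}"] by (auto simp: adj_def)

lemma in_nbrs: "u \<in> nbrs E v \<longleftrightarrow> adj v u" by (simp add: nbrs_def adj_def)

lemma in_arcs: "(u, v) \<in> arcs E \<longleftrightarrow> adj u v" by (simp add: arcs_def adj_def)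

lemma diamond: "adj u v \<Longrightarrow> adj u x \<Longrightarrow> adj v x \<Longrightarrow> adj u y \<Longrightarrow> adj v y \<Longrightarrow> x = y"
  unfolding adj_def by (rule diamond_free)

lemma finite_nbrs: "finite (nbrs E v)"
  by (rule finite_subset[OF _ finite_V]) (auto simp: in_nbrs adj_V2)

lemma finite_arcs: "finite (arcs E)"
  by (rule finite_subset[of _ "V \<times> V"]) (auto simp: in_arcs finite_V adj_V adj_V2)

lemma tau_permutes: "\<tau> permutes arcs E"
  using rotation by (simp add: rotation_system_def)

lemma tau_eq: "adj v u \<Longrightarrow> \<tau> (v, u) = (v, nx v u)"
  using rotation by (auto simp: rotation_system_def nx_def in_arcs prod_eq_iff)

lemma nx_adj: "adj v u \<Longrightarrow> adj v (nx v u)"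
  using permutes_in_image[OF tau_permutes, of "(v, u)"] tau_eq[of v u] by (simp add: in_arcs)

lemma nx_funpow_adj: "adj v u \<Longrightarrow> adj v ((nx v ^^ n) u)"
  by (induction n) (auto intro: nx_adj)

lemma tau_funpow: "adj v u \<Longrightarrow> (\<tau> ^^ n) (v, u) = (v, (nx v ^^ n) u)"
  by (induction n) (auto simp: tau_eq nx_funpow_adj)

lemma orbit_tau: "adj v u \<Longrightarrow> orbit \<tau> (v, u) = {v} \<times> nbrs E v"
proof (intro equalityI subsetI)
  fix d assume a: "adj v u" and d: "d \<in> orbit \<tau> (v, u)"
  then obtain n where "d = (\<tau> ^^ n) (v, u)" by (auto simp: orbit_altdef)
  then show "d \<in> {v} \<times> nbrs E v" using a tau_funpow nx_funpow_adj by (simp add: in_nbrs)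
next
  fix d assume a: "adj v u" and d: "d \<in> {v} \<times> nbrs E v"
  then have "d \<in> arcs E" "(v, u) \<in> arcs E" "fst (v, u) = fst d" by (auto simp: in_arcs in_nbrs)
  then show "d \<in> orbit \<tau> (v, u)" using rotation unfolding rotation_system_def by blast
qed

lemma nbrs_enum:
  assumes "adj v u"
  shows "nbrs E v = (\<lambda>i. (nx v ^^ i) u) ` {..<deg v}" "inj_on (\<lambda>i. (nx v ^^ i) u) {..<deg v}"
    "(nx v ^^ deg v) u = u"
proof -
  have c: "card (orbit \<tau> (v, u)) = deg v"
    unfolding orbit_tau[OF assms] by (simp add: card_cartesian_product)
  note en = orbit_enum[OF tau_permutes finite_arcs, of "(v, u)", unfolded c]
  have eq: "(\<lambda>n. (\<tau> ^^ n) (v, u)) = (\<lambda>n. (v, (nx v ^^ n) u))" using tau_funpow[OF assms] by auto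
  have "{v} \<times> nbrs E v = (\<lambda>n. (v, (nx v ^^ n) u)) ` {..<deg v}"
    using en(4) unfolding orbit_tau[OF assms] eq .
  then have "snd ` ({v} \<times> nbrs E v) = snd ` (\<lambda>n. (v, (nx v ^^ n) u)) ` {..<deg v}" by simp
  then show "nbrs E v = (\<lambda>i. (nx v ^^ i) u) ` {..<deg v}" by (simp add: image_image)
  show "inj_on (\<lambda>i. (nx v ^^ i) u) {..<deg v}"
    using en(3) unfolding eq by (auto simp: inj_on_def)
  show "(nx v ^^ deg v) u = u" using en(2) tau_funpow[OF assms] by simp
qed

lemma nx_neq:
  assumes "adj v u" "0 < i" "i < deg v" shows "(nx v ^^ i) u \<noteq> u"
  using inj_onD[OF nbrs_enum(2)[OF assms(1)], of i 0] assms(2,3) by auto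

lemma deg_ge_3: "adj v u \<Longrightarrow> 3 \<le> deg v" using min_deg adj_V by blast

lemma nx1: "adj v u \<Longrightarrow> nx v u \<noteq> u" using nx_neq[of v u 1] deg_ge_3[of v u] by simp

lemma nx2: "adj v u \<Longrightarrow> nx v (nx v u) \<noteq> u"
  using nx_neq[of v u 2] deg_ge_3[of v u] by (simp add: eval_nat_numeral)

lemma nx3: "adj v u \<Longrightarrow> 4 \<le> deg v \<Longrightarrow> nx v (nx v (nx v u)) \<noteq> u"
  using nx_neq[of v u 3] by (simp add: eval_nat_numeral)

lemma face_perm_eq: "adj u v \<Longrightarrow> face_perm (u, v) = (v, nx v u)"
  by (simp add: face_perm_def arc_rev_def in_arcs tau_eq adj_sym)

lemma arc_rev_permutes: "arc_rev E permutes arcs E"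
  by (rule bij_imp_permutes, rule bij_betw_byWitness[where f' = "arc_rev E"])
    (auto simp: arc_rev_def in_arcs adj_sym)

lemma face_perm_permutes: "face_perm permutes arcs E"
  unfolding face_perm_def by (rule permutes_compose[OF arc_rev_permutes tau_permutes])

lemma face_step:
  assumes "adj v u" shows "face_perm (u, v) = (v, nx v u)" "adj (nx v u) v" "nx v u \<noteq> u" "adj v (nx v u)"
  using assms face_perm_eq[of u v] nx_adj[of v u] nx1[of v u] by (auto intro: adj_sym)

lemma flen_period: "(face_perm ^^ flen v u) (u, v) = (u, v)"
  unfolding flen_def by (rule orbit_enum(2)[OF face_perm_permutes finite_arcs])

lemma face3:
  assumes "adj v u" "flen v u = 3" "w = nx v u"
  shows "nx w v = u" "nx u w = v" "adj v w" "adj w u" "u \<noteq> w"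
proof -
  note s1 = face_step[OF assms(1), folded assms(3)]
  note s2 = face_step[OF s1(2)]
  note s3 = face_step[OF s2(2)]
  have "(face_perm ^^ 3) (u, v) = (u, v)" using flen_period[of v u] assms(2) by simp
  then have "face_perm (face_perm (face_perm (u, v))) = (u, v)" by (simp add: eval_nat_numeral)
  then have "(nx w v, nx (nx w v) w) = (u, v)" by (simp only: s1(1) s2(1) s3(1))
  then have "nx w v = u \<and> nx (nx w v) w = v" unfolding prod.inject .
  note e1 = conjunct1[OF this] and e2 = conjunct2[OF this]
  show e: "nx w v = u" "nx u w = v" using e1 e2 by simp_all
  show "adj v w" "adj w u" "u \<noteq> w" using s1 s2 e by auto
qed

text \<open>Opposite vertices differ because a face walk never turns straight back, and a chord
  would be shared by two triangles.\<close>

lemma face4: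
  assumes "adj v u" "flen v u = 4" "w = nx v u" "x = nx w v"
  shows "nx x w = u" "nx u x = v" "adj v w" "adj w x" "adj x u"
    "u \<noteq> w" "v \<noteq> x" "\<not> adj v x" "\<not> adj u w"
proof -
  note s1 = face_step[OF assms(1), folded assms(3)]
  note s2 = face_step[OF s1(2), folded assms(4)]
  note s3 = face_step[OF s2(2)]
  note s4 = face_step[OF s3(2)]
  have "(face_perm ^^ 4) (u, v) = (u, v)" using flen_period[of v u] assms(2) by simp
  then have "face_perm (face_perm (face_perm (face_perm (u, v)))) = (u, v)" by (simp add: eval_nat_numeral)
  then have "(nx x w, nx (nx x w) x) = (u, v)" by (simp only: s1(1) s2(1) s3(1) s4(1))
  then have "nx x w = u \<and> nx (nx x w) x = v" unfolding prod.inject .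
  note e1 = conjunct1[OF this] and e2 = conjunct2[OF this]
  show e: "nx x w = u" "nx u x = v" using e1 e2 by simp_all
  show "adj v w" "adj w x" "u \<noteq> w" "v \<noteq> x" using s1 s2 by auto
  show xu: "adj x u" using s3 e by simp
  show "\<not> adj v x"
    using diamond[of v x u w] assms(1) xu s1 s2 by (auto dest: adj_sym)
  show "\<not> adj u w"
    using diamond[of u w v x] assms(1) xu s1 s2 by (auto dest: adj_sym)
qed

text \<open>Any two positions of a closed walk of length 5 are one or two steps apart, so without
  loops and immediate reversals it is a cycle.\<close>

lemma face5:
  assumes "adj v u" "flen v u = 5" "w = nx v u" "x = nx w v" "y = nx x w"
  shows "nx y x = u" "nx u y = v" "adj v w" "adj w x" "adj x y" "adj y u" "distinct [u, v, w, x, y]"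
proof -
  note s1 = face_step[OF assms(1), folded assms(3)]
  note s2 = face_step[OF s1(2), folded assms(4)]
  note s3 = face_step[OF s2(2), folded assms(5)]
  note s4 = face_step[OF s3(2)]
  note s5 = face_step[OF s4(2)]
  have "(face_perm ^^ 5) (u, v) = (u, v)" using flen_period[of v u] assms(2) by simp
  then have "face_perm (face_perm (face_perm (face_perm (face_perm (u, v))))) = (u, v)" by (simp add: eval_nat_numeral)
  then have "(nx y x, nx (nx y x) y) = (u, v)" by (simp only: s1(1) s2(1) s3(1) s4(1) s5(1))
  then have "nx y x = u \<and> nx (nx y x) y = v" unfolding prod.inject .
  note e1 = conjunct1[OF this] and e2 = conjunct2[OF this]
  show e: "nx y x = u" "nx u y = v" using e1 e2 by simp_all
  show adj: "adj v w" "adj w x" "adj x y" using s1 s2 s3 by auto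
  show yu: "adj y u" using s4 e by simp
  have "u \<noteq> x" using s4(3) e(1) by simp
  moreover have "v \<noteq> y" using s5(3) e by simp
  ultimately show "distinct [u, v, w, x, y]"
    using s1(3) s2(3) s3(3) adj_neq[OF assms(1)] adj_neq[OF adj(1)] adj_neq[OF adj(2)] adj_neq[OF adj(3)] adj_neq[OF yu]
    by auto
qed

text \<open>For a concrete list the simplifier unfolds \<open>successively\<close>, with no indices
  modulo the length.\<close>

lemma cycle_iff:
  assumes "xs \<noteq> []"
  shows "graph_cycle E xs \<longleftrightarrow> 3 \<le> length xs \<and> distinct xs \<and> successively adj (xs @ [hd xs])"
proof -
  have "(\<forall>i<length xs. {xs ! i, xs ! (Suc i mod length xs)} \<in> E) \<longleftrightarrow> successively adj (xs @ [hd xs])"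
    unfolding successively_conv_nth adj_def
  proof (intro iffI allI impI)
    fix i assume h: "\<forall>i<length xs. {xs ! i, xs ! (Suc i mod length xs)} \<in> E" "Suc i < length (xs @ [hd xs])"
    then have i: "i < length xs" by simp
    show "{(xs @ [hd xs]) ! i, (xs @ [hd xs]) ! Suc i} \<in> E"
      using h(1)[rule_format, OF i] i assms
      by (cases "Suc i = length xs") (auto simp: nth_append hd_conv_nth)
  next
    fix i assume h: "\<forall>i. Suc i < length (xs @ [hd xs]) \<longrightarrow> {(xs @ [hd xs]) ! i, (xs @ [hd xs]) ! Suc i} \<in> E"
      and i: "i < length xs"
    show "{xs ! i, xs ! (Suc i mod length xs)} \<in> E"
      using h[rule_format, of i] i assms
      by (cases "Suc i = length xs") (auto simp: nth_append hd_conv_nth)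
  qed
  then show ?thesis by (auto simp: graph_cycle_def)
qed

lemma no_cycle:
  assumes "\<not> contains_cycle E n" "length xs = n" "3 \<le> n" "distinct xs" "successively adj (xs @ [hd xs])"
  shows False
  using assms cycle_iff[of xs] unfolding contains_cycle_def by (metis list.size(3) not_numeral_le_zero)

lemma no6: "distinct [a, b, c, d, e, f] \<Longrightarrow> adj a b \<Longrightarrow> adj b c \<Longrightarrow> adj c d \<Longrightarrow> adj d e \<Longrightarrow> adj e f \<Longrightarrow> adj f a \<Longrightarrow> False"
  by (rule no_cycle[OF no_6_cycle, of "[a, b, c, d, e, f]"]) auto

section \<open>Corner sequences excluded by short cycles\<close>

lemma not_33:
  assumes "adj v u" "flen v u = 3" "flen v (nx v u) = 3" shows False
proof -
  define w where "w = nx v u"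
  note w = face3[OF assms(1,2) w_def]
  define z where "z = nx v w"
  note z = face3[OF w(3) assms(3)[folded w_def] z_def]
  have "u = z" by (rule diamond[OF w(3) assms(1) w(4) z(3)]) (rule adj_sym[OF z(4)])
  then show False using nx2[OF assms(1)] w_def z_def by simp
qed

text \<open>Unlike \<open>not_33\<close>, this is about triangles that may not be faces, as needed
  for triangular corners of long faces.\<close>

lemma not_tri_tri:
  assumes "adj v u" "adj u (nx v u)" "adj (nx v u) (nx v (nx v u))" shows False
proof -
  define w z where "w = nx v u" and "z = nx v w"
  have w: "adj v w" "adj v z" using nx_adj[OF assms(1)] nx_adj by (simp_all add: w_def z_def)
  have "u = z" by (rule diamond[OF w(1) assms(1) _ w(2)]) (use assms in \<open>simp_all add: w_def z_def adj_sym\<close>)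
  then show False using nx2[OF assms(1)] w_def z_def by simp
qed

text \<open>Replacing the common edge \<open>v w\<close> in the 5-face by the detour over
  \<open>u\<close> gives a 6-cycle; \<open>u\<close> is not on the 5-face by minimum degree and
  because no two triangles share an edge.\<close>

lemma not_35:
  assumes "adj v u" "flen v u = 3" "flen v (nx v u) = 5" shows False
proof -
  define w where "w = nx v u"
  note w = face3[OF assms(1,2) w_def]
  define z p q where "z = nx v w" and "p = nx z v" and "q = nx p z"
  note z = face5[OF w(3) assms(3)[folded w_def] z_def p_def q_def]
  have vz: "adj v z" and wz: "adj z p" "adj p q" using z by auto
  have "u \<noteq> z" using nx2[OF assms(1)] w_def z_def by simp
  moreover have "u \<noteq> q" using nx2[OF adj_sym[OF z(6)]] z w by auto
  moreover have "u \<noteq> p"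
  proof
    assume u: "u = p"
    have "w = z"
      by (rule diamond[of v p]) (use u assms(1) w z in \<open>auto intro: adj_sym\<close>)
    then show False using z by simp
  qed
  ultimately show False
    using no6[of w u v z p q] w z assms(1) adj_neq adj_sym by auto
qed

lemma not_53:
  assumes "adj v u" "flen v u = 5" "flen v (nx v u) = 3" shows False
proof -
  define w x y where "w = nx v u" and "x = nx w v" and "y = nx x w"
  note w = face5[OF assms(1,2) w_def x_def y_def]
  define z where "z = nx v w"
  note z = face3[OF w(3) assms(3)[folded w_def] z_def]
  have "z \<noteq> u" using nx2[OF assms(1)] w_def z_def by simp
  moreover have "z \<noteq> x" using nx2[OF z(4)[THEN adj_sym]] z x_def by auto
  moreover have "z \<noteq> y"
  proof
    assume zy: "z = y"
    have "v = x"
      by (rule diamond[of w y]) (use zy w z in \<open>auto intro: adj_sym\<close>)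
    then show False using w by simp
  qed
  ultimately show False
    using no6[of v z w x y u] w z assms(1) adj_neq adj_sym by auto
qed

text \<open>The union of the two faces is bounded by a 6-cycle; they share no further vertex, by
  minimum degree and since 4-faces have no chords.\<close>

lemma not_44:
  assumes "adj v u" "flen v u = 4" "flen v (nx v u) = 4" shows False
proof -
  define w x where "w = nx v u" and "x = nx w v"
  note w = face4[OF assms(1,2) w_def x_def]
  define z p where "z = nx v w" and "p = nx z v"
  note z = face4[OF w(3) assms(3)[folded w_def] z_def p_def]
  have "u \<noteq> z" using nx2[OF assms(1)] w_def z_def by simp
  moreover have "x \<noteq> p" using nx2[OF adj_sym[OF z(5)]] z x_def by auto
  moreover have "x \<noteq> z" "p \<noteq> u" using w z assms(1) by auto
  ultimately show False
    using no6[of u x w p z v] w z assms(1) adj_neq adj_sym by auto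
qed

text \<open>The path \<open>a b x c d\<close> closes at \<open>v\<close> to a 6-cycle. If
  \<open>a = d\<close>, two triangles would share the edge \<open>v a\<close>.\<close>

lemma not_tri_4_tri:
  assumes "adj v a" "b = nx v a" "c = nx v b" "d = nx v c" "adj a b" "flen v b = 4" "adj c d" shows False
proof -
  have b: "adj v b" using nx_adj[OF assms(1)] assms(2) by simp
  define x where "x = nx c v"
  note x = face4[OF b assms(6,3) x_def]
  have d: "adj v d" using nx_adj[OF x(3)] assms(4) by simp
  have "a \<noteq> c" using nx2[OF assms(1)] assms by simp
  moreover have "b \<noteq> d" using nx2[OF b] assms by simp
  moreover have "a \<noteq> d"
  proof
    assume ad: "a = d"
    have "b = c" by (rule diamond[of v a]) (use ad assms(1,5,7) b x in \<open>auto intro: adj_sym\<close>)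
    then show False using x by simp
  qed
  moreover have "x \<noteq> a" "x \<noteq> d" using x assms(1) d by auto
  ultimately show False
    using no6[of a b x c d v] assms(1,5,7) b x d adj_neq adj_sym by auto
qed

text \<open>Without their common edge \<open>v c\<close>, the 4-face and the 5-face leave a 7-cycle,
  unless they also share the vertex \<open>x = p\<close>; then the triangle supplies a
  6-cycle.\<close>

lemma not_tri_4_5:
  assumes no7: "\<not> contains_cycle E 7"
    and "adj v a" "b = nx v a" "c = nx v b" "d = nx v c" "a \<noteq> d" "adj a b" "flen v b = 4" "flen v c = 5"
  shows False
proof -
  have b: "adj v b" using nx_adj[OF assms(2)] assms(3) by simp
  define x where "x = nx c v"
  note x = face4[OF b assms(8,4) x_def]
  define p q where "p = nx d v" and "q = nx p d"
  note p = face5[OF x(3) assms(9,5) p_def q_def]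
  have 1: "a \<noteq> c" using nx2[OF assms(2)] assms by simp
  have 2: "b \<noteq> d" using nx2[OF b] assms by simp
  have 3: "x \<noteq> q" using nx2[OF adj_sym[OF p(6)]] p x_def by auto
  have 4: "b \<noteq> q" "x \<noteq> d" "x \<noteq> a" using x p assms(2) adj_sym by auto
  have 5: "b \<noteq> p"
  proof
    assume bp: "b = p"
    have "a = d" by (rule diamond[of v b]) (use bp assms(2,7) b p in \<open>auto intro: adj_sym\<close>)
    then show False using assms(6) by simp
  qed
  have 6: "a \<noteq> q"
  proof
    assume aq: "a = q"
    have "b = c" by (rule diamond[of v a]) (use aq assms(2,7) b x p in \<open>auto intro: adj_sym\<close>)
    then show False using x by simp
  qed
  show False
  proof (cases "x = p")
    case True
    then show False
      using no6[of a b x q c v] 1 3 4 6 assms(2,7) b x p adj_neq adj_sym by auto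
  next
    case False
    have "distinct [b, x, c, q, p, d, v]" using False 2 3 4 5 b x p adj_neq by auto
    moreover have "successively adj ([b, x, c, q, p, d, v] @ [hd [b, x, c, q, p, d, v]])"
      using b x p adj_sym by auto
    ultimately show False using no_cycle[OF no7, of "[b, x, c, q, p, d, v]"] by simp
  qed
qed

text \<open>Mirror image of \<open>not_tri_4_5\<close>; for \<open>x = p\<close> the 6-cycle passes
  through \<open>d\<close>.\<close>

lemma not_5_4_tri:
  assumes no7: "\<not> contains_cycle E 7"
    and "adj v a" "b = nx v a" "c = nx v b" "d = nx v c" "a \<noteq> d" "flen v a = 5" "flen v b = 4" "adj c d"
  shows False
proof -
  define q p where "q = nx b v" and "p = nx q b"
  note p = face5[OF assms(2,7,3) q_def p_def]
  define x where "x = nx c v"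
  note x = face4[OF p(3) assms(8,4) x_def]
  have d: "adj v d" using nx_adj[OF x(3)] assms(5) by simp
  have 1: "a \<noteq> c" using nx2[OF assms(2)] assms by simp
  have 2: "b \<noteq> d" using nx2[OF p(3)] assms by simp
  have 3: "x \<noteq> q" using nx2[OF adj_sym[OF x(5)]] x q_def by auto
  have 4: "c \<noteq> q" "x \<noteq> a" "x \<noteq> d" using x p d assms(2) adj_sym by auto
  have 5: "c \<noteq> p"
  proof
    assume cp: "c = p"
    have "a = d" by (rule diamond[of v c]) (use cp assms(2,9) x d p in \<open>auto intro: adj_sym\<close>)
    then show False using assms(6) by simp
  qed
  have 6: "d \<noteq> q"
  proof
    assume dq: "d = q"
    have "b = c" by (rule diamond[of v d]) (use dq assms(9) d x p in \<open>auto intro: adj_sym\<close>)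
    then show False using x by simp
  qed
  have 7: "c \<noteq> d" using assms(9) adj_neq by simp
  show False
  proof (cases "x = p")
    case True
    then show False
      using no6[of d c x q b v] 2 3 4 6 7 assms(9) d x p adj_neq adj_sym by auto
  next
    case False
    have "distinct [c, x, b, q, p, a, v]" using False 1 3 4 5 x p assms(2) adj_neq by auto
    moreover have "successively adj ([c, x, b, q, p, a, v] @ [hd [c, x, b, q, p, a, v]])"
      using assms(2) x p adj_sym by auto
    ultimately show False using no_cycle[OF no7, of "[c, x, b, q, p, a, v]"] by simp
  qed
qed

text \<open>The outer boundary of the three pieces around \<open>v\<close> is a 7-cycle. Here
  \<open>x\<close> and \<open>y\<close> differ, as otherwise \<open>v\<close> and \<open>x\<close>
  would form two triangles on the edge \<open>b c\<close>.\<close>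

lemma not_4_tri_4:
  assumes no7: "\<not> contains_cycle E 7"
    and "adj v a" "b = nx v a" "c = nx v b" "d = nx v c" "a \<noteq> d" "flen v a = 4" "adj b c" "flen v c = 4"
  shows False
proof -
  define x where "x = nx b v"
  note x = face4[OF assms(2,7,3) x_def]
  have c: "adj v c" using nx_adj[OF x(3)] assms(4) by simp
  define y where "y = nx d v"
  note y = face4[OF c assms(9,5) y_def]
  have 1: "a \<noteq> c" using nx2[OF assms(2)] assms by simp
  have 2: "b \<noteq> d" using nx2[OF x(3)] assms by simp
  have 3: "x \<noteq> y"
  proof
    assume xy: "x = y"
    have "v = x" by (rule diamond[of b c]) (use xy assms(8) c x y in \<open>auto intro: adj_sym\<close>)
    then show False using x by simp
  qed
  have 4: "x \<notin> {a, b, c, d}" "y \<notin> {a, b, c, d}" using x y c assms(2) by auto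
  have "distinct [a, x, b, c, y, d, v]" using 1 2 3 4 x y c assms(2,6,8) adj_neq by auto
  moreover have "successively adj ([a, x, b, c, y, d, v] @ [hd [a, x, b, c, y, d, v]])"
    using assms(2,8) x y adj_sym by auto
  ultimately show False using no_cycle[OF no7, of "[a, x, b, c, y, d, v]"] by simp
qed

lemma not_tri_4:
  assumes no5: "\<not> contains_cycle E 5" and "adj v a" "b = nx v a" "adj a b" "flen v b = 4"
  shows False
proof -
  have b: "adj v b" using nx_adj[OF assms(2)] assms(3) by simp
  define c x where "c = nx v b" and "x = nx c v"
  note x = face4[OF b assms(5) c_def x_def]
  have "a \<noteq> c" using nx2[OF assms(2)] assms c_def by simp
  then have "distinct [a, b, x, c, v]" using x b assms(2,4) adj_neq by auto
  moreover have "successively adj ([a, b, x, c, v] @ [hd [a, b, x, c, v]])"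
    using assms(2,4) x adj_sym by auto
  ultimately show False using no_cycle[OF no5, of "[a, b, x, c, v]"] by simp
qed

lemma not_4_tri:
  assumes no5: "\<not> contains_cycle E 5" and "adj v a" "b = nx v a" "c = nx v b" "flen v a = 4" "adj b c"
  shows False
proof -
  define x where "x = nx b v"
  note x = face4[OF assms(2,5,3) x_def]
  have c: "adj v c" using nx_adj[OF x(3)] assms(4) by simp
  have "a \<noteq> c" using nx2[OF assms(2)] assms by simp
  then have "distinct [c, b, x, a, v]" using x c assms(2,6) adj_neq by auto
  moreover have "successively adj ([c, b, x, a, v] @ [hd [c, b, x, a, v]])"
    using assms(2,6) x c adj_sym by auto
  ultimately show False using no_cycle[OF no5, of "[c, b, x, a, v]"] by simp
qed

end

section \<open>Face walks and the total charge\<close>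

context graph_map
begin

text \<open>A face of length 6 or 7 need not be a cycle, but then it runs around a triangle. The corners inside
  that triangle have no 3-face next to them and are treated like corners of a 5-face.\<close>

definition ctype :: "'a \<Rightarrow> 'a \<Rightarrow> nat" where
  "ctype v u = (if flen v u \<le> 5 then flen v u else if adj u (nx v u) then 5 else 8)"

definition walk :: "'a \<times> 'a \<Rightarrow> nat \<Rightarrow> 'a" where "walk d n = fst ((face_perm ^^ n) d)"

lemma face_perm_funpow:
  assumes "d \<in> arcs E"
  shows "(face_perm ^^ n) d = (walk d n, walk d (Suc n)) \<and> adj (walk d n) (walk d (Suc n)) \<and>
         walk d (Suc (Suc n)) = nx (walk d (Suc n)) (walk d n)"
proof (induction n)
  case 0
  obtain u v where d: "d = (u, v)" by fastforce
  then have a: "adj v u" "adj u v" using assms by (auto simp: in_arcs adj_sym)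
  note s = face_step[OF a(1)]
  note s' = face_step[OF s(2)]
  show ?case using d a s(1) s'(1) by (simp add: walk_def)
next
  case (Suc n)
  then have f: "(face_perm ^^ n) d = (walk d n, walk d (Suc n))" and a: "adj (walk d (Suc n)) (walk d n)"
    and n: "walk d (Suc (Suc n)) = nx (walk d (Suc n)) (walk d n)" by (auto intro: adj_sym)
  note s = face_step[OF a, folded n]
  note s' = face_step[OF s(2)]
  have f1: "(face_perm ^^ Suc n) d = (walk d (Suc n), walk d (Suc (Suc n)))" using f s(1) by simp
  have f2: "(face_perm ^^ Suc (Suc n)) d = (walk d (Suc (Suc n)), nx (walk d (Suc (Suc n))) (walk d (Suc n)))"
    using f1 s'(1) by simp
  then have "(face_perm ^^ Suc (Suc (Suc n))) d =
    (nx (walk d (Suc (Suc n))) (walk d (Suc n)), nx (nx (walk d (Suc (Suc n))) (walk d (Suc n))) (walk d (Suc (Suc n))))"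
    using face_step(1)[OF s'(2)] by simp
  then have "walk d (Suc (Suc (Suc n))) = nx (walk d (Suc (Suc n))) (walk d (Suc n))"
    by (simp add: walk_def del: funpow.simps)
  then show ?case using f1 s(4) by simp
qed

lemma walk_adj: "d \<in> arcs E \<Longrightarrow> adj (walk d n) (walk d (Suc n))"
  using face_perm_funpow by blast

lemma walk_nx: "d \<in> arcs E \<Longrightarrow> walk d (Suc (Suc n)) = nx (walk d (Suc n)) (walk d n)"
  using face_perm_funpow by blast

lemma walk_neq2: "d \<in> arcs E \<Longrightarrow> walk d (Suc (Suc n)) \<noteq> walk d n"
  using walk_nx nx1[OF adj_sym[OF walk_adj]] by simp

lemma walk_shift: "walk ((face_perm ^^ m) d) n = walk d (n + m)"
  by (simp add: walk_def funpow_add)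

definition olen :: "'a \<times> 'a \<Rightarrow> nat" where "olen d = card (orbit face_perm d)"

lemma walk_period: "walk d (n + olen d) = walk d n"
  using orbit_enum(2)[OF face_perm_permutes finite_arcs, of d] by (simp add: walk_def olen_def funpow_add)

lemma funpow_in_arcs: "d \<in> arcs E \<Longrightarrow> (face_perm ^^ n) d \<in> arcs E"
  using face_perm_funpow by (simp add: in_arcs)

lemma orbit_funpow: "orbit face_perm ((face_perm ^^ n) d) = orbit face_perm d"
proof (rule orbit_eq_permutes[OF face_perm_permutes finite_arcs])
  show "(face_perm ^^ n) d \<in> orbit face_perm d"
    by (rule funpow_in_orbit[OF self_in_orbit_permutes[OF face_perm_permutes finite_arcs]])
qed

lemma flen_walk: "d \<in> arcs E \<Longrightarrow> flen (walk d (Suc n)) (walk d n) = olen d"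
  using face_perm_funpow[of d n] orbit_funpow[of n d] by (simp add: flen_def olen_def)

lemma olen_ge_3: assumes d: "d \<in> arcs E" shows "3 \<le> olen d"
proof -
  have "olen d \<noteq> 0" using orbit_enum(1)[OF face_perm_permutes finite_arcs, of d] by (simp add: olen_def)
  moreover have "olen d \<noteq> 1"
    using walk_period[of d 0] walk_adj[OF d, of 0] adj_neq by fastforce
  moreover have "olen d \<noteq> 2"
    using walk_period[of d 0] walk_neq2[OF d, of 0] by (auto simp: eval_nat_numeral)
  ultimately show ?thesis by simp
qed

lemma flen_ge_3: "adj v u \<Longrightarrow> 3 \<le> flen v u"
  using olen_ge_3[of "(u, v)"] by (simp add: olen_def flen_def in_arcs adj_sym)

lemma ctype_cases: "adj v u \<Longrightarrow> ctype v u = 3 \<or> ctype v u = 4 \<or> ctype v u = 5 \<or> ctype v u = 8"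
  using flen_ge_3[of v u] by (auto simp: ctype_def)

lemma sum_orbit:
  "(\<Sum>e\<in>orbit face_perm d. f e) = (\<Sum>n<olen d. f ((face_perm ^^ n) d))"
proof -
  note en = orbit_enum[OF face_perm_permutes finite_arcs, of d, folded olen_def]
  show ?thesis unfolding en(4) by (subst sum.reindex[OF en(3)]) simp
qed

lemma triangular_corner:
  assumes d: "d \<in> arcs E" "6 \<le> olen d" "adj (walk d n) (walk d (Suc (Suc n)))"
  shows "ctype (walk d (Suc n)) (walk d n) = 5"
  using d flen_walk[OF d(1), of n] walk_nx[OF d(1), of n] by (simp add: ctype_def)

text \<open>Equal vertices on the walk are at least three steps apart both ways, as there are no
  loops or reversals. On length 6 the distance is 3; on length 7 it is 3 one way and 4 the
  other.\<close>

lemma repeated_vertex: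
  assumes d: "d \<in> arcs E" and l: "olen d = 6 \<or> olen d = 7" and no: "\<not> contains_cycle E (olen d)"
  obtains n where "walk d (n + 3) = walk d n"
proof -
  have "\<not> distinct (map (walk d) [0..<olen d])"
  proof
    assume dis: "distinct (map (walk d) [0..<olen d])"
    have "successively adj (map (walk d) [0..<olen d] @ [hd (map (walk d) [0..<olen d])])"
      using l
    proof
      assume l6: "olen d = 6"
      have "walk d 6 = walk d 0" using walk_period[of d 0] l6 by simp
      then show ?thesis using walk_adj[OF d, of 0] walk_adj[OF d, of 1] walk_adj[OF d, of 2] walk_adj[OF d, of 3]
          walk_adj[OF d, of 4] walk_adj[OF d, of 5] by (simp add: l6 upt_rec eval_nat_numeral)
    next
      assume l7: "olen d = 7"
      have "walk d 7 = walk d 0" using walk_period[of d 0] l7 by simp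
      then show ?thesis using walk_adj[OF d, of 0] walk_adj[OF d, of 1] walk_adj[OF d, of 2] walk_adj[OF d, of 3]
          walk_adj[OF d, of 4] walk_adj[OF d, of 5] walk_adj[OF d, of 6] by (simp add: l7 upt_rec eval_nat_numeral)
    qed
    then show False using no_cycle[OF no _ _ dis] l by auto
  qed
  then obtain i j where ij: "i < j" "j < olen d" "walk d i = walk d j"
    by (auto simp: distinct_conv_nth) (metis linorder_neqE_nat)
  define k where "k = j - i"
  have k: "j = i + k" "0 < k" using ij by (auto simp: k_def)
  have neq1: "walk d (Suc n) \<noteq> walk d n" for n using walk_adj[OF d, of n] adj_neq by metis
  have "k \<noteq> 1" using ij k neq1[of i] by auto
  moreover have "k \<noteq> 2" using ij k walk_neq2[OF d, of i] by (auto simp: eval_nat_numeral)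
  moreover have "Suc k \<noteq> olen d"
  proof
    assume "Suc k = olen d"
    then have "i + olen d = Suc j" using k by simp
    then have "walk d (Suc j) = walk d i" using walk_period[of d i] by simp
    then show False using neq1[of j] ij by simp
  qed
  moreover have "Suc (Suc k) \<noteq> olen d"
  proof
    assume "Suc (Suc k) = olen d"
    then have "i + olen d = Suc (Suc j)" using k by simp
    then have "walk d (Suc (Suc j)) = walk d i" using walk_period[of d i] by simp
    then show False using walk_neq2[OF d, of j] ij by simp
  qed
  moreover have "k < olen d" using ij k by simp
  ultimately have "k = 3 \<or> (olen d = 7 \<and> k = 4)" using l k(2) by linarith
  then show ?thesis
  proof
    assume "k = 3" then show ?thesis using that[of i] ij k by simp
  next
    assume k4: "olen d = 7 \<and> k = 4"
    then have "i + olen d = j + 3" using k by simp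
    then have "walk d (j + 3) = walk d i" using walk_period[of d i] by simp
    then show ?thesis using that[of j] ij by simp
  qed
qed

text \<open>\<open>wt t\<close> is the part of a face given to a corner of type \<open>t\<close>;
  the inequalities make faces of each length hand out at least 1. Those for lengths 6 and 7 count
  the four or two triangular corners of a face that is not a cycle.\<close>

context
  fixes wt :: "nat \<Rightarrow> real"
  assumes wt: "1 \<le> 3 * wt 3" "1 \<le> 4 * wt 4" "0 < wt 8" "wt 8 \<le> wt 5" "1 \<le> 8 * wt 8" "1 \<le> 4 * wt 5 + 2 * wt 8"
    and wt5: "\<not> contains_cycle E 5 \<or> 1 \<le> 5 * wt 5"
    and wt7: "1 \<le> 7 * wt 8 \<or> \<not> contains_cycle E 7 \<and> 1 \<le> 2 * wt 5 + 5 * wt 8"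
begin

definition cw :: "'a \<times> 'a \<Rightarrow> real" where "cw d = wt (ctype (snd d) (fst d))"

lemma cw_walk: "d \<in> arcs E \<Longrightarrow> cw ((face_perm ^^ n) d) = wt (ctype (walk d (Suc n)) (walk d n))"
  using face_perm_funpow by (simp add: cw_def)

lemma cw_big: "d \<in> arcs E \<Longrightarrow> 6 \<le> olen d \<Longrightarrow> wt 8 \<le> cw ((face_perm ^^ n) d)"
  using flen_walk wt(4) by (auto simp: cw_walk ctype_def)

lemma face_sum_ge_1:
  assumes d: "d \<in> arcs E"
  shows "1 \<le> (\<Sum>e\<in>orbit face_perm d. cw e)"
proof -
  consider "olen d \<le> 5" | "olen d = 6" | "olen d = 7" | "8 \<le> olen d" by linarith
  then show ?thesis
  proof cases
    case 1
    have "(\<Sum>e\<in>orbit face_perm d. cw e) = (\<Sum>n<olen d. wt (olen d))"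
      unfolding sum_orbit using 1 by (intro sum.cong refl) (simp add: cw_walk[OF d] ctype_def flen_walk[OF d])
    also have "\<dots> = olen d * wt (olen d)" by simp
    also have "1 \<le> olen d * wt (olen d)"
    proof -
      consider "olen d = 3" | "olen d = 4" | "olen d = 5" using 1 olen_ge_3[OF d] by linarith
      then show ?thesis
      proof cases
        case 3
        have f: "flen (walk d 1) (walk d 0) = 5" using flen_walk[OF d, of 0] 3 by simp
        have a: "adj (walk d 1) (walk d 0)" using walk_adj[OF d, of 0] by (simp add: adj_sym)
        note w = face5[OF a f refl refl refl]
        have "contains_cycle E 5"
        proof (rule ccontr)
          assume "\<not> contains_cycle E 5"
          from no_cycle[OF this _ _ w(7)] show False using w a adj_sym by simp
        qed
        then show ?thesis using wt5 3 by simp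
      qed (use wt in simp_all)
    qed
    finally show ?thesis .
  next
    case 2
    have no: "\<not> contains_cycle E (olen d)" using no_6_cycle 2 by simp
    obtain n where n: "walk d (n + 3) = walk d n"
      by (rule repeated_vertex[OF d _ no]) (use 2 in simp, rule that)
    \<comment> \<open>From the repeated vertex the walk makes two closed tours of length 3; the four
      corners away from that vertex are triangular.\<close>
    define e where "e = (face_perm ^^ n) d"
    have e: "e \<in> arcs E" unfolding e_def by (rule funpow_in_arcs[OF d])
    have oe: "orbit face_perm e = orbit face_perm d" unfolding e_def by (rule orbit_funpow)
    then have le: "olen e = 6" using 2 by (simp add: olen_def)
    have w3: "walk e 3 = walk e 0" unfolding e_def walk_shift using n by (simp add: add.commute)
    have w6: "walk e 6 = walk e 0" using walk_period[of e 0] le by simp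
    have a: "adj (walk e n) (walk e (Suc n))" "adj (walk e (Suc n)) (walk e n)" for n
      using walk_adj[OF e] by (auto intro: adj_sym)
    have "adj (walk e 0) (walk e 2)" using a(2)[of 2] w3 by simp
    moreover have "adj (walk e 1) (walk e 3)" using a(2)[of 0] w3 by simp
    moreover have "adj (walk e 3) (walk e 5)" using a(2)[of 5] w3 w6 by simp
    moreover have "adj (walk e 4) (walk e 6)" using a(2)[of 3] w3 w6 by simp
    ultimately have t: "cw ((face_perm ^^ 0) e) = wt 5" "cw ((face_perm ^^ 1) e) = wt 5"
      "cw ((face_perm ^^ 3) e) = wt 5" "cw ((face_perm ^^ 4) e) = wt 5"
      using triangular_corner[OF e, of 0] triangular_corner[OF e, of 1] triangular_corner[OF e, of 3]
        triangular_corner[OF e, of 4] le unfolding cw_walk[OF e] by (simp_all add: eval_nat_numeral)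
    have b: "wt 8 \<le> cw ((face_perm ^^ 2) e)" "wt 8 \<le> cw ((face_perm ^^ 5) e)"
      using cw_big[OF e] le by simp_all
    have six: "{..<6::nat} = {0, 1, 2, 3, 4, 5}" by auto
    have "1 \<le> (\<Sum>n<6. cw ((face_perm ^^ n) e))" unfolding six using t b wt by simp
    then show ?thesis using sum_orbit[of cw e] le oe by simp
  next
    case 3
    show ?thesis
    proof (cases "1 \<le> 7 * wt 8")
      case True
      have "(\<Sum>n<7::nat. wt 8) \<le> (\<Sum>n<7. cw ((face_perm ^^ n) d))"
        by (rule sum_mono) (use cw_big[OF d] 3 in simp)
      then show ?thesis using sum_orbit[of cw d] 3 True by simp
    next
      case False
      then have w7: "\<not> contains_cycle E 7" "1 \<le> 2 * wt 5 + 5 * wt 8" using wt7 by auto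
      have no: "\<not> contains_cycle E (olen d)" using w7 3 by simp
      obtain n where n: "walk d (n + 3) = walk d n"
        by (rule repeated_vertex[OF d _ no]) (use 3 in simp, rule that)
      \<comment> \<open>Seven steps split into a tour of length 3 and one of length 4, so two
        triangular corners are guaranteed.\<close>
      define e where "e = (face_perm ^^ n) d"
      have e: "e \<in> arcs E" unfolding e_def by (rule funpow_in_arcs[OF d])
      have oe: "orbit face_perm e = orbit face_perm d" unfolding e_def by (rule orbit_funpow)
      then have le: "olen e = 7" using 3 by (simp add: olen_def)
      have w3: "walk e 3 = walk e 0" unfolding e_def walk_shift using n by (simp add: add.commute)
      have a: "adj (walk e (Suc n)) (walk e n)" for n using walk_adj[OF e] by (auto intro: adj_sym)
      have "adj (walk e 0) (walk e 2)" using a[of 2] w3 by simp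
      moreover have "adj (walk e 1) (walk e 3)" using a[of 0] w3 by simp
      ultimately have t: "cw ((face_perm ^^ 0) e) = wt 5" "cw ((face_perm ^^ 1) e) = wt 5"
        using triangular_corner[OF e, of 0] triangular_corner[OF e, of 1] le unfolding cw_walk[OF e]
        by (simp_all add: eval_nat_numeral)
      have b: "wt 8 \<le> cw ((face_perm ^^ n) e)" for n using cw_big[OF e] le by simp
      have seven: "{..<7::nat} = {0, 1, 2, 3, 4, 5, 6}" by auto
      have "1 \<le> (\<Sum>n<7. cw ((face_perm ^^ n) e))"
        unfolding seven using t b[of 2] b[of 3] b[of 4] b[of 5] b[of 6] w7 by simp
      then show ?thesis using sum_orbit[of cw e] le oe by simp
    qed
  next
    case 4
    have "1 \<le> 8 * wt 8" by (rule wt)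
    also have "\<dots> \<le> olen d * wt 8" using 4 wt(3) by (intro mult_right_mono) simp_all
    also have "\<dots> = (\<Sum>n<olen d. wt 8)" by simp
    also have "\<dots> \<le> (\<Sum>n<olen d. cw ((face_perm ^^ n) d))"
      by (rule sum_mono) (use cw_big[OF d] 4 in simp)
    finally show ?thesis using sum_orbit[of cw d] by simp
  qed
qed

lemma card_faces_le: "card (orbit face_perm ` arcs E) \<le> (\<Sum>d\<in>arcs E. cw d)"
proof -
  let ?O = "orbit face_perm ` arcs E"
  have sub: "orbit face_perm d \<subseteq> arcs E" if "d \<in> arcs E" for d
    by (rule permutes_orbit_subset[OF face_perm_permutes that])
  have U: "arcs E = \<Union> ?O"
    using sub self_in_orbit_permutes[OF face_perm_permutes finite_arcs] by blast
  have "real (card ?O) = (\<Sum>Q\<in>?O. 1)" by simp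
  also have "\<dots> \<le> (\<Sum>Q\<in>?O. \<Sum>d\<in>Q. cw d)" by (rule sum_mono) (use face_sum_ge_1 in auto)
  also have "\<dots> = (\<Sum>d\<in>\<Union> ?O. cw d)"
  proof (rule sum.Union_disjoint[symmetric, unfolded comp_def])
    show "\<forall>A\<in>?O. finite A" using sub finite_arcs finite_subset by blast
    show "\<forall>A\<in>?O. \<forall>B\<in>?O. A \<noteq> B \<longrightarrow> A \<inter> B = {}"
    proof (intro ballI impI, rule ccontr)
      fix A B assume AB: "A \<in> ?O" "B \<in> ?O" "A \<noteq> B" and "A \<inter> B \<noteq> {}"
      then obtain z where z: "z \<in> A" "z \<in> B" by blast
      have "orbit face_perm z = A" "orbit face_perm z = B"
        using AB z orbit_eq_permutes[OF face_perm_permutes finite_arcs, of z] by auto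
      then show False using AB by simp
    qed
  qed
  finally show ?thesis using U by simp
qed

lemma sum_arcs: "(\<Sum>d\<in>arcs E. f d) = (\<Sum>v\<in>V. \<Sum>u\<in>nbrs E v. f (u, v))"
proof -
  have "(\<Sum>v\<in>V. \<Sum>u\<in>nbrs E v. f (u, v)) = (\<Sum>p\<in>Sigma V (nbrs E). f (snd p, fst p))"
    using finite_V finite_nbrs by (subst sum.Sigma) (auto simp: split_def)
  also have "\<dots> = (\<Sum>d\<in>arcs E. f d)"
    by (rule sum.reindex_bij_witness[where i = prod.swap and j = prod.swap])
      (auto simp: in_arcs in_nbrs adj_sym adj_V adj_V2)
  finally show ?thesis by simp
qed

text \<open>There are at least \<open>|E| - |V|\<close> faces, each bringing at least 1 to its
  corners, and half the degree sum is \<open>|E|\<close>.\<close>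

theorem total_charge_nonneg:
  assumes "card (arcs E) \<le> 2 * card (orbit face_perm ` arcs E) + 2 * card V"
  shows "0 \<le> (\<Sum>v\<in>V. 1 - deg v / 2 + (\<Sum>u\<in>nbrs E v. wt (ctype v u)))"
proof -
  have c: "real (card (arcs E)) = (\<Sum>v\<in>V. real (deg v))"
    using sum_arcs[of "\<lambda>_. 1 :: real"] by simp
  have "(\<Sum>d\<in>arcs E. cw d) = (\<Sum>v\<in>V. \<Sum>u\<in>nbrs E v. wt (ctype v u))"
    unfolding sum_arcs by (simp add: cw_def)
  then have "card (orbit face_perm ` arcs E) \<le> (\<Sum>v\<in>V. \<Sum>u\<in>nbrs E v. wt (ctype v u))"
    using card_faces_le by simp
  moreover have "real (card (arcs E)) \<le> 2 * card (orbit face_perm ` arcs E) + 2 * card V"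
    using assms by linarith
  ultimately show ?thesis using c
    by (simp add: sum.distrib sum_subtractf sum_divide_distrib[symmetric])
qed

end

end

section \<open>Discharging\<close>

definition ok2 :: "nat \<Rightarrow> nat \<Rightarrow> bool" where
  "ok2 a b \<longleftrightarrow> \<not> (a = 3 \<and> b = 3 \<or> a = 3 \<and> b = 5 \<or> a = 5 \<and> b = 3 \<or> a = 4 \<and> b = 4)"

text \<open>For graphs without 7-cycles and vertices of degree at least 4, where the four edges
  bounding three consecutive corners are distinct.\<close>

definition ok3 :: "nat \<Rightarrow> nat \<Rightarrow> nat \<Rightarrow> bool" where
  "ok3 a b c \<longleftrightarrow> \<not> (b = 4 \<and> (a = 3 \<and> (c = 3 \<or> c = 5) \<or> a = 5 \<and> c = 3)) \<and> \<not> (a = 4 \<and> b = 3 \<and> c = 4)"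

text \<open>The unit charge of a face is split among its corners by type, in units of 1/120 for graphs
  without 7-cycles and of 1/84 for graphs without 5-cycles.\<close>

definition wB :: "nat \<Rightarrow> real" where
  "wB t = (if t = 3 then 40 else if t = 4 then 30 else if t = 5 then 24 else 15)"

text \<open>Chosen so that 3 * 28 = 4 * 21 = 7 * 12 = 4 * 15 + 2 * 12 = 84. Without 5-cycles, type 5
  occurs only at triangular corners of long faces, so 15 is fixed by faces of length 6.\<close>

definition wA :: "nat \<Rightarrow> real" where
  "wA t = (if t = 3 then 28 else if t = 4 then 21 else if t = 5 then 15 else 12)"

definition corner_type :: "nat \<Rightarrow> bool" where
  "corner_type t \<longleftrightarrow> t = 3 \<or> t = 4 \<or> t = 5 \<or> t = 8"

lemma corner_type_iff: "corner_type t \<longleftrightarrow> t \<in> {3, 4, 5, 8}"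
  by (auto simp: corner_type_def)

text \<open>The conditionals instead of implications let the simplifier skip the excluded cases.\<close>

lemma three_corners_all:
  "\<forall>a\<in>{3, 4, 5, 8}. \<forall>b\<in>{3, 4, 5, 8}. if ok2 a b then
    (\<forall>c\<in>{3, 4, 5, 8}. if ok2 b c \<and> ok2 c a then
      (a \<noteq> 4 \<and> b \<noteq> 4 \<and> c \<noteq> 4 \<longrightarrow> wB a + wB b + wB c \<le> 72) \<and>
      (a = 4 \<longrightarrow> b = 3 \<and> c = 8 \<or> b = 8 \<and> c = 3 \<or> b = 5 \<and> c = 5 \<or> wB a + wB b + wB c \<le> 72)
     else True) else True"
  by (simp add: ok2_def wB_def)

text \<open>At degree 3 the charge is the corner sum minus 60. A sum of 72 leaves 12, below the 15
  that three neighbours always absorb; the exceptions in the second claim need larger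
  shares.\<close>

lemma three_corners:
  assumes "corner_type a" "corner_type b" "ok2 a b" "corner_type c" "ok2 b c" "ok2 c a"
  shows "a \<noteq> 4 \<Longrightarrow> b \<noteq> 4 \<Longrightarrow> c \<noteq> 4 \<Longrightarrow> wB a + wB b + wB c \<le> 72"
    "a = 4 \<Longrightarrow> b = 3 \<and> c = 8 \<or> b = 8 \<and> c = 3 \<or> b = 5 \<and> c = 5 \<or> wB a + wB b + wB c \<le> 72"
proof -
  note ct = assms(1,2,4)[unfolded corner_type_iff]
  note 1 = bspec[OF bspec[OF three_corners_all ct(1)] ct(2), unfolded if_P[OF assms(3)]]
  have "ok2 b c \<and> ok2 c a" using assms by simp
  note 2 = bspec[OF 1 ct(3), unfolded if_P[OF this]]
  show "a \<noteq> 4 \<Longrightarrow> b \<noteq> 4 \<Longrightarrow> c \<noteq> 4 \<Longrightarrow> wB a + wB b + wB c \<le> 72"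
    "a = 4 \<Longrightarrow> b = 3 \<and> c = 8 \<or> b = 8 \<and> c = 3 \<or> b = 5 \<and> c = 5 \<or> wB a + wB b + wB c \<le> 72"
    using 2 by blast+
qed

lemma four_corners_all:
  "\<forall>a\<in>{3, 4, 5, 8}. \<forall>b\<in>{3, 4, 5, 8}. if ok2 a b then
    (\<forall>c\<in>{3, 4, 5, 8}. if ok2 b c \<and> ok3 a b c then
     (\<forall>d\<in>{3, 4, 5, 8}. if ok2 c d \<and> ok3 b c d \<and> ok2 d a \<and> ok3 c d a \<and> ok3 d a b then
      wB a + wB b + wB c + wB d \<le> 110 \<and>
      (a = 4 \<or> a = 5 \<longrightarrow> wB a + wB b + wB c + wB d \<le> 108) \<and>
      (a = 4 \<and> b = 8 \<or> a = 8 \<and> b = 4 \<or> a = 3 \<and> b = 4 \<or> a = 4 \<and> b = 3 \<longrightarrow> wB a + wB b + wB c + wB d \<le> 100) \<and>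
      (a = 5 \<and> (b = 5 \<or> b = 8) \<or> b = 5 \<and> (a = 5 \<or> a = 8) \<longrightarrow> wB a + wB b + wB c + wB d \<le> 102)
     else True) else True) else True"
  by (simp add: ok2_def ok3_def wB_def)

text \<open>At degree 4 the reserve is 120 minus the corner sum, split between at most two
  neighbours of degree 3. The bounds 110, 108, 100 and 102 thus become shares 5, 6, 10 and
  9.\<close>

lemma four_corners:
  assumes "corner_type a" "corner_type b" "ok2 a b" "corner_type c" "ok2 b c" "ok3 a b c"
    "corner_type d" "ok2 c d" "ok3 b c d" "ok2 d a" "ok3 c d a" "ok3 d a b"
  shows "wB a + wB b + wB c + wB d \<le> 110"
    "a = 4 \<or> a = 5 \<Longrightarrow> wB a + wB b + wB c + wB d \<le> 108"
    "a = 4 \<and> b = 8 \<or> a = 8 \<and> b = 4 \<or> a = 3 \<and> b = 4 \<or> a = 4 \<and> b = 3 \<Longrightarrow> wB a + wB b + wB c + wB d \<le> 100"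
    "a = 5 \<and> (b = 5 \<or> b = 8) \<or> b = 5 \<and> (a = 5 \<or> a = 8) \<Longrightarrow> wB a + wB b + wB c + wB d \<le> 102"
proof -
  note ct = assms(1,2,4,7)[unfolded corner_type_iff]
  note 1 = bspec[OF bspec[OF four_corners_all ct(1)] ct(2), unfolded if_P[OF assms(3)]]
  have "ok2 b c \<and> ok3 a b c" using assms by simp
  note 2 = bspec[OF 1 ct(3), unfolded if_P[OF this]]
  have "ok2 c d \<and> ok3 b c d \<and> ok2 d a \<and> ok3 c d a \<and> ok3 d a b" using assms by simp
  note 3 = bspec[OF 2 ct(4), unfolded if_P[OF this]]
  show "wB a + wB b + wB c + wB d \<le> 110"
    "a = 4 \<or> a = 5 \<Longrightarrow> wB a + wB b + wB c + wB d \<le> 108"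
    "a = 4 \<and> b = 8 \<or> a = 8 \<and> b = 4 \<or> a = 3 \<and> b = 4 \<or> a = 4 \<and> b = 3 \<Longrightarrow> wB a + wB b + wB c + wB d \<le> 100"
    "a = 5 \<and> (b = 5 \<or> b = 8) \<or> b = 5 \<and> (a = 5 \<or> a = 8) \<Longrightarrow> wB a + wB b + wB c + wB d \<le> 102"
    using 3 by (simp_all only: simp_thms)
qed

lemma five_corners_all:
  "\<forall>a\<in>{3, 4, 5, 8}. \<forall>b\<in>{3, 4, 5, 8}. if ok2 a b then
    (\<forall>c\<in>{3, 4, 5, 8}. if ok2 b c \<and> ok3 a b c then
     (\<forall>d\<in>{3, 4, 5, 8}. if ok2 c d \<and> ok3 b c d then
      (\<forall>e\<in>{3, 4, 5, 8}. if ok2 d e \<and> ok3 c d e \<and> ok2 e a \<and> ok3 d e a \<and> ok3 e a b then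
      wB a + wB b + wB c + wB d + wB e \<le> 132 \<or>
      wB a + wB b + wB c + wB d + wB e \<le> 140 \<and>
       (a = 3 \<and> c = 3 \<or> b = 3 \<and> d = 3 \<or> c = 3 \<and> e = 3 \<or> d = 3 \<and> a = 3 \<or> e = 3 \<and> b = 3)
     else True) else True) else True) else True"
  by (simp add: ok2_def ok3_def wB_def)

text \<open>\<open>s\<close>, ..., \<open>z\<close> mark which of the five neighbours have degree 3,
  not both beside a triangular face. Here 180 is 5 * 60 - 120, and the extra 5 makes the charge
  itself strictly negative.\<close>

lemma five_corners:
  fixes s t x y z :: real
  assumes "corner_type a" "corner_type b" "ok2 a b" "corner_type c" "ok2 b c" "ok3 a b c"
    "corner_type d" "ok2 c d" "ok3 b c d" "corner_type e" "ok2 d e" "ok3 c d e" "ok2 e a" "ok3 d e a" "ok3 e a b"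
    and th: "s \<le> 1" "t \<le> 1" "x \<le> 1" "y \<le> 1" "z \<le> 1" "s + t + x + y + z \<le> 4"
    "a = 3 \<Longrightarrow> s + t \<le> 1" "b = 3 \<Longrightarrow> t + x \<le> 1" "c = 3 \<Longrightarrow> x + y \<le> 1" "d = 3 \<Longrightarrow> y + z \<le> 1" "e = 3 \<Longrightarrow> z + s \<le> 1"
  shows "wB a + wB b + wB c + wB d + wB e + 21 / 2 * (s + t + x + y + z) + 5 \<le> 180"
proof -
  note ct = assms(1,2,4,7,10)[unfolded corner_type_iff]
  note 1 = bspec[OF bspec[OF five_corners_all ct(1)] ct(2), unfolded if_P[OF assms(3)]]
  have "ok2 b c \<and> ok3 a b c" using assms by simp
  note 2 = bspec[OF 1 ct(3), unfolded if_P[OF this]]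
  have "ok2 c d \<and> ok3 b c d" using assms by simp
  note 3 = bspec[OF 2 ct(4), unfolded if_P[OF this]]
  have "ok2 d e \<and> ok3 c d e \<and> ok2 e a \<and> ok3 d e a \<and> ok3 e a b" using assms by simp
  note 4 = bspec[OF 3 ct(5), unfolded if_P[OF this]]
  let ?T = "s + t + x + y + z" and ?W = "wB a + wB b + wB c + wB d + wB e"
  \<comment> \<open>Two 3-corners without a common edge account for four edges with at most one mark
    per corner, so at most three marks in all.\<close>
  have "?W \<le> 132 \<or> ?W \<le> 140 \<and> ?T \<le> 3"
    using 4
  proof (elim disjE conjE)
    assume "?W \<le> 140" "a = 3" "c = 3"
    then show ?thesis using th(5) th(7) th(9) by simp
  next
    assume "?W \<le> 140" "b = 3" "d = 3"
    then show ?thesis using th(1) th(8) th(10) by simp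
  next
    assume "?W \<le> 140" "c = 3" "e = 3"
    then show ?thesis using th(2) th(9) th(11) by simp
  next
    assume "?W \<le> 140" "d = 3" "a = 3"
    then show ?thesis using th(3) th(7) th(10) by simp
  next
    assume "?W \<le> 140" "e = 3" "b = 3"
    then show ?thesis using th(4) th(8) th(11) by simp
  qed (rule disjI1)
  moreover have "W + 21 / 2 * T + 5 \<le> 180" if "T \<le> 4" "W \<le> 132 \<or> W \<le> 140 \<and> T \<le> 3" for W T :: real
    using that by auto
  ultimately show ?thesis using th(6) by blast
qed

section \<open>Corner types around a vertex\<close>

context graph_map
begin

lemma ctype_corner: "adj v u \<Longrightarrow> corner_type (ctype v u)"
  using ctype_cases by (simp add: corner_type_def)

lemma ctype_3: "ctype v u = 3 \<Longrightarrow> flen v u = 3"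
  by (auto simp: ctype_def split: if_splits)

lemma ctype_4: "ctype v u = 4 \<Longrightarrow> flen v u = 4"
  by (auto simp: ctype_def split: if_splits)

lemma ctype_5: "ctype v u = 5 \<Longrightarrow> flen v u = 5 \<or> 6 \<le> flen v u \<and> adj u (nx v u)"
  by (auto simp: ctype_def split: if_splits)

lemma ctype_8: "ctype v u = 8 \<Longrightarrow> 6 \<le> flen v u \<and> \<not> adj u (nx v u)"
  by (auto simp: ctype_def split: if_splits)

lemma adj_of_ctype_3: "adj v u \<Longrightarrow> ctype v u = 3 \<Longrightarrow> adj u (nx v u)"
  using face3[of v u, OF _ ctype_3 refl] by (auto intro: adj_sym)

text \<open>A corner of type 5 is either a true 5-face, excluded next to a triangle by a 6-cycle, or
  a triangular corner of a long face, excluded by adjacent triangles.\<close>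

lemma ctype_ok2: assumes "adj v u" shows "ok2 (ctype v u) (ctype v (nx v u))"
proof -
  let ?w = "nx v u"
  have w: "adj v ?w" by (rule nx_adj[OF assms])
  show ?thesis unfolding ok2_def
  proof (intro notI, elim disjE conjE)
    assume "ctype v u = 3" "ctype v ?w = 3"
    then show False using not_33[OF assms] ctype_3 by blast
  next
    assume h: "ctype v u = 3" "ctype v ?w = 5"
    show False using ctype_5[OF h(2)] not_35[OF assms ctype_3[OF h(1)]]
        not_tri_tri[OF assms adj_of_ctype_3[OF assms h(1)]] by blast
  next
    assume h: "ctype v u = 5" "ctype v ?w = 3"
    show False using ctype_5[OF h(1)] not_53[OF assms _ ctype_3[OF h(2)]]
        not_tri_tri[OF assms _ adj_of_ctype_3[OF w h(2)]] by blast
  next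
    assume "ctype v u = 4" "ctype v ?w = 4"
    then show False using not_44[OF assms] ctype_4 by blast
  qed
qed

text \<open>True 5-faces are handled by 6- and 7-cycles; a triangular corner of a long face acts as
  a triangle, where \<open>not_tri_4_tri\<close> applies.\<close>

lemma ctype_ok3:
  assumes no7: "\<not> contains_cycle E 7" and a: "adj v u" and d: "4 \<le> deg v"
  shows "ok3 (ctype v u) (ctype v (nx v u)) (ctype v (nx v (nx v u)))"
proof -
  define b c e where "b = nx v u" and "c = nx v b" and "e = nx v c"
  have vb: "adj v b" using nx_adj[OF a] b_def by simp
  have vc: "adj v c" using nx_adj[OF vb] c_def by simp
  have ne: "u \<noteq> e" using nx3[OF a d] by (simp add: b_def c_def e_def)
  have tri: "adj x (nx v x)" if "adj v x" "ctype v x = 3 \<or> ctype v x = 5 \<and> flen v x \<noteq> 5" for x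
    using that adj_of_ctype_3 ctype_5 by blast
  have t4t: False if "ctype v b = 4" "adj u b" "adj c e"
    using not_tri_4_tri[OF a b_def c_def e_def that(2) ctype_4[OF that(1)] that(3)] .
  have "ok3 (ctype v u) (ctype v b) (ctype v c)" unfolding ok3_def
  proof (intro conjI notI, elim conjE disjE)
    assume "ctype v b = 4" "ctype v u = 3" "ctype v c = 3"
    then show False using t4t tri[OF a] tri[OF vc] b_def e_def by blast
  next
    assume h: "ctype v b = 4" "ctype v u = 3" "ctype v c = 5"
    show False
    proof (cases "flen v c = 5")
      case True
      show False
        by (rule not_tri_4_5[OF no7 a b_def c_def e_def ne _ ctype_4[OF h(1)] True])
          (use tri[OF a] h b_def in blast)
    next
      case False
      then show False using t4t h tri[OF a] tri[OF vc] b_def e_def by blast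
    qed
  next
    assume h: "ctype v b = 4" "ctype v u = 5" "ctype v c = 3"
    show False
    proof (cases "flen v u = 5")
      case True
      show False
        by (rule not_5_4_tri[OF no7 a b_def c_def e_def ne True ctype_4[OF h(1)]])
          (use tri[OF vc] h e_def in blast)
    next
      case False
      then show False using t4t h tri[OF a] tri[OF vc] b_def e_def by blast
    qed
  next
    assume h: "ctype v u = 4 \<and> ctype v b = 3 \<and> ctype v c = 4"
    have "adj b c" using tri[OF vb] h c_def by blast
    then show False
      using not_4_tri_4[OF no7 a b_def c_def e_def ne ctype_4 _ ctype_4] h by blast
  qed
  then show ?thesis by (simp add: b_def c_def)
qed

text \<open>Without 5-cycles, type 5 means a triangular corner, and neither it nor type 3 can stand
  next to type 4. So type 3 only has neighbours of type 8, giving 28 + 12, and otherwise 21 + 12 is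
  the largest pair.\<close>

lemma ctype_pair_no5:
  assumes no5: "\<not> contains_cycle E 5" and a: "adj v u"
  shows "wA (ctype v u) + wA (ctype v (nx v u)) \<le> 40"
    "ctype v u \<noteq> 3 \<Longrightarrow> ctype v (nx v u) \<noteq> 3 \<Longrightarrow> wA (ctype v u) + wA (ctype v (nx v u)) \<le> 33"
proof -
  let ?w = "nx v u"
  have w: "adj v ?w" by (rule nx_adj[OF a])
  have n5: "flen v x \<noteq> 5" if "adj v x" for x
  proof
    assume f: "flen v x = 5"
    note w = face5[OF that f refl refl refl]
    from no_cycle[OF no5 _ _ w(7)] show False using w that adj_sym by simp
  qed
  have tri: "adj x (nx v x)" if "adj v x" "ctype v x = 3 \<or> ctype v x = 5" for x
    using that adj_of_ctype_3 ctype_5 n5 by blast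
  have "\<not> (ctype v u = 4 \<and> (ctype v ?w = 3 \<or> ctype v ?w = 5))"
    using not_4_tri[OF no5 a refl refl ctype_4] tri[OF w] by blast
  moreover have "\<not> (ctype v ?w = 4 \<and> (ctype v u = 3 \<or> ctype v u = 5))"
    using not_tri_4[OF no5 a refl _ ctype_4] tri[OF a] by blast
  moreover note ctype_ok2[OF a] ctype_cases[OF a] ctype_cases[OF w]
  ultimately show "wA (ctype v u) + wA (ctype v ?w) \<le> 40"
    "ctype v u \<noteq> 3 \<Longrightarrow> ctype v ?w \<noteq> 3 \<Longrightarrow> wA (ctype v u) + wA (ctype v ?w) \<le> 33"
    by (auto simp: ok2_def wA_def)
qed

lemma sum_nbrs: "adj v u \<Longrightarrow> (\<Sum>x\<in>nbrs E v. f x) = (\<Sum>i<deg v. f ((nx v ^^ i) u))"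
  using nbrs_enum[of v u] by (metis (no_types, lifting) sum.reindex_cong)

lemma sum_nbrs_nx: "(\<Sum>x\<in>nbrs E v. f (nx v x)) = (\<Sum>x\<in>nbrs E v. f x)"
proof (cases "nbrs E v = {}")
  case False
  then obtain u where u: "adj v u" by (auto simp: in_nbrs)
  have "inj_on (nx v) (nbrs E v)"
  proof (rule inj_onI)
    fix x y assume xy: "x \<in> nbrs E v" "y \<in> nbrs E v" "nx v x = nx v y"
    then have "\<tau> (v, x) = \<tau> (v, y)" using tau_eq by (simp add: in_nbrs)
    then show "x = y" using permutes_inj[OF tau_permutes] by (auto dest: injD)
  qed
  moreover have "nx v ` nbrs E v \<subseteq> nbrs E v" by (auto simp: in_nbrs nx_adj)
  ultimately have "bij_betw (nx v) (nbrs E v) (nbrs E v)"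
    using finite_nbrs by (simp add: bij_betw_def endo_inj_surj)
  then show ?thesis by (rule sum.reindex_bij_betw)
qed simp

lemma funpow_numeral:
  "(f ^^ 0) x = x" "(f ^^ 1) x = f x" "(f ^^ 2) x = f (f x)" "(f ^^ 3) x = f (f (f x))"
  "(f ^^ 4) x = f (f (f (f x)))" "(f ^^ 5) x = f (f (f (f (f x))))"
  by (simp_all add: eval_nat_numeral)

lemma deg_3_nbrs:
  assumes "adj v u" "deg v = 3"
  shows "nx v (nx v (nx v u)) = u" "nbrs E v = {u, nx v u, nx v (nx v u)}"
    "(\<Sum>x\<in>nbrs E v. f x) = f u + f (nx v u) + (f (nx v (nx v u)) :: real)"
proof -
  show "nx v (nx v (nx v u)) = u" using nbrs_enum(3)[OF assms(1)] assms(2) by (simp add: funpow_numeral)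
  have 3: "{..<3::nat} = {0, 1, 2}" by auto
  show "nbrs E v = {u, nx v u, nx v (nx v u)}"
    using nbrs_enum(1)[OF assms(1)] unfolding assms(2) 3 by (simp add: funpow_numeral)
  show "(\<Sum>x\<in>nbrs E v. f x) = f u + f (nx v u) + f (nx v (nx v u))"
    unfolding sum_nbrs[OF assms(1)] assms(2) 3 by (simp add: funpow_numeral add.assoc)
qed

end

section \<open>Discharging in a critical graph\<close>

locale critical_map = graph_map +
  assumes V_nonempty: "V \<noteq> {}"
    and three_nbrs: "\<And>v. v \<in> V \<Longrightarrow> card {u \<in> nbrs E v. card (nbrs E u) = 3} + 6 \<le> 2 * card (nbrs E v)"
    and not_344: "\<And>x y z. {x, y} \<in> E \<Longrightarrow> {y, z} \<in> E \<Longrightarrow> {x, z} \<in> E \<Longrightarrow>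
      card (nbrs E x) = 3 \<Longrightarrow> card (nbrs E y) = 4 \<Longrightarrow> card (nbrs E z) \<noteq> 4"
    and euler: "card (arcs E) \<le> 2 * card (orbit (\<tau> \<circ> arc_rev E) ` arcs E) + 2 * card V"
begin

definition threes :: "'a \<Rightarrow> nat" where "threes v = card {u \<in> nbrs E v. deg u = 3}"

lemma threes_le: "v \<in> V \<Longrightarrow> threes v + 6 \<le> 2 * deg v"
  unfolding threes_def by (rule three_nbrs)

lemma threes_le_deg: "threes v \<le> deg v"
  unfolding threes_def by (rule card_mono[OF finite_nbrs]) auto

lemma threes_eq_sum: "real (threes v) = (\<Sum>u\<in>nbrs E v. if deg u = 3 then 1 else 0)"
  unfolding threes_def using finite_nbrs by (simp add: sum.If_cases Int_def)

lemma deg_ge_4: assumes "adj x y" "deg x = 3" shows "4 \<le> deg y"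
proof -
  have "threes x = 0" using threes_le[OF adj_V[OF assms(1)]] assms(2) by simp
  then have "{u \<in> nbrs E x. deg u = 3} = {}" unfolding threes_def using finite_nbrs[of x] by simp
  then have "deg y \<noteq> 3" using assms(1) in_nbrs by blast
  then show ?thesis using deg_ge_3[OF adj_sym[OF assms(1)]] by simp
qed

text \<open>\<open>share y\<close> is what \<open>y\<close> absorbs from each neighbour of degree 3;
  double counting is exact because such vertices only have larger neighbours. Strictness comes from
  \<open>small\<close> if degree 3 occurs, and from \<open>S v < 0\<close> otherwise.\<close>

lemma discharge:
  fixes S share :: "'a \<Rightarrow> real"
  assumes nonneg: "0 \<le> (\<Sum>v\<in>V. S v)"
    and big: "\<And>v. v \<in> V \<Longrightarrow> 4 \<le> deg v \<Longrightarrow> S v + share v * threes v \<le> 0 \<and> S v < 0"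
    and small: "\<And>x. x \<in> V \<Longrightarrow> deg x = 3 \<Longrightarrow> S x < (\<Sum>y\<in>nbrs E x. share y)"
  shows False
proof -
  let ?A = "{v \<in> V. deg v = 3}" and ?B = "{v \<in> V. 4 \<le> deg v}"
  have "deg v = 3 \<or> 4 \<le> deg v" if "v \<in> V" for v using min_deg[OF that] by linarith
  then have V: "V = ?A \<union> ?B" "?A \<inter> ?B = {}" by auto
  have fin: "finite ?A" "finite ?B" using finite_V by auto
  have split: "(\<Sum>v\<in>V. S v) = (\<Sum>v\<in>?A. S v) + (\<Sum>v\<in>?B. S v)"
    unfolding sum.union_disjoint[OF fin V(2), symmetric] using V(1) by (rule arg_cong)
  have 1: "(\<Sum>x\<in>?A. \<Sum>y\<in>nbrs E x. share y) = (\<Sum>y\<in>?B. share y * threes y)"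
  proof -
    have "(\<Sum>x\<in>?A. \<Sum>y\<in>nbrs E x. share y) = (\<Sum>x\<in>?A. \<Sum>y | y \<in> ?B \<and> adj x y. share y)"
      by (intro sum.cong refl) (auto simp: in_nbrs adj_V2 deg_ge_4)
    also have "\<dots> = (\<Sum>y\<in>?B. \<Sum>x | x \<in> ?A \<and> adj x y. share y)"
      by (rule sum.swap_restrict[OF fin])
    also have "\<dots> = (\<Sum>y\<in>?B. share y * threes y)"
    proof (intro sum.cong refl)
      fix y
      have "{x. x \<in> ?A \<and> adj x y} = {u \<in> nbrs E y. deg u = 3}"
        by (auto simp: in_nbrs adj_V2 intro: adj_sym)
      then show "(\<Sum>x | x \<in> ?A \<and> adj x y. share y) = share y * threes y"
        by (simp add: threes_def)
    qed
    finally show ?thesis .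
  qed
  have B: "(\<Sum>y\<in>?B. S y) + (\<Sum>y\<in>?B. share y * threes y) \<le> 0"
    unfolding sum.distrib[symmetric] using big by (intro sum_nonpos) auto
  show False
  proof (cases "?A = {}")
    case True
    then have "?B \<noteq> {}" using V V_nonempty by auto
    then have "(\<Sum>v\<in>?B. S v) < (\<Sum>v\<in>?B. 0)" using big fin by (intro sum_strict_mono) auto
    then show False using split True nonneg by simp
  next
    case False
    then have "(\<Sum>x\<in>?A. S x) < (\<Sum>x\<in>?A. \<Sum>y\<in>nbrs E x. share y)"
      using small fin by (intro sum_strict_mono) auto
    then show False using split 1 B nonneg by linarith
  qed
qed

lemma charge_scaled:
  fixes w :: "nat \<Rightarrow> real" and c :: real
  assumes "c > 0" "c \<le> 3 * w 3" "c \<le> 4 * w 4" "0 < w 8" "w 8 \<le> w 5" "c \<le> 8 * w 8" "c \<le> 4 * w 5 + 2 * w 8"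
    and "\<not> contains_cycle E 5 \<or> c \<le> 5 * w 5"
    and "c \<le> 7 * w 8 \<or> \<not> contains_cycle E 7 \<and> c \<le> 2 * w 5 + 5 * w 8"
  shows "0 \<le> (\<Sum>v\<in>V. c - c / 2 * deg v + (\<Sum>u\<in>nbrs E v. w (ctype v u)))"
proof -
  have "0 \<le> (\<Sum>v\<in>V. 1 - deg v / 2 + (\<Sum>u\<in>nbrs E v. w (ctype v u) / c))"
    by (rule total_charge_nonneg[of "\<lambda>t. w t / c"])
      (use assms euler in \<open>simp_all add: face_perm_def field_simps\<close>)
  then have "0 \<le> c * (\<Sum>v\<in>V. 1 - deg v / 2 + (\<Sum>u\<in>nbrs E v. w (ctype v u) / c))"
    using assms(1) by simp
  also have "\<dots> = (\<Sum>v\<in>V. c - c / 2 * deg v + (\<Sum>u\<in>nbrs E v. w (ctype v u)))"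
    unfolding sum_distrib_left
  proof (intro sum.cong refl)
    fix v
    have "(\<Sum>u\<in>nbrs E v. w (ctype v u)) = c * (\<Sum>u\<in>nbrs E v. w (ctype v u) / c)"
      using assms(1) by (simp add: sum_divide_distrib[symmetric])
    then show "c * (1 - deg v / 2 + (\<Sum>u\<in>nbrs E v. w (ctype v u) / c)) =
      c - c / 2 * deg v + (\<Sum>u\<in>nbrs E v. w (ctype v u))"
      by (simp add: algebra_simps)
  qed
  finally show ?thesis .
qed

text \<open>Consecutive corners weigh at most 40 together, so the charge at degree d is at most 84 -
  22 d: at most -4, -26 and -48 for d = 4, d = 5 and d \<ge> 6, against at most 2, 4 and d
  neighbours of degree 3.\<close>

lemma no_5_cycle_False:
  assumes no5: "\<not> contains_cycle E 5" shows False
proof -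
  define cs where "cs v = (\<Sum>u\<in>nbrs E v. wA (ctype v u))" for v
  \<comment> \<open>A vertex of degree 3 with a 3-face has charge at most 28 + 12 + 12 - 42 = 10
    and, by \<open>not_344\<close>, a neighbour of degree at least 5. That neighbour must absorb
    more than 10 - 2 - 2 = 6, and degree 5 allows 26 / 4.\<close>
  define share where "share v = (if deg v = 4 then 2 else 31 / 5 :: real)" for v
  have cs: "cs v \<le> 20 * deg v" for v
  proof -
    have "2 * cs v = (\<Sum>u\<in>nbrs E v. wA (ctype v u) + wA (ctype v (nx v u)))"
      using sum_nbrs_nx[where v = v and f = "\<lambda>u. wA (ctype v u)"] by (simp add: cs_def sum.distrib)
    also have "\<dots> \<le> (\<Sum>u\<in>nbrs E v. 40)"
      by (rule sum_mono) (use ctype_pair_no5(1)[OF no5] in \<open>simp add: in_nbrs\<close>)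
    finally show ?thesis by simp
  qed
  show False
  proof (rule discharge[of "\<lambda>v. 84 - 84 / 2 * deg v + cs v" share])
    show "0 \<le> (\<Sum>v\<in>V. 84 - 84 / 2 * deg v + cs v)"
      unfolding cs_def by (rule charge_scaled) (simp_all add: wA_def no5)
  next
    fix v assume v: "v \<in> V" "4 \<le> deg v"
    have k: "real (threes v) \<le> deg v" using threes_le_deg by simp
    consider "deg v = 4" | "deg v = 5" | "6 \<le> deg v" using v(2) by linarith
    then show "84 - 84 / 2 * deg v + cs v + share v * threes v \<le> 0 \<and> 84 - 84 / 2 * deg v + cs v < 0"
    proof cases
      case 1
      then have "real (threes v) \<le> 2" using threes_le[OF v(1)] by simp
      then show ?thesis using cs[of v] 1 by (simp add: share_def)
    next
      case 2
      then have "real (threes v) \<le> 4" using threes_le[OF v(1)] by simp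
      then show ?thesis using cs[of v] 2 by (simp add: share_def)
    next
      case 3
      then have "6 \<le> real (deg v)" by simp
      then show ?thesis using cs[of v] 3 k by (simp add: share_def)
    qed
  next
    fix x assume x: "x \<in> V" "deg x = 3"
    have sh: "2 \<le> share y" for y by (simp add: share_def)
    show "84 - 84 / 2 * deg x + cs x < (\<Sum>y\<in>nbrs E x. share y)"
    proof (cases "\<exists>u. adj x u \<and> ctype x u = 3")
      case True
      then obtain u where u: "adj x u" "ctype x u = 3" by blast
      define b c where "b = nx x u" and "c = nx x b"
      have ab: "adj x b" "adj x c" using nx_adj u b_def c_def by auto
      note d3 = deg_3_nbrs[OF u(1) x(2), folded b_def, folded c_def]
      have "wA (ctype x u) + wA (ctype x b) \<le> 40" "wA (ctype x c) + wA (ctype x u) \<le> 40"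
        using ctype_pair_no5(1)[OF no5 u(1)] ctype_pair_no5(1)[OF no5 ab(2)] d3(1) b_def by simp_all
      then have "cs x \<le> 52" using u(2) unfolding cs_def d3(3) by (simp add: wA_def)
      moreover have "deg b \<noteq> 4 \<or> deg u \<noteq> 4"
        using not_344[of x u b] adj_of_ctype_3[OF u] u(1) ab x b_def by (auto simp: adj_def)
      then have "share u + share b + share c \<ge> 51 / 5" using sh[of c] by (auto simp: share_def)
      ultimately show ?thesis using x(2) unfolding d3(3) by simp
    next
      case False
      obtain u where u: "adj x u" using x(2) in_nbrs[of _ x] by (metis card.empty ex_in_conv zero_neq_numeral)
      define b c where "b = nx x u" and "c = nx x b"
      have ab: "adj x b" "adj x c" using nx_adj u b_def c_def by auto
      note d3 = deg_3_nbrs[OF u(1) x(2), folded b_def, folded c_def]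
      have "wA (ctype x u) + wA (ctype x b) \<le> 33" "wA (ctype x b) + wA (ctype x c) \<le> 33"
        using ctype_pair_no5(2)[OF no5 u] ctype_pair_no5(2)[OF no5 ab(1)] False u ab
        by (simp_all add: b_def c_def)
      moreover have "ctype x u \<noteq> 3" "ctype x b \<noteq> 3" "ctype x c \<noteq> 3" using False u ab by auto
      ultimately have "cs x \<le> 45"
        using ctype_cases[OF u] ctype_cases[OF ab(1)] ctype_cases[OF ab(2)]
          ctype_pair_no5(2)[OF no5 ab(2)] d3(1)
        unfolding cs_def d3(3) by (auto simp: wA_def)
      then show ?thesis using x(2) sh[of u] sh[of b] sh[of c] unfolding d3(3) by simp
    qed
  qed
qed

text \<open>\<open>u\<close> is arbitrary, so the conditions on \<open>a\<close> and
  \<open>b\<close> can be used at any two consecutive corners.\<close>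

lemma deg_4_corners:
  assumes no7: "\<not> contains_cycle E 7" and u: "adj v u" and d: "deg v = 4"
  defines "a \<equiv> ctype v u" and "b \<equiv> ctype v (nx v u)" and "s \<equiv> \<Sum>x\<in>nbrs E v. wB (ctype v x)"
  shows "s \<le> 110" "a = 4 \<or> a = 5 \<Longrightarrow> s \<le> 108"
    "a = 4 \<and> b = 8 \<or> a = 8 \<and> b = 4 \<or> a = 3 \<and> b = 4 \<or> a = 4 \<and> b = 3 \<Longrightarrow> s \<le> 100"
    "a = 5 \<and> (b = 5 \<or> b = 8) \<or> b = 5 \<and> (a = 5 \<or> a = 8) \<Longrightarrow> s \<le> 102"
proof -
  define u1 u2 u3 where "u1 = nx v u" and "u2 = nx v u1" and "u3 = nx v u2"
  have adj: "adj v u1" "adj v u2" "adj v u3" using nx_adj u u1_def u2_def u3_def by auto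
  have wrap: "nx v u3 = u" using nbrs_enum(3)[OF u] d by (simp add: funpow_numeral u1_def u2_def u3_def)
  have 4: "{..<4::nat} = {0, 1, 2, 3}" by auto
  have sum4: "s = wB (ctype v u) + wB (ctype v u1) + wB (ctype v u2) + wB (ctype v u3)"
    unfolding s_def sum_nbrs[OF u] d 4 by (simp add: funpow_numeral u1_def u2_def u3_def)
  have d4: "4 \<le> deg v" using d by simp
  note o2 = ctype_ok2[OF u, folded u1_def] ctype_ok2[OF adj(1), folded u2_def]
    ctype_ok2[OF adj(2), folded u3_def] ctype_ok2[OF adj(3), unfolded wrap]
  note o3 = ctype_ok3[OF no7 u d4, folded u1_def, folded u2_def] ctype_ok3[OF no7 adj(1) d4, folded u2_def, folded u3_def]
    ctype_ok3[OF no7 adj(2) d4, folded u3_def, unfolded wrap] ctype_ok3[OF no7 adj(3) d4, unfolded wrap, folded u1_def]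
  note f = four_corners[OF ctype_corner[OF u] ctype_corner[OF adj(1)] o2(1) ctype_corner[OF adj(2)] o2(2) o3(1)
      ctype_corner[OF adj(3)] o2(3) o3(2) o2(4) o3(3) o3(4), folded sum4, folded a_def]
  have b: "ctype v u1 = b" by (simp add: b_def u1_def)
  show "s \<le> 110" "a = 4 \<or> a = 5 \<Longrightarrow> s \<le> 108"
    "a = 4 \<and> b = 8 \<or> a = 8 \<and> b = 4 \<or> a = 3 \<and> b = 4 \<or> a = 4 \<and> b = 3 \<Longrightarrow> s \<le> 100"
    "a = 5 \<and> (b = 5 \<or> b = 8) \<or> b = 5 \<and> (a = 5 \<or> a = 8) \<Longrightarrow> s \<le> 102"
    using f unfolding b by blast+
qed

lemma three_corner_threes:
  assumes "adj v u" "ctype v u = 3"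
  shows "(if deg u = 3 then 1 else 0 :: real) + (if deg (nx v u) = 3 then 1 else 0) \<le> 1"
  using deg_ge_4[OF adj_of_ctype_3[OF assms]] by auto

lemma deg_5_corners:
  assumes no7: "\<not> contains_cycle E 7" and v: "v \<in> V" and d: "deg v = 5"
  shows "(\<Sum>x\<in>nbrs E v. wB (ctype v x)) + 21 / 2 * threes v + 5 \<le> 180"
proof -
  obtain u where u: "adj v u" using d in_nbrs[of _ v] by (metis card.empty ex_in_conv zero_neq_numeral)
  define u1 u2 u3 u4 where "u1 = nx v u" and "u2 = nx v u1" and "u3 = nx v u2" and "u4 = nx v u3"
  define th where "th x = (if deg x = 3 then 1 else 0 :: real)" for x
  have adj: "adj v u1" "adj v u2" "adj v u3" "adj v u4" using nx_adj u u1_def u2_def u3_def u4_def by auto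
  have wrap: "nx v u4 = u" using nbrs_enum(3)[OF u] d by (simp add: funpow_numeral u1_def u2_def u3_def u4_def)
  have 5: "{..<5::nat} = {0, 1, 2, 3, 4}" by auto
  have s: "(\<Sum>x\<in>nbrs E v. f x) = f u + f u1 + f u2 + f u3 + f u4" for f :: "'a \<Rightarrow> real"
    unfolding sum_nbrs[OF u] d 5 by (simp add: funpow_numeral u1_def u2_def u3_def u4_def)
  have t: "real (threes v) = th u + th u1 + th u2 + th u3 + th u4"
    unfolding threes_eq_sum s th_def by simp
  have "real (threes v) \<le> 4" using threes_le[OF v] d by simp
  then have t4: "th u + th u1 + th u2 + th u3 + th u4 \<le> 4" using t by simp
  have t1: "th x \<le> 1" for x by (simp add: th_def)
  have tc: "ctype v x = 3 \<Longrightarrow> th x + th (nx v x) \<le> 1" if "adj v x" for x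
    unfolding th_def by (rule three_corner_threes[OF that])
  have d4: "4 \<le> deg v" using d by simp
  note o2 = ctype_ok2[OF u, folded u1_def] ctype_ok2[OF adj(1), folded u2_def]
    ctype_ok2[OF adj(2), folded u3_def] ctype_ok2[OF adj(3), folded u4_def] ctype_ok2[OF adj(4), unfolded wrap]
  note o3 = ctype_ok3[OF no7 u d4, folded u1_def, folded u2_def] ctype_ok3[OF no7 adj(1) d4, folded u2_def, folded u3_def]
    ctype_ok3[OF no7 adj(2) d4, folded u3_def, folded u4_def] ctype_ok3[OF no7 adj(3) d4, folded u4_def, unfolded wrap]
    ctype_ok3[OF no7 adj(4) d4, unfolded wrap, folded u1_def]
  note tri = tc[OF u, folded u1_def] tc[OF adj(1), folded u2_def] tc[OF adj(2), folded u3_def]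
    tc[OF adj(3), folded u4_def] tc[OF adj(4), unfolded wrap]
  show ?thesis unfolding s t
    by (rule five_corners[OF ctype_corner[OF u] ctype_corner[OF adj(1)] o2(1) ctype_corner[OF adj(2)] o2(2) o3(1)
      ctype_corner[OF adj(3)] o2(3) o3(2) ctype_corner[OF adj(4)] o2(4) o3(3) o2(5) o3(4) o3(5)
      t1 t1 t1 t1 t1 t4 tri])
qed

text \<open>Charges are collected along the edges at \<open>v\<close>, each edge taking half of its two corners. Only the two
  edges of a triangular corner can exceed the average, and only one of them: the potential moves
  the excess to the other one.\<close>

lemma deg_ge_6_corners:
  assumes no7: "\<not> contains_cycle E 7" and d: "6 \<le> deg v"
  shows "(\<Sum>x\<in>nbrs E v. wB (ctype v x)) + 21 / 2 * threes v + 5 \<le> 60 * deg v - 120"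
proof -
  define th where "th x = (if deg x = 3 then 1 else 0 :: real)" for x
  define W where "W x = wB (ctype v x)" for x
  \<comment> \<open>Indexed by the corner before the edge: \<open>b x\<close> belongs to the edge
    towards \<open>nx v x\<close>.\<close>
  define b where "b x = (W x + W (nx v x)) / 2 + 21 / 2 * th (nx v x)" for x
  define pot where "pot x = (if ctype v x = 3 then b x - 75 / 2 else 0)" for x
  have t1: "0 \<le> th x" "th x \<le> 1" for x by (simp_all add: th_def)
  \<comment> \<open>The average 75 / 2 = (30 + 24) / 2 + 21 / 2 is attained by corners 4 and 5
    beside a neighbour of degree 3. It suffices from degree 6 on, as (60 - 75 / 2) * 6 = 135 exceeds
    120 + 5.\<close>
  have le: "b x \<le> 75 / 2 + pot x - pot (nx v x)" if x: "adj v x" for x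
  proof -
    define y where "y = nx v x"
    have y: "adj v y" using nx_adj[OF x] y_def by simp
    define z where "z = nx v y"
    have z: "adj v z" using nx_adj[OF y] z_def by simp
    note o = ctype_ok2[OF x, folded y_def] ctype_ok2[OF y, folded z_def] ctype_cases[OF x] ctype_cases[OF y]
    show ?thesis
    proof (cases "ctype v y = 3")
      case True
      have o3: "ok3 (ctype v x) (ctype v y) (ctype v z)"
        using ctype_ok3[OF no7 x] d by (simp add: y_def z_def)
      have "W x + W z \<le> 45"
        using True o o3 ctype_cases[OF z] by (auto simp: ok2_def ok3_def W_def wB_def)
      moreover have "th y + th z \<le> 1"
        using three_corner_threes[OF y True] by (simp add: th_def z_def)
      moreover have "W y = 40" using True by (simp add: W_def wB_def)
      then have "b x + b y = (W x + W z) / 2 + 40 + 21 / 2 * (th y + th z)"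
        by (simp add: b_def field_simps flip: y_def z_def)
      moreover have "p / 2 + 40 + 21 / 2 * q \<le> 75" if "p \<le> 45" "q \<le> 1" for p q :: real
        using that by simp
      ultimately have "b x + b y \<le> 75" by metis
      moreover have "ctype v x \<noteq> 3" using True o by (auto simp: ok2_def)
      ultimately show ?thesis
        using True by (simp add: pot_def flip: y_def)
    next
      case False
      show ?thesis
      proof (cases "ctype v x = 3")
        case True
        then show ?thesis using False by (simp add: pot_def flip: y_def)
      next
        case x3: False
        have "W x + W y \<le> 54" using False x3 o by (auto simp: ok2_def W_def wB_def)
        moreover have "p / 2 + 21 / 2 * q \<le> 75 / 2" if "p \<le> 54" "q \<le> 1" for p q :: real
          using that by simp
        ultimately have "b x \<le> 75 / 2" unfolding b_def y_def[symmetric] using t1(2)[of y] by blast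
        then show ?thesis using False x3 by (simp add: pot_def flip: y_def)
      qed
    qed
  qed
  have "(\<Sum>x\<in>nbrs E v. b x) \<le> (\<Sum>x\<in>nbrs E v. 75 / 2 + pot x - pot (nx v x))"
    by (rule sum_mono) (use le in \<open>simp add: in_nbrs\<close>)
  also have "\<dots> = 75 / 2 * deg v"
    using sum_nbrs_nx[where f = pot and v = v] by (simp add: sum.distrib sum_subtractf)
  finally have "(\<Sum>x\<in>nbrs E v. b x) \<le> 75 / 2 * deg v" .
  moreover have "(\<Sum>x\<in>nbrs E v. b x) = (\<Sum>x\<in>nbrs E v. W x) + 21 / 2 * threes v"
  proof -
    have "(\<Sum>x\<in>nbrs E v. b x) = ((\<Sum>x\<in>nbrs E v. W x) + (\<Sum>x\<in>nbrs E v. W (nx v x))) / 2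
        + 21 / 2 * (\<Sum>x\<in>nbrs E v. th (nx v x))"
      unfolding b_def sum.distrib sum_divide_distrib[symmetric] sum_distrib_left[symmetric] ..
    then show ?thesis
      using sum_nbrs_nx[where f = W and v = v] sum_nbrs_nx[where f = th and v = v]
      by (simp add: threes_eq_sum th_def)
  qed
  ultimately show ?thesis using d unfolding W_def by simp
qed

text \<open>Transfers face lengths known at a vertex to the corners at its neighbours.\<close>

lemma flen_next: "adj v u \<Longrightarrow> flen (nx v u) v = flen v u"
  unfolding flen_def using orbit_funpow[of 1 "(u, v)"] face_step(1)[of v u] by simp

lemma ex_prev: assumes "adj v x" obtains q where "adj v q" "nx v q = x"
proof -
  have "deg v = Suc (deg v - 1)" using deg_ge_3[OF assms] by simp
  then have "nx v ((nx v ^^ (deg v - 1)) x) = x"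
    using nbrs_enum(3)[OF assms] by (metis comp_apply funpow.simps(2))
  then show ?thesis using that nx_funpow_adj[OF assms] by blast
qed

text \<open>A vertex of degree 3 with corners 3, 4, 8 needs 25 units from its neighbours, one with corners 4, 5, 5 needs
  18, and all others need less than 15, while every neighbour gives at least 5.\<close>

lemma no_7_cycle_False:
  assumes no7: "\<not> contains_cycle E 7" shows False
proof -
  define cs where "cs v = (\<Sum>u\<in>nbrs E v. wB (ctype v u))" for v
  \<comment> \<open>At degree 4 the reserve is halved, as at most two neighbours have degree 3.
    Elsewhere more than 10 is wanted for the corners 3, 4, 8, and 21 / 2 is still affordable at
    degree 5: 132 + 4 * 21 / 2 + 5 \<le> 180.\<close>
  define share where "share v = (if deg v = 4 then (120 - cs v) / 2 else 21 / 2 :: real)" for v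
  note d4 = deg_4_corners[OF no7, folded cs_def]
  show False
  proof (rule discharge[of "\<lambda>v. 120 - 120 / 2 * deg v + cs v" share])
    show "0 \<le> (\<Sum>v\<in>V. 120 - 120 / 2 * deg v + cs v)"
      unfolding cs_def by (rule charge_scaled) (simp_all add: wB_def no7)
  next
    fix v assume v: "v \<in> V" "4 \<le> deg v"
    consider "deg v = 4" | "deg v = 5" | "6 \<le> deg v" using v(2) by linarith
    then show "120 - 120 / 2 * deg v + cs v + share v * threes v \<le> 0 \<and> 120 - 120 / 2 * deg v + cs v < 0"
    proof cases
      case 1
      then have "nbrs E v \<noteq> {}" by auto
      then obtain u where u: "adj v u" using in_nbrs by blast
      have c: "cs v \<le> 110" by (rule d4(1)[OF u 1])
      have "real (threes v) \<le> 2" using threes_le[OF v(1)] 1 by simp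
      then have "share v * threes v \<le> share v * 2" using c 1 by (intro mult_left_mono) (simp_all add: share_def)
      then show ?thesis using c 1 by (simp add: share_def)
    next
      case 2
      have "cs v + 21 / 2 * threes v + 5 \<le> 180" using deg_5_corners[OF no7 v(1) 2] by (simp add: cs_def)
      then show ?thesis using 2 by (simp add: share_def)
    next
      case 3
      have "cs v + 21 / 2 * threes v + 5 \<le> 60 * deg v - 120"
        using deg_ge_6_corners[OF no7 3] by (simp add: cs_def)
      then show ?thesis using 3 by (simp add: share_def)
    qed
  next
    fix x assume x: "x \<in> V" "deg x = 3"
    have big: "21 / 2 \<le> share y" if "deg y \<noteq> 4" for y using that by (simp add: share_def)
    have sh: "5 \<le> share y" if y: "adj x y" for y
      using d4(1)[OF adj_sym[OF y]] by (cases "deg y = 4") (simp_all add: share_def)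
    have sh6: "6 \<le> share y" if y: "adj y u" "ctype y u = 4 \<or> ctype y u = 5" for y u
      using d4(2)[OF y(1) _ y(2)] by (cases "deg y = 4") (simp_all add: share_def)
    have sh10: "10 \<le> share y" if y: "adj y u" "ctype y u = 4 \<and> ctype y (nx y u) = 8 \<or> ctype y u = 8 \<and> ctype y (nx y u) = 4 \<or>
      ctype y u = 3 \<and> ctype y (nx y u) = 4 \<or> ctype y u = 4 \<and> ctype y (nx y u) = 3" for y u
      using d4(3)[OF y(1) _ y(2)] by (cases "deg y = 4") (simp_all add: share_def)
    have sh9: "9 \<le> share y" if y: "adj y u" "ctype y u = 5 \<and> (ctype y (nx y u) = 5 \<or> ctype y (nx y u) = 8) \<or>
      ctype y (nx y u) = 5 \<and> (ctype y u = 5 \<or> ctype y u = 8)" for y u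
      using d4(4)[OF y(1) _ y(2)] by (cases "deg y = 4") (simp_all add: share_def)
    have ct34: "ctype y u = flen y u" if "flen y u \<le> 5" for y u using that by (simp add: ctype_def)
    show "120 - 120 / 2 * deg x + cs x < (\<Sum>y\<in>nbrs E x. share y)"
    proof (cases "\<exists>u. adj x u \<and> ctype x u = 4")
      case False
      have "nbrs E x \<noteq> {}" using x(2) by auto
      then obtain u where u: "adj x u" using in_nbrs by blast
      define b c where "b = nx x u" and "c = nx x b"
      have ab: "adj x b" "adj x c" using nx_adj u b_def c_def by auto
      note d3 = deg_3_nbrs[OF u(1) x(2), folded b_def, folded c_def]
      have n4: "ctype x u \<noteq> 4" "ctype x b \<noteq> 4" "ctype x c \<noteq> 4" using False u ab by auto
      have o: "ok2 (ctype x u) (ctype x b)" "ok2 (ctype x b) (ctype x c)" "ok2 (ctype x c) (ctype x u)"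
        using ctype_ok2[OF u] ctype_ok2[OF ab(1)] ctype_ok2[OF ab(2)] d3(1) by (simp_all add: b_def c_def)
      have "wB (ctype x u) + wB (ctype x b) + wB (ctype x c) \<le> 72"
        by (rule three_corners(1)[OF ctype_corner[OF u] ctype_corner[OF ab(1)] o(1) ctype_corner[OF ab(2)] o(2,3) n4])
      then show ?thesis using x(2) sh[OF u] sh[OF ab(1)] sh[OF ab(2)] unfolding cs_def d3(3) by simp
    next
      case True
      then obtain u where u: "adj x u" "ctype x u = 4" by blast
      define b c where "b = nx x u" and "c = nx x b"
      have ab: "adj x b" "adj x c" using nx_adj u b_def c_def by auto
      note d3 = deg_3_nbrs[OF u(1) x(2), folded b_def, folded c_def]
      have cu: "nx x c = u" using d3(1) .
      have f4: "flen x u = 4" by (rule ctype_4[OF u(2)])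
      note q4 = face4[OF u(1) f4 b_def refl]
      have ub: "\<not> adj u b" using q4 by simp
      have o: "ok2 (ctype x u) (ctype x b)" "ok2 (ctype x b) (ctype x c)" "ok2 (ctype x c) (ctype x u)"
        using ctype_ok2[OF u(1)] ctype_ok2[OF ab(1)] ctype_ok2[OF ab(2)] cu by (simp_all add: b_def c_def)
      have nb: "r = u \<or> r = b \<or> r = c" if "adj x r" for r
        using that d3(2) in_nbrs[of r x] by auto
      have ne: "u \<noteq> b" "b \<noteq> c" "u \<noteq> c"
        using nx1[OF u(1)] nx1[OF ab(1)] nx2[OF u(1)] by (simp_all add: b_def c_def)
      \<comment> \<open>The predecessors of \<open>x\<close> in the rotations of its neighbours: at
        each neighbour, the two corners beside the edge to \<open>x\<close> belong to the two faces
        at that edge.\<close>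
      obtain qu where qu: "adj u qu" "nx u qu = x" by (rule ex_prev[OF adj_sym[OF u(1)]]) (rule that)
      obtain qb where qb: "adj b qb" "nx b qb = x" by (rule ex_prev[OF adj_sym[OF ab(1)]]) (rule that)
      obtain qc where qc: "adj c qc" "nx c qc = x" by (rule ex_prev[OF adj_sym[OF ab(2)]]) (rule that)
      have fu: "flen u qu = 4" "flen u x = flen x c"
        using flen_next[OF qu(1)] flen_next[OF ab(2)] qu(2) cu f4 by simp_all
      have fb: "flen b qb = flen x b" "flen b x = 4"
        using flen_next[OF qb(1)] flen_next[OF u(1)] qb(2) f4 by (simp_all add: b_def)
      have fc: "flen c qc = flen x c" "flen c x = flen x b"
        using flen_next[OF qc(1)] flen_next[OF ab(1)] qc(2) by (simp_all add: c_def)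
      have tu: "ctype u qu = 4" using ct34[of u qu] fu by simp
      have tb: "ctype b x = 4" using ct34[of b x] fb by simp
      have s: "cs x = wB (ctype x u) + wB (ctype x b) + wB (ctype x c)"
        unfolding cs_def d3(3) ..
      consider (a) "ctype x b = 3" "ctype x c = 8" | (b) "ctype x b = 8" "ctype x c = 3"
        | (c) "ctype x b = 5" "ctype x c = 5" | (d) "cs x \<le> 72"
        using three_corners(2)[OF ctype_corner[OF u(1)] ctype_corner[OF ab(1)] o(1) ctype_corner[OF ab(2)] o(2,3) u(2)]
        unfolding s by blast
      then show ?thesis
      proof cases
        case a
        note t = face3[OF ab(1) ctype_3[OF a(1)] c_def]
        have "ctype b qb = 3" using ct34[of b qb] fb ctype_3[OF a(1)] by simp
        then have B: "10 \<le> share b" using sh10[OF qb(1)] qb(2) tb by simp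
        \<comment> \<open>The long face must not become triangular at \<open>u\<close>: its third
          vertex would be \<open>b\<close>, a chord of the 4-face, or \<open>c\<close>, making the
          corner at \<open>x\<close> triangular against type 8.\<close>
        have "\<not> adj x (nx u x)"
        proof
          assume r: "adj x (nx u x)"
          have ur: "adj u (nx u x)" by (rule nx_adj[OF adj_sym[OF u(1)]])
          have "nx u x \<noteq> u" using adj_neq[OF ur] by simp
          then consider "nx u x = b" | "nx u x = c" using nb[OF r] by blast
          then show False
          proof cases
            case 1 then show ?thesis using ur ub by simp
          next
            case 2 then show ?thesis using ur ctype_8[OF a(2)] cu adj_sym by auto
          qed
        qed
        then have "ctype u x = 8" using fu ctype_8[OF a(2)] by (simp add: ctype_def)
        then have U: "10 \<le> share u" using sh10[OF qu(1)] qu(2) tu by simp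
        have "deg b \<noteq> 4 \<or> deg c \<noteq> 4"
          using not_344[of x b c] ab t x(2) adj_sym[OF t(4)] by (auto simp: adj_def insert_commute)
        \<comment> \<open>The smaller sum is 21 / 2 + 5, with \<open>b\<close> large; a large
          \<open>c\<close> gives 10 + 21 / 2. Together with the 10 of \<open>u\<close> this exceeds
          25.\<close>
        then have "share b + share c \<ge> 31 / 2" using big[of b] big[of c] sh[OF ab(1)] sh[OF ab(2)] B by auto
        then show ?thesis using x(2) U unfolding s d3(3) by (simp add: a u(2) wB_def)
      next
        case b
        note t = face3[OF ab(2) ctype_3[OF b(2)] cu[symmetric]]
        have "ctype u x = 3" using ct34[of u x] fu ctype_3[OF b(2)] by simp
        then have U: "10 \<le> share u" using sh10[OF qu(1)] qu(2) tu by simp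
        have "\<not> adj qb x"
        proof
          assume r: "adj qb x"
          have "qb \<noteq> b" using adj_neq[OF qb(1)] by simp
          then consider "qb = u" | "qb = c" using nb[OF adj_sym[OF r]] by blast
          then show False
          proof cases
            case 1 then show ?thesis using qb(1) ub adj_sym by blast
          next
            case 2 then show ?thesis using qb(1) ctype_8[OF b(1)] by (simp add: c_def)
          qed
        qed
        then have "ctype b qb = 8" using fb qb(2) ctype_8[OF b(1)] by (simp add: ctype_def)
        then have B: "10 \<le> share b" using sh10[OF qb(1)] qb(2) tb by simp
        have "deg u \<noteq> 4 \<or> deg c \<noteq> 4"
          using not_344[of x u c] ab u t x(2) adj_sym[OF t(4)] by (auto simp: adj_def insert_commute)
        then have "share u + share c \<ge> 31 / 2" using big[of u] big[of c] sh[OF u(1)] sh[OF ab(2)] U by auto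
        then show ?thesis using x(2) B unfolding s d3(3) by (simp add: b u(2) wB_def)
      next
        case c
        have U: "6 \<le> share u" using sh6[OF qu(1)] tu by simp
        have B: "6 \<le> share b" using sh6[OF adj_sym[OF ab(1)]] tb by simp
        \<comment> \<open>Were both corners triangular, two triangles would share the edge
          \<open>x c\<close>. So one is a true 5-face, which \<open>c\<close> also sees as type
          5.\<close>
        have five: "flen x b = 5 \<or> flen x c = 5"
        proof (rule ccontr)
          assume "\<not> ?thesis"
          then have "adj b c" "adj c u" using ctype_5[OF c(1)] ctype_5[OF c(2)] cu by (auto simp: c_def)
          then have "b = u" using diamond[of x c b u] ab u(1) adj_sym by blast
          then show False using ne by simp
        qed
        have ge5: "5 \<le> flen x b" "5 \<le> flen x c" using ctype_5[OF c(1)] ctype_5[OF c(2)] by auto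
        have t58: "ctype y w = 5 \<or> ctype y w = 8" if "5 \<le> flen y w" for y w
          using that by (auto simp: ctype_def)
        have "ctype c qc = 5 \<or> ctype c x = 5"
          using five fc ct34[of c qc] ct34[of c x] by auto
        then have C: "9 \<le> share c"
          using sh9[OF qc(1)] qc(2) t58[of c qc] t58[of c x] fc ge5 by auto
        show ?thesis using x(2) U B C unfolding s d3(3) by (simp add: c u(2) wB_def)
      next
        case d
        then show ?thesis using x(2) sh[OF u(1)] sh[OF ab(1)] sh[OF ab(2)] unfolding d3(3) by simp
      qed
    qed
  qed
qed

end

section \<open>Passing to the critical subgraph\<close>

lemma toroidal_induced:
  assumes "toroidal V E" "W \<subseteq> V" shows "toroidal W (induced E W)"
proof -
  obtain p \<gamma> where emb: "torus_embedding V E p \<gamma>" and G: "simple_graph V E"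
    using assms(1) by (auto simp: toroidal_def)
  have "torus_embedding W (induced E W) p \<gamma>"
    unfolding torus_embedding_def
  proof (intro conjI ballI impI)
    show "inj_on p W" using emb assms(2) by (auto simp: torus_embedding_def intro: inj_on_subset)
    show "p ` W \<subseteq> torus" using emb assms(2) by (auto simp: torus_embedding_def)
  next
    fix e assume e: "e \<in> induced E W"
    then have e': "e \<in> E" "e \<subseteq> W" by (auto simp: induced_def)
    show "arc (\<gamma> e)" "path_image (\<gamma> e) \<subseteq> torus" "{pathstart (\<gamma> e), pathfinish (\<gamma> e)} = p ` e"
      using emb e'(1) by (auto simp: torus_embedding_def)
    have "path_image (\<gamma> e) \<inter> p ` V = p ` e" using emb e'(1) by (auto simp: torus_embedding_def)
    then show "path_image (\<gamma> e) \<inter> p ` W = p ` e" using e'(2) assms(2) by blast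
  next
    fix e f assume "e \<in> induced E W" "f \<in> induced E W" "e \<noteq> f"
    then show "path_image (\<gamma> e) \<inter> path_image (\<gamma> f) = p ` (e \<inter> f)"
      using emb by (simp add: torus_embedding_def induced_def)
  qed
  moreover have "simple_graph W (induced E W)"
    using G assms(2) by (auto simp: simple_graph_def induced_def intro: finite_subset)
  ultimately show ?thesis by (auto simp: toroidal_def)
qed

lemma contains_cycle_mono: "contains_cycle E n \<Longrightarrow> E \<subseteq> F \<Longrightarrow> contains_cycle F n"
  unfolding contains_cycle_def graph_cycle_def by blast

lemma triangleI:
  assumes "\<And>e. e \<in> E \<Longrightarrow> card e = 2" "{u, v} \<in> E" "{v, w} \<in> E" "{u, w} \<in> E"
  shows "triangle E {u, v, w}"
proof -
  have "distinct [u, v, w]" using assms(1)[OF assms(2)] assms(1)[OF assms(3)] assms(1)[OF assms(4)] by auto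
  moreover have "\<forall>i<3. {[u, v, w] ! i, [u, v, w] ! (Suc i mod 3)} \<in> E"
  proof (intro allI impI)
    have wu: "{w, u} \<in> E" using assms(4) by (simp add: insert_commute)
    fix i :: nat assume "i < 3"
    then consider "i = 0" | "i = 1" | "i = 2" by linarith
    then show "{[u, v, w] ! i, [u, v, w] ! (Suc i mod 3)} \<in> E"
      by cases (use assms(2,3) wu in simp_all)
  qed
  ultimately have "graph_cycle E [u, v, w]" by (simp add: graph_cycle_def)
  then show ?thesis unfolding triangle_def by (intro exI[of _ "[u, v, w]"]) simp
qed

theorem theorem2:
  fixes V :: "'a set" and E :: "'a set set"
  assumes "toroidal V E"
    and "\<not> (\<exists>S T. adjacent_triangles E S T)"
    and "\<not> contains_cycle E 6"
    and "\<exists>l\<in>{5, 7}. \<not> contains_cycle E l"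
  shows "defective_choosable TYPE('c) 3 1 V E"
proof (rule ccontr)
  assume nc: "\<not> defective_choosable TYPE('c) 3 1 V E"
  have G: "simple_graph V E" using assms(1) by (simp add: toroidal_def)
  have E2: "card e = 2" if "e \<in> E" for e using G that by (simp add: simple_graph_def)
  show False
  proof (rule minimal_uncolorable[OF G nc])
    fix W assume W: "W \<subseteq> V" "W \<noteq> {}"
      and star: "\<And>v K. v \<in> W \<Longrightarrow> K \<subseteq> nbrs (induced E W) v \<Longrightarrow> (\<And>x. x \<in> K \<Longrightarrow> card (nbrs (induced E W) x) = 3) \<Longrightarrow>
        (\<And>x y. x \<in> K \<Longrightarrow> y \<in> K \<Longrightarrow> {x, y} \<notin> E) \<Longrightarrow> card K + 6 \<le> 2 * card (nbrs (induced E W) v)"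
      and tri: "\<And>x y z. {x, y} \<in> induced E W \<Longrightarrow> {y, z} \<in> induced E W \<Longrightarrow> {x, z} \<in> induced E W \<Longrightarrow>
        card (nbrs (induced E W) x) = 3 \<Longrightarrow> card (nbrs (induced E W) y) = 4 \<Longrightarrow> card (nbrs (induced E W) z) \<noteq> 4"
    let ?F = "induced E W"
    have FE: "?F \<subseteq> E" by (auto simp: induced_def)
    have F: "e \<subseteq> W \<and> card e = 2" if "e \<in> ?F" for e using that E2 by (auto simp: induced_def)
    have T: "toroidal W ?F" by (rule toroidal_induced[OF assms(1) W(1)])
    have loop: "{x} \<notin> E" for x using E2[of "{x}"] by auto
    have deg: "3 \<le> card (nbrs ?F v)" if "v \<in> W" for v
      using star[OF that, of "{}"] by simp
    have no33: "{x, y} \<notin> ?F" if "card (nbrs ?F x) = 3" "card (nbrs ?F y) = 3" for x y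
    proof
      assume e: "{x, y} \<in> ?F"
      then have x: "x \<in> W" "y \<in> nbrs ?F x" by (auto simp: induced_def nbrs_def)
      then have "card {y} + 6 \<le> 2 * card (nbrs ?F x)"
        by (intro star) (use that loop in auto)
      then show False using that by simp
    qed
    have iso: "\<exists>e\<in>?F. v \<in> e" if "v \<in> W" for v
    proof -
      have "nbrs ?F v \<noteq> {}" using deg[OF that] by auto
      then show ?thesis by (auto simp: nbrs_def)
    qed
    obtain \<tau> where \<tau>: "rotation_system ?F \<tau>"
      "card (arcs ?F) \<le> 2 * card (orbit (\<tau> \<circ> arc_rev ?F) ` arcs ?F) + 2 * card W"
      by (rule toroidal_rotation_system[OF T W(2) iso]) (assumption, rule that)
    interpret critical_map W ?F \<tau>
    proof
      show "finite W" using T by (simp add: toroidal_def simple_graph_def)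
      show "e \<subseteq> W \<and> card e = 2" if "e \<in> ?F" for e using F[OF that] .
      show "rotation_system ?F \<tau>" by (rule \<tau>)
      show "3 \<le> card (nbrs ?F v)" if "v \<in> W" for v using deg[OF that] .
      show "\<not> contains_cycle ?F 6" using assms(3) contains_cycle_mono[OF _ FE] by blast
      show "W \<noteq> {}" by (rule W)
      show "card (arcs ?F) \<le> 2 * card (orbit (\<tau> \<circ> arc_rev ?F) ` arcs ?F) + 2 * card W" by (rule \<tau>)
      \<comment> \<open>All neighbours of degree 3 together form an admissible star, since no two of
        them are adjacent.\<close>
      show "card {u \<in> nbrs ?F v. card (nbrs ?F u) = 3} + 6 \<le> 2 * card (nbrs ?F v)" if "v \<in> W" for v
      proof (rule star[OF that])
        fix x y assume xy: "x \<in> {u \<in> nbrs ?F v. card (nbrs ?F u) = 3}" "y \<in> {u \<in> nbrs ?F v. card (nbrs ?F u) = 3}"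
        then have "x \<in> W" "y \<in> W" by (auto simp: nbrs_def induced_def)
        then show "{x, y} \<notin> E" using no33[of x y] xy by (auto simp: induced_def)
      qed auto
      show "card (nbrs ?F z) \<noteq> 4"
        if "{x, y} \<in> ?F" "{y, z} \<in> ?F" "{x, z} \<in> ?F" "card (nbrs ?F x) = 3" "card (nbrs ?F y) = 4" for x y z
        using tri[OF that] .
      \<comment> \<open>Two triangles on \<open>u v\<close> with distinct third vertices are
        adjacent triangles, whether or not they bound faces.\<close>
      show "x = y" if e: "{u, v} \<in> ?F" "{u, x} \<in> ?F" "{v, x} \<in> ?F" "{u, y} \<in> ?F" "{v, y} \<in> ?F" for u v x y
      proof (rule ccontr)
        assume ne: "x \<noteq> y"
        have e': "{u, v} \<in> E" "{u, x} \<in> E" "{v, x} \<in> E" "{u, y} \<in> E" "{v, y} \<in> E" using e FE by auto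
        have "triangle E {u, v, x}" "triangle E {u, v, y}"
          using triangleI[OF E2 e'(1,3,2)] triangleI[OF E2 e'(1,5,4)] by auto
        moreover have "{u, v, x} \<noteq> {u, v, y}"
        proof
          assume "{u, v, x} = {u, v, y}"
          then have "x \<in> {u, v, y}" by blast
          then show False using ne e' loop by auto
        qed
        moreover have "{u, v} \<subseteq> {u, v, x}" "{u, v} \<subseteq> {u, v, y}" by auto
        ultimately have "adjacent_triangles E {u, v, x} {u, v, y}"
          unfolding adjacent_triangles_def using e'(1) by blast
        then show False using assms(2) by blast
      qed
    qed
    obtain l where "l = 5 \<or> l = 7" "\<not> contains_cycle E l" using assms(4) by blast
    then show False
      using no_5_cycle_False no_7_cycle_False contains_cycle_mono[OF _ FE] by blast
  qed
qed

end
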